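(* Let $\sigma=F(q_1,q_2)\,dq_1\wedge dq_2$ be a nondegenerate magnetic two-form on the flat torus $\mathbb T^2$, where $F$ is a smooth positive function, and let $\overline F$ and $\underline F$ denote the maximum and minimum values of $F$. Suppose that $$V_F:=\overline F/\underline F<\sqrt{\pi/2}.$$ Then, for the corresponding magnetic flow on $T^*\mathbb T^2$, there is a contractible periodic orbit on every sufficiently low energy level $\{H=E\}$, $E>0$. Moreover, the symplectic areas of these orbits are uniformly bounded. (That is, there exist $E_0>0$ and $K>0$ such that for every $E\in(0,E_0)$ the level $\{H=E\}$ carries a contractible periodic orbit $x$ with $|\mathcal A(x)|\le K$.)
   Context: $\mathbb T^2$ is the two-torus with its standard flat metric, with angular coordinates $(q_1,q_2)$ and conjugate momenta $(p_1,p_2)$ on $T^*\mathbb T^2$. The magnetic flow is the flow on $T^*\mathbb T^2$ of the Hamiltonian vector field $X_H$ of the kinetic energy $H=\tfrac12(p_1^2+p_2^2)$ with respect to the twisted symplectic form $\Omega_\sigma=d\lambda+\pi^*\sigma$, where $\lambda=p_1dq_1+p_2dq_2$, $\pi:T^*\mathbb T^2\to\mathbb T^2$ is the projection, and $\Omega_\sigma(X_H,\cdot)=-dH(\cdot)$. On $\{H=E\}$, writing $p_1=r\cos\theta$, $p_2=r\sin\theta$, it is given by $\dot q_1=\sqrt{2E}\cos\theta$, $\dot q_2=\sqrt{2E}\sin\theta$, $\dot\theta=-F(q_1,q_2)$. Contractible means contractible in $T^*\mathbb T^2$, and the symplectic area of a contractible loop $x$ is $\mathcal A(x)=\int_{D^2}v^*\Omega_\sigma$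 for any smooth disc $v$ in $T^*\mathbb T^2$ with $v|_{\partial D^2}=x$. *)

theory Defs
  imports "HOL-Analysis.Analysis"
begin

primrec Ck_on :: "nat \<Rightarrow> ('a::real_normed_vector \<Rightarrow> 'b::real_normed_vector) \<Rightarrow> 'a set \<Rightarrow> bool" where
  "Ck_on 0 f S \<longleftrightarrow> continuous_on S f"
| "Ck_on (Suc k) f S \<longleftrightarrow>
     (\<forall>x\<in>S. f differentiable (at x)) \<and> (\<forall>v. Ck_on k (\<lambda>x. frechet_derivative f (at x) v) S)"

text \<open>Only meaningful for open \<open>S\<close>, since derivatives are taken in the ambient space.\<close>

definition smooth_on :: "('a::real_normed_vector \<Rightarrow> 'b::real_normed_vector) \<Rightarrow> 'a set \<Rightarrow> bool" where
  "smooth_on f S \<longleftrightarrow> (\<forall>k. Ck_on k f S)"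

text \<open>
  The two-torus is the product of two unit circles in the complex plane; its angular coordinates
  are defined by \<open>z\<^sub>j = cis q\<^sub>j\<close>. The forms \<open>dq\<^sub>1, dq\<^sub>2\<close> trivialise the cotangent bundle, which is
  therefore the torus times \<open>\<real>\<^sup>2\<close>, with momenta \<open>(p\<^sub>1, p\<^sub>2)\<close>. All of this is embedded in
  \<open>\<complex>\<^sup>2 \<times> \<real>\<^sup>2\<close>, and tangent vectors are vectors of the ambient space.
\<close>

type_synonym phase = "(complex \<times> complex) \<times> (real \<times> real)"

definition torus :: "(complex \<times> complex) set" where
  "torus = sphere 0 1 \<times> sphere 0 1"

definition cotangent_torus :: "phase set" where
  "cotangent_torus = torus \<times> UNIV"

definition tangent_space :: "phase \<Rightarrow> phase set" where
  "tangent_space x =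
     {X. fst (fst x) \<bullet> fst (fst X) = 0 \<and> snd (fst x) \<bullet> snd (fst X) = 0}"

text \<open>
  The map \<open>(q\<^sub>1, q\<^sub>2) \<mapsto> (cis q\<^sub>1, cis q\<^sub>2)\<close> is a covering whose local inverses are the charts
  of the torus. Values of the function off the torus are irrelevant.
\<close>

definition smooth_on_torus :: "(complex \<times> complex \<Rightarrow> real) \<Rightarrow> bool" where
  "smooth_on_torus F \<longleftrightarrow> smooth_on (\<lambda>q::real \<times> real. F (cis (fst q), cis (snd q))) UNIV"

text \<open>
  Along \<open>z = cis q\<close> one has \<open>dz = \<i> z dq\<close>, hence \<open>dq = Im (cnj z dz)\<close> as \<open>\<bar>z\<bar> = 1\<close>. The first
  argument of \<open>dq1\<close> and \<open>dq2\<close> is the base point in the torus.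
\<close>

definition dq1 :: "complex \<times> complex \<Rightarrow> complex \<times> complex \<Rightarrow> real" where
  "dq1 z w = Im (cnj (fst z) * fst w)"

definition dq2 :: "complex \<times> complex \<Rightarrow> complex \<times> complex \<Rightarrow> real" where
  "dq2 z w = Im (cnj (snd z) * snd w)"

definition dp1 :: "phase \<Rightarrow> real" where
  "dp1 X = fst (snd X)"

definition dp2 :: "phase \<Rightarrow> real" where
  "dp2 X = snd (snd X)"

definition wedge :: "('a \<Rightarrow> real) \<Rightarrow> ('a \<Rightarrow> real) \<Rightarrow> 'a \<Rightarrow> 'a \<Rightarrow> real" where
  "wedge \<alpha> \<beta> X Y = \<alpha> X * \<beta> Y - \<alpha> Y * \<beta> X"

text \<open>The exterior derivative \<open>dp\<^sub>1 \<and> dq\<^sub>1 + dp\<^sub>2 \<and> dq\<^sub>2\<close> of \<open>\<lambda> = p\<^sub>1 dq\<^sub>1 + p\<^sub>2 dq\<^sub>2\<close>.\<close>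

definition canonical_form :: "phase \<Rightarrow> phase \<Rightarrow> phase \<Rightarrow> real" where
  "canonical_form x X Y =
     wedge dp1 (\<lambda>Z. dq1 (fst x) (fst Z)) X Y + wedge dp2 (\<lambda>Z. dq2 (fst x) (fst Z)) X Y"

definition magnetic_form ::
    "(complex \<times> complex \<Rightarrow> real) \<Rightarrow> complex \<times> complex \<Rightarrow> complex \<times> complex \<Rightarrow> complex \<times> complex \<Rightarrow> real"
  where "magnetic_form F z u v = F z * wedge (dq1 z) (dq2 z) u v"

text \<open>
  The projection to the torus is \<open>fst\<close>, and so is its differential; the second summand is the
  pullback of the magnetic form.
\<close>

definition twisted_form :: "(complex \<times> complex \<Rightarrow> real) \<Rightarrow> phase \<Rightarrow> phase \<Rightarrow> phase \<Rightarrow> real" where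
  "twisted_form F x X Y = canonical_form x X Y + magnetic_form F (fst x) (fst X) (fst Y)"

definition kinetic_energy :: "phase \<Rightarrow> real" where
  "kinetic_energy x = ((fst (snd x))\<^sup>2 + (snd (snd x))\<^sup>2) / 2"

definition is_hamiltonian_vector ::
    "(complex \<times> complex \<Rightarrow> real) \<Rightarrow> (phase \<Rightarrow> real) \<Rightarrow> phase \<Rightarrow> phase \<Rightarrow> bool" where
  "is_hamiltonian_vector F H x X \<longleftrightarrow>
     X \<in> tangent_space x \<and>
     (\<forall>Y\<in>tangent_space x. twisted_form F x X Y = - frechet_derivative H (at x) Y)"

definition magnetic_trajectory ::
    "(complex \<times> complex \<Rightarrow> real) \<Rightarrow> (real \<Rightarrow> phase) \<Rightarrow> bool" where
  "magnetic_trajectory F x \<longleftrightarrow>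
     (\<forall>t. x t \<in> cotangent_torus) \<and>
     (\<forall>t. \<exists>X. is_hamiltonian_vector F kinetic_energy (x t) X \<and>
              (x has_vector_derivative X) (at t))"

text \<open>\<open>T\<close> is some positive period, not necessarily the minimal one.\<close>

definition periodic_orbit ::
    "(complex \<times> complex \<Rightarrow> real) \<Rightarrow> real \<Rightarrow> (real \<Rightarrow> phase) \<Rightarrow> bool" where
  "periodic_orbit F T x \<longleftrightarrow> T > 0 \<and> magnetic_trajectory F x \<and> (\<forall>t. x (t + T) = x t)"

definition contractible_loop :: "real \<Rightarrow> (real \<Rightarrow> phase) \<Rightarrow> bool" where
  "contractible_loop T x \<longleftrightarrow>
     (\<exists>a. homotopic_loops cotangent_torus (\<lambda>s. x (T * s)) (\<lambda>_. a))"

text \<open>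
  The disc is the closed unit disc of the complex plane, with boundary parametrised
  counterclockwise. A map on it is smooth if it extends smoothly, as a map into the ambient vector
  space, to a neighbourhood; the extension need not stay in the cotangent bundle.
\<close>

definition smooth_capping_disc :: "real \<Rightarrow> (real \<Rightarrow> phase) \<Rightarrow> (complex \<Rightarrow> phase) \<Rightarrow> bool" where
  "smooth_capping_disc T x v \<longleftrightarrow>
     (\<exists>U. open U \<and> cball 0 1 \<subseteq> U \<and> smooth_on v U) \<and>
     v ` cball 0 1 \<subseteq> cotangent_torus \<and>
     (\<forall>s. v (cis (2 * pi * s)) = x (T * s))"

definition disc_area :: "(complex \<times> complex \<Rightarrow> real) \<Rightarrow> (complex \<Rightarrow> phase) \<Rightarrow> real" where
  "disc_area F v =
     integral (cball 0 1)
       (\<lambda>\<zeta>. twisted_form F (v \<zeta>)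
              (frechet_derivative v (at \<zeta>) 1) (frechet_derivative v (at \<zeta>) \<i>))"

text \<open>
  The area of a loop is the common value of \<open>disc_area\<close> on all its capping discs. Existence of a
  capping disc is part of the definition, so that it is not vacuous.
\<close>

definition has_symplectic_area ::
    "(complex \<times> complex \<Rightarrow> real) \<Rightarrow> real \<Rightarrow> (real \<Rightarrow> phase) \<Rightarrow> real \<Rightarrow> bool" where
  "has_symplectic_area F T x A \<longleftrightarrow>
     (\<exists>v. smooth_capping_disc T x v) \<and>
     (\<forall>v. smooth_capping_disc T x v \<longrightarrow> disc_area F v = A)"

end

theory Submission
  imports Defs
begin

text \<open>
  Let \<open>f\<close> be the lift of \<open>F\<close> to the universal cover \<open>\<complex>\<close> of the torus, with \<open>q = q\<^sub>1 + \<i> q\<^sub>2\<close>, and let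
  \<open>\<epsilon> = sqrt (2E)\<close>. On the level of energy \<open>E\<close> the momentum is \<open>\<epsilon> cis \<theta>\<close>, and \<open>\<theta>\<close> decreases
  strictly because \<open>F\<close> is positive. Hence a periodic orbit along which \<open>\<theta>\<close> makes one turn and whose
  lift closes up is the same as a \<open>2\<pi>\<close>-periodic solution of
  \<open>f(q) dq/d\<theta> = - \<epsilon> cis \<theta>\<close>. For small \<open>\<epsilon>\<close> the right-hand side is small, and the orbit is sought
  near a fibre of the unit circle bundle.

  The equation is solved by Lyapunov-Schmidt reduction. For small \<open>\<epsilon>\<close> and any starting point \<open>a\<close> there is
  exactly one closed curve \<open>q\<^sub>a\<close> with \<open>f(q) dq/d\<theta> = c - \<epsilon> cis \<theta>\<close>, where the constant
  \<open>c = c(a)\<close> is chosen so that the curve closes up (\<open>solution_exists\<close>). It remains to find \<open>a\<close> with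
  \<open>c(a) = 0\<close>. The equation with \<open>c = 0\<close> is the Euler-Lagrange equation of an action, a term linear
  in \<open>q\<close> minus the magnetic flux through the loop. The first variation of this action at
  \<open>q\<^sub>a\<close> in direction \<open>\<Delta>\<close> is the integral of the cross product of \<open>c\<close> and \<open>\<Delta>\<close>, so moving \<open>a\<close> in the
  direction \<open>\<i> c\<close> increases the action to first order unless \<open>c = 0\<close> (\<open>action_difference\<close>). The
  action of \<open>q\<^sub>a\<close> is a continuous function of \<open>a\<close> which is invariant under deck transformations, so
  it lives on the torus and has a maximum, and there \<open>c\<close> vanishes (\<open>drift_free_solution\<close>). Only the
  Lipschitz dependence of \<open>q\<^sub>a\<close> on \<open>a\<close> is used, since at a maximum it is enough to compare values.

  The orbit is contractible because it lifts to a loop in a contractible space. For its area, two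
  things are shown. All capping discs have the same area (\<open>disc_area_unique\<close>): the twisted form
  becomes exact on the universal cover, and the difference of the area densities of two discs is a
  sum of exterior derivatives of one-forms that vanish on the boundary circle. One
  capping disc is written down explicitly (\<open>smooth_extension_to_disc\<close>) by contracting the lifted loop
  to a point, and its area is bounded by the size of the loop and of its velocity
  (\<open>symplectic_area_bound\<close>); both stay bounded as the energy tends to zero.
\<close>

section \<open>Calculus of \<open>C\<^sup>k\<close> maps\<close>

lemma Ck_on_cong:
  assumes "open S" "\<And>x. x \<in> S \<Longrightarrow> f x = g x" "Ck_on k f S"
  shows "Ck_on k g S"
  using assms(2,3)
proof (induction k arbitrary: f g)
  case 0
  then show ?case by (metis Ck_on.simps(1) continuous_on_cong)
next
  case (Suc k)
  have eq: "frechet_derivative g (at x) = frechet_derivative f (at x)"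
    and dg: "g differentiable (at x)" if "x \<in> S" for x
  proof -
    have f: "(f has_derivative frechet_derivative f (at x)) (at x)"
      using Suc.prems(2) that by (simp add: frechet_derivative_works[THEN iffD1])
    have "(g has_derivative frechet_derivative f (at x)) (at x)"
      by (rule has_derivative_transform_within_open[OF f \<open>open S\<close> that]) (use Suc.prems in auto)
    then show "frechet_derivative g (at x) = frechet_derivative f (at x)" "g differentiable (at x)"
      using frechet_derivative_at differentiableI by (metis, blast)
  qed
  have "Ck_on k (\<lambda>x. frechet_derivative g (at x) v) S" for v
    by (rule Suc.IH[of "\<lambda>x. frechet_derivative f (at x) v"]) (use eq Suc.prems in auto)
  then show ?case using dg by simp
qed

text \<open>
  The definition of \<open>Ck_on\<close> speaks of \<open>frechet_derivative\<close>; this introduction rule allows the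
  derivative to be given by any formula that is valid on the open set.
\<close>

lemma Ck_on_SucI:
  assumes "open S" "\<And>x. x \<in> S \<Longrightarrow> (f has_derivative f' x) (at x)"
    and "\<And>v. Ck_on k (\<lambda>x. f' x v) S"
  shows "Ck_on (Suc k) f S"
proof -
  have eq: "f' x = frechet_derivative f (at x)" if "x \<in> S" for x
    using assms(2) that frechet_derivative_at by blast
  have "Ck_on k (\<lambda>x. frechet_derivative f (at x) v) S" for v
    by (rule Ck_on_cong[OF assms(1) _ assms(3)]) (use eq in auto)
  moreover have "f differentiable (at x)" if "x \<in> S" for x
    using assms(2)[OF that] by (rule differentiableI)
  ultimately show ?thesis by auto
qed

lemma Ck_on_Suc_has_derivative:
  "Ck_on (Suc k) f S \<Longrightarrow> x \<in> S \<Longrightarrow> (f has_derivative frechet_derivative f (at x)) (at x)"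
  by (simp add: frechet_derivative_works[THEN iffD1])

lemma Ck_on_lower: "Ck_on (Suc k) f S \<Longrightarrow> Ck_on k f S"
proof (induction k arbitrary: f)
  case 0
  then show ?case
    by (auto intro!: continuous_at_imp_continuous_on differentiable_imp_continuous_within)
next
  case (Suc k)
  then show ?case by (metis Ck_on.simps(2))
qed

lemma Ck_on_continuous: "Ck_on k f S \<Longrightarrow> continuous_on S f"
  by (induction k) (simp, blast dest: Ck_on_lower)

lemma Ck_on_const: "open S \<Longrightarrow> Ck_on k (\<lambda>x. c) S"
  by (induction k arbitrary: c) auto

lemma Ck_on_bounded_linear:
  assumes "bounded_linear f" "open S" shows "Ck_on k f S"
proof (cases k)
  case 0
  then show ?thesis using assms linear_continuous_on by auto
next
  case (Suc n)
  then show ?thesis using assms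
    by (simp del: Ck_on.simps(2), intro Ck_on_SucI[where f' = "\<lambda>x. f"] Ck_on_const
        bounded_linear_imp_has_derivative)
qed

lemma Ck_on_add:
  assumes "open S" "Ck_on k f S" "Ck_on k g S" shows "Ck_on k (\<lambda>x. f x + g x) S"
  using assms(2,3)
proof (induction k arbitrary: f g)
  case 0
  then show ?case by (auto intro: continuous_intros)
next
  case (Suc k)
  show ?case
    by (rule Ck_on_SucI[OF assms(1)],
        rule has_derivative_add[OF Ck_on_Suc_has_derivative[OF Suc.prems(1)]
            Ck_on_Suc_has_derivative[OF Suc.prems(2)]])
      (use Suc in auto)
qed

lemma Ck_on_bilinear:
  assumes "bounded_bilinear B" "open S" "Ck_on k f S" "Ck_on k g S"
  shows "Ck_on k (\<lambda>x. B (f x) (g x)) S"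
  using assms(3,4)
proof (induction k arbitrary: f g)
  case 0
  then show ?case by (auto intro: bounded_bilinear.continuous_on[OF assms(1)])
next
  case (Suc k)
  show ?case
  proof (rule Ck_on_SucI[OF assms(2)])
    show "((\<lambda>x. B (f x) (g x)) has_derivative
        (\<lambda>v. B (f x) (frechet_derivative g (at x) v) + B (frechet_derivative f (at x) v) (g x))) (at x)"
      if "x \<in> S" for x
      using bounded_bilinear.FDERIV[OF assms(1) Ck_on_Suc_has_derivative[OF Suc.prems(1) that]
          Ck_on_Suc_has_derivative[OF Suc.prems(2) that]] .
    show "Ck_on k (\<lambda>x. B (f x) (frechet_derivative g (at x) v)
        + B (frechet_derivative f (at x) v) (g x)) S" for v
      using Suc.prems Suc.prems[THEN Ck_on_lower] by (intro Ck_on_add assms(2) Suc.IH) simp_all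
  qed
qed

lemmas Ck_on_mult = Ck_on_bilinear[OF bounded_bilinear_mult]
lemmas Ck_on_scaleR = Ck_on_bilinear[OF bounded_bilinear_scaleR]
lemmas Ck_on_inner = Ck_on_bilinear[OF bounded_bilinear_inner]

lemma Ck_on_linear_compose:
  assumes "bounded_linear L" "open S" "Ck_on k f S" shows "Ck_on k (\<lambda>x. L (f x)) S"
  using assms(3)
proof (induction k arbitrary: f)
  case 0
  then show ?case by (auto intro: bounded_linear.continuous_on[OF assms(1)])
next
  case (Suc k)
  show ?case
    by (rule Ck_on_SucI[OF assms(2)],
        rule bounded_linear.has_derivative[OF assms(1) Ck_on_Suc_has_derivative[OF Suc.prems(1)]])
      (use Suc in auto)
qed

lemma Ck_on_Pair:
  assumes "open S" "Ck_on k f S" "Ck_on k g S" shows "Ck_on k (\<lambda>x. (f x, g x)) S"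
proof -
  have "Ck_on k (\<lambda>x. (f x, 0) + (0, g x)) S"
    by (rule Ck_on_add[OF assms(1)
          Ck_on_linear_compose[OF bounded_linear_Pair[OF bounded_linear_ident bounded_linear_zero]
              assms(1,2)]
          Ck_on_linear_compose[OF bounded_linear_Pair[OF bounded_linear_zero bounded_linear_ident]
              assms(1,3)]])
  then show ?thesis by simp
qed

lemma Ck_on_sum:
  assumes "open S" "finite I" "\<And>i. i \<in> I \<Longrightarrow> Ck_on k (f i) S"
  shows "Ck_on k (\<lambda>x. \<Sum>i\<in>I. f i x) S"
  using assms(2,3)
  by (induction rule: finite_induct) (auto intro: Ck_on_const Ck_on_add assms(1))

text \<open>
  The definition controls the derivative only in fixed directions, whereas the chain rule evaluates
  the derivative of \<open>f\<close> in a direction that moves with the point. Expanding that direction in a basis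
  turns the chain rule into a sum of products to which the induction hypothesis applies.
\<close>

lemma Ck_on_compose:
  fixes g :: "'a::real_normed_vector \<Rightarrow> 'b::euclidean_space"
  assumes "open S" "open U" "g ` S \<subseteq> U" "Ck_on k f U" "Ck_on k g S"
  shows "Ck_on k (\<lambda>x. f (g x)) S"
  using assms(4,5)
proof (induction k arbitrary: f)
  case 0
  then show ?case using assms(3) by (auto intro: continuous_on_compose2)
next
  case (Suc k)
  let ?f = "\<lambda>y. frechet_derivative f (at y)" and ?g = "\<lambda>x. frechet_derivative g (at x)"
  have df: "(f has_derivative ?f (g x)) (at (g x))" if "x \<in> S" for x
    using Suc.prems(1) assms(3) that by (intro Ck_on_Suc_has_derivative) auto
  show ?case
  proof (rule Ck_on_SucI[OF assms(1)])
    fix x assume x: "x \<in> S"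
    have "((\<lambda>x. f (g x)) has_derivative (\<lambda>v. ?f (g x) (?g x v))) (at x)"
      using has_derivative_compose[OF Ck_on_Suc_has_derivative[OF Suc.prems(2) x] df[OF x]] .
    moreover have "?f (g x) (?g x v) = (\<Sum>b\<in>Basis. (?g x v \<bullet> b) *\<^sub>R ?f (g x) b)" for v
    proof -
      have "linear (?f (g x))" using df[OF x] has_derivative_linear by blast
      then show ?thesis
        by (subst euclidean_representation[of "?g x v", symmetric])
          (simp only: linear_sum linear_cmul)
    qed
    ultimately show "((\<lambda>x. f (g x)) has_derivative
        (\<lambda>v. \<Sum>b\<in>Basis. (?g x v \<bullet> b) *\<^sub>R ?f (g x) b)) (at x)" by simp
  next
    fix v
    show "Ck_on k (\<lambda>x. \<Sum>b\<in>Basis. (?g x v \<bullet> b) *\<^sub>R ?f (g x) b) S"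
    proof (rule Ck_on_sum[OF assms(1) finite_Basis])
      fix b :: 'b
      show "Ck_on k (\<lambda>x. (?g x v \<bullet> b) *\<^sub>R ?f (g x) b) S"
      proof (rule Ck_on_scaleR[OF assms(1)])
        show "Ck_on k (\<lambda>x. ?g x v \<bullet> b) S"
          by (rule Ck_on_linear_compose[OF bounded_linear_inner_left assms(1)])
              (use Suc.prems(2) in simp)
        show "Ck_on k (\<lambda>x. ?f (g x) b) S"
          by (rule Suc.IH) (use Suc.prems Ck_on_lower[OF Suc.prems(2)] in simp_all)
      qed
    qed
  qed
qed

lemma Ck_on_Un:
  assumes "open S" "open U" "Ck_on k f S" "Ck_on k f U" shows "Ck_on k f (S \<union> U)"
  using assms(3,4)
  by (induction k arbitrary: f) (auto intro: continuous_on_open_Un assms)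

lemma Ck_on_subset: "Ck_on k f S \<Longrightarrow> T \<subseteq> S \<Longrightarrow> Ck_on k f T"
  by (induction k arbitrary: f) (auto intro: continuous_on_subset)

lemma Ck_on_vector_derivative:
  fixes f :: "real \<Rightarrow> 'b::real_normed_vector"
  assumes "open S" "\<And>x. x \<in> S \<Longrightarrow> (f has_vector_derivative g x) (at x)" "Ck_on k g S"
  shows "Ck_on (Suc k) f S"
  by (rule Ck_on_SucI[where f' = "\<lambda>x v. v *\<^sub>R g x", OF assms(1)])
    (use assms Ck_on_scaleR[OF assms(1) Ck_on_const[OF assms(1)] assms(3)] in
      \<open>simp_all add: has_vector_derivative_def\<close>)

text \<open>
  Bootstrapping: if \<open>y\<close> is \<open>C\<^sup>k\<close>, then so is its derivative \<open>G \<circ> y\<close>, hence \<open>y\<close> is \<open>C\<^sup>k\<^sup>+\<^sup>1\<close>.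
\<close>

lemma Ck_on_ode:
  fixes y :: "real \<Rightarrow> 'b::euclidean_space"
  assumes "\<And>k. Ck_on k G UNIV" "\<And>t. (y has_vector_derivative G (y t)) (at t)"
  shows "Ck_on k y UNIV"
proof (induction k)
  case 0
  then show ?case
    using has_vector_derivative_continuous[OF assms(2)]
    by (simp add: continuous_at_imp_continuous_on)
next
  case (Suc k)
  show ?case
    by (rule Ck_on_vector_derivative[OF open_UNIV assms(2)
          Ck_on_compose[OF open_UNIV open_UNIV subset_UNIV assms(1) Suc]])
qed

lemma Ck_on_field_derivative:
  fixes f :: "'a::real_normed_field \<Rightarrow> 'a"
  assumes "open S" "\<And>x. x \<in> S \<Longrightarrow> (f has_field_derivative g x) (at x)" "Ck_on k g S"
  shows "Ck_on (Suc k) f S"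
  by (rule Ck_on_SucI[where f' = "\<lambda>x v. g x * v", OF assms(1)])
    (use assms Ck_on_mult[OF assms(1) assms(3) Ck_on_const[OF assms(1)]] in
      \<open>simp_all add: has_field_derivative_def\<close>)

lemma Ck_on_exp: "Ck_on k (exp :: complex \<Rightarrow> complex) UNIV"
proof (induction k)
  case 0
  show ?case by (auto intro!: continuous_intros)
next
  case (Suc k)
  show ?case by (rule Ck_on_field_derivative[OF open_UNIV DERIV_exp Suc])
qed

lemma Ck_on_cis: "Ck_on k cis UNIV"
proof -
  have "bounded_linear (\<lambda>x. \<i> * complex_of_real x)"
    by (rule bounded_linear_const_mult[OF bounded_linear_of_real])
  then have "Ck_on k (\<lambda>x. exp (\<i> * complex_of_real x)) UNIV"
    by (rule Ck_on_compose[OF open_UNIV open_UNIV subset_UNIV Ck_on_exp Ck_on_bounded_linear[OF _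
        open_UNIV]])
  then show ?thesis by (simp add: cis_conv_exp[abs_def])
qed

lemma Ck_on_inverse: "Ck_on k (inverse :: complex \<Rightarrow> complex) (- {0})"
proof (induction k)
  case 0
  show ?case by (auto intro!: continuous_intros)
next
  case (Suc k)
  have op: "open (- {0 :: complex})" by auto
  have "Ck_on k (\<lambda>x::complex. - (inverse x * inverse x)) (- {0})"
    by (rule Ck_on_linear_compose[OF bounded_linear_minus[OF bounded_linear_ident] op Ck_on_mult[OF
        op Suc Suc]])
  note ck = this
  have d: "(inverse has_field_derivative - (inverse x * inverse x)) (at x)"
    if "x \<in> - {0}" for x :: complex
    using DERIV_inverse[of x] that by (simp add: power2_eq_square)
  show ?case by (rule Ck_on_field_derivative[OF op d ck])
qed

section \<open>Integrals over the disc that depend only on the boundary\<close>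

text \<open>
  The mean value theorem is applied to the difference of two parallel increments, first in the
  direction \<open>v\<close> and then in the direction \<open>w\<close>. The left-hand side is symmetric in \<open>v\<close> and \<open>w\<close>, which
  gives the symmetry of the second derivative in the limit.
\<close>

lemma second_difference:
  fixes f :: "'a::real_normed_vector \<Rightarrow> real"
  assumes sub: "ball x r \<subseteq> S" and t: "0 < t" "t * (norm v + norm w) < r"
    and f': "\<And>y. y \<in> S \<Longrightarrow> (f has_derivative f' y) (at y)"
    and g: "\<And>y. y \<in> S \<Longrightarrow> ((\<lambda>z. f' z v) has_derivative g y) (at y)"
  shows "\<exists>p\<in>ball x r. f (x + t *\<^sub>R v + t *\<^sub>R w) - f (x + t *\<^sub>R v) - f (x + t *\<^sub>R w) + f x = t\<^sup>2 * g p w"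
proof -
  have inb: "x + a *\<^sub>R v + b *\<^sub>R w \<in> ball x r" if "0 \<le> a" "a \<le> t" "0 \<le> b" "b \<le> t" for a b
  proof -
    have "norm (a *\<^sub>R v + b *\<^sub>R w) \<le> a * norm v + b * norm w"
      using norm_triangle_ineq[of "a *\<^sub>R v" "b *\<^sub>R w"] that by simp
    also have "\<dots> \<le> t * norm v + t * norm w"
      using that by (intro add_mono mult_right_mono) auto
    also have "\<dots> < r" using t by (simp add: algebra_simps)
    moreover have "dist x (x + a *\<^sub>R v + b *\<^sub>R w) = norm (a *\<^sub>R v + b *\<^sub>R w)"
      by (metis add.assoc add_diff_cancel_left' dist_commute dist_norm)
    ultimately show ?thesis by (simp add: mem_ball)
  qed
  have d1: "((\<lambda>s. f (x + s *\<^sub>R v + b *\<^sub>R w)) has_real_derivative f' (x + a *\<^sub>R v + b *\<^sub>R w) v) (at a)"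
    if "0 \<le> a" "a \<le> t" "0 \<le> b" "b \<le> t" for a b
  proof -
    have *: "x + a *\<^sub>R v + b *\<^sub>R w \<in> S" using inb that sub by blast
    have "((\<lambda>s. x + s *\<^sub>R v + b *\<^sub>R w) has_derivative (\<lambda>s. s *\<^sub>R v)) (at a)"
      by (auto intro!: derivative_eq_intros)
    from has_derivative_compose[OF this f'[OF *]] show ?thesis
      using linear_cmul[OF has_derivative_linear[OF f'[OF *]]]
      by (intro has_derivative_imp_has_field_derivative) auto
  qed
  obtain s where s: "0 < s" "s < t" and e1: "(f (x + t *\<^sub>R v + t *\<^sub>R w) - f (x + t *\<^sub>R v + 0 *\<^sub>R w))
        - (f (x + 0 *\<^sub>R v + t *\<^sub>R w) - f (x + 0 *\<^sub>R v + 0 *\<^sub>R w))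
      = (t - 0) * (f' (x + s *\<^sub>R v + t *\<^sub>R w) v - f' (x + s *\<^sub>R v + 0 *\<^sub>R w) v)"
    using MVT2[OF t(1), of "\<lambda>s. f (x + s *\<^sub>R v + t *\<^sub>R w) - f (x + s *\<^sub>R v + 0 *\<^sub>R w)",
        OF DERIV_diff[OF d1 d1]] t by auto
  have d2: "((\<lambda>b. f' (x + s *\<^sub>R v + b *\<^sub>R w) v) has_real_derivative g (x + s *\<^sub>R v + b *\<^sub>R w) w) (at b)"
    if "0 \<le> b" "b \<le> t" for b
  proof -
    have *: "x + s *\<^sub>R v + b *\<^sub>R w \<in> S" using inb[of s b] that s sub by auto
    have "((\<lambda>b. x + s *\<^sub>R v + b *\<^sub>R w) has_derivative (\<lambda>b. b *\<^sub>R w)) (at b)"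
      by (auto intro!: derivative_eq_intros)
    from has_derivative_compose[OF this g[OF *]] show ?thesis
      using linear_cmul[OF has_derivative_linear[OF g[OF *]]]
      by (intro has_derivative_imp_has_field_derivative) auto
  qed
  obtain b where b: "0 < b" "b < t" and e2: "f' (x + s *\<^sub>R v + t *\<^sub>R w) v - f' (x + s *\<^sub>R v + 0 *\<^sub>R w) v
      = (t - 0) * g (x + s *\<^sub>R v + b *\<^sub>R w) w"
    using MVT2[OF t(1) d2] by auto
  show ?thesis
    using inb[of s b] s b e1 e2 by (intro bexI[of _ "x + s *\<^sub>R v
        + b *\<^sub>R w"]) (auto simp: power2_eq_square)
qed

lemma second_derivative_symmetric:
  fixes f :: "'a::real_normed_vector \<Rightarrow> real"
  assumes S: "open S" "x \<in> S"
    and f': "\<And>y. y \<in> S \<Longrightarrow> (f has_derivative f' y) (at y)"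
    and g: "\<And>y. y \<in> S \<Longrightarrow> ((\<lambda>z. f' z v) has_derivative g y) (at y)"
    and h: "\<And>y. y \<in> S \<Longrightarrow> ((\<lambda>z. f' z w) has_derivative h y) (at y)"
    and cont: "continuous_on S (\<lambda>y. g y w)" "continuous_on S (\<lambda>y. h y v)"
  shows "g x w = h x v"
proof (rule ccontr)
  assume ne: "g x w \<noteq> h x v"
  define e where "e = \<bar>g x w - h x v\<bar> / 2"
  have e: "e > 0" using ne by (simp add: e_def)
  obtain r0 where r0: "r0 > 0" "ball x r0 \<subseteq> S" using S openE by blast
  obtain r1 where r1: "r1 > 0" "\<And>y. y \<in> S \<Longrightarrow> dist y x < r1 \<Longrightarrow> dist (g y w) (g x w) < e"
    using cont(1) S(2) e unfolding continuous_on_iff by metis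
  obtain r2 where r2: "r2 > 0" "\<And>y. y \<in> S \<Longrightarrow> dist y x < r2 \<Longrightarrow> dist (h y v) (h x v) < e"
    using cont(2) S(2) e unfolding continuous_on_iff by metis
  define r where "r = min r0 (min r1 r2)"
  have r: "r > 0" "ball x r \<subseteq> S" using r0 r1 r2 by (auto simp: r_def)
  define N where "N = norm v + norm w"
  \<comment> \<open>The summand \<open>1\<close> covers the case \<open>v = w = 0\<close>.\<close>
  define t where "t = r / (2 * (N + 1))"
  have N: "N \<ge> 0" by (simp add: N_def)
  have t: "t > 0" "t * (norm v + norm w) < r"
  proof -
    show "t > 0" using r N by (simp add: t_def)
    have "r * N < r * (2 * (N + 1))" using r N by (intro mult_strict_left_mono) auto
    then show "t * (norm v + norm w) < r"
      using N unfolding t_def N_def[symmetric] by (simp add: pos_divide_less_eq)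
  qed
  then have t': "t * (norm w + norm v) < r" by (simp add: add.commute)
  obtain p where p: "p \<in> ball x r" "f (x + t *\<^sub>R v + t *\<^sub>R w) - f (x + t *\<^sub>R v) - f (x + t *\<^sub>R w)
      + f x = t\<^sup>2 * g p w"
    using second_difference[OF r(2) t f' g] by blast
  obtain q where q: "q \<in> ball x r" "f (x + t *\<^sub>R w + t *\<^sub>R v) - f (x + t *\<^sub>R w) - f (x + t *\<^sub>R v)
      + f x = t\<^sup>2 * h q v"
    using second_difference[OF r(2) t(1) t' f' h] by blast
  have "x + t *\<^sub>R w + t *\<^sub>R v = x + t *\<^sub>R v + t *\<^sub>R w" by (simp add: algebra_simps)
  then have "t\<^sup>2 * g p w = t\<^sup>2 * h q v" using p(2) q(2) by (simp only:)
  then have eq: "g p w = h q v" using t(1) by simp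
  have "dist (g p w) (g x w) < e" "dist (h q v) (h x v) < e"
    using r1(2)[of p] r2(2)[of q] p(1) q(1) subsetD[OF r(2)] by (simp_all add: r_def dist_commute)
  then have "\<bar>g x w - h x v\<bar> < e + e" using eq unfolding dist_real_def by linarith
  then show False by (simp add: e_def)
qed

text \<open>
  Angle functions of a disc are defined only over the closed disc, so differentiability is required
  only inside. The derivative must still extend continuously to the boundary, which bounds it.
\<close>

definition disc_C1 :: "(complex \<Rightarrow> real) \<Rightarrow> (complex \<Rightarrow> complex \<Rightarrow> real) \<Rightarrow> bool" where
  "disc_C1 u u' \<longleftrightarrow> continuous_on (cball 0 1) u \<and> (\<forall>z\<in>ball 0 1. (u has_derivative u' z) (at z)) \<and>
     (\<forall>h. continuous_on (cball 0 1) (\<lambda>z. u' z h))"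

definition disc_C2 :: "(complex \<Rightarrow> real) \<Rightarrow> (complex \<Rightarrow> complex \<Rightarrow> real) \<Rightarrow> bool" where
  "disc_C2 w w' \<longleftrightarrow> disc_C1 w w' \<and> (\<forall>h. \<exists>g. disc_C1 (\<lambda>z. w' z h) g)"

lemma disc_C1_diff: "disc_C1 u u' \<Longrightarrow> disc_C1 w w' \<Longrightarrow> disc_C1 (\<lambda>z. u z - w z) (\<lambda>z h. u' z h - w' z h)"
  unfolding disc_C1_def by (auto intro!: continuous_intros has_derivative_diff)

lemma disc_C1_mult:
  "disc_C1 u u' \<Longrightarrow> disc_C1 w w' \<Longrightarrow> disc_C1 (\<lambda>z. u z * w z) (\<lambda>z h. u z * w' z h + u' z h * w z)"
  unfolding disc_C1_def by (auto intro!: continuous_intros has_derivative_mult)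

lemma linear_complex_bound:
  fixes L :: "complex \<Rightarrow> real"
  assumes lin: "linear L"
  shows "\<bar>L h\<bar> \<le> (\<bar>L 1\<bar> + \<bar>L \<i>\<bar>) * norm h"
proof -
  have "L h = L (Re h *\<^sub>R 1 + Im h *\<^sub>R \<i>)" by (rule arg_cong[where f = L]) (simp add: complex_eq_iff)
  also have "\<dots> = Re h * L 1 + Im h * L \<i>" by (simp only: linear_add[OF lin] linear_cmul[OF lin]
      real_scaleR_def)
  finally have "\<bar>L h\<bar> \<le> \<bar>Re h\<bar> * \<bar>L 1\<bar> + \<bar>Im h\<bar> * \<bar>L \<i>\<bar>"
    by (metis abs_mult abs_triangle_ineq)
  also have "\<dots> \<le> norm h * \<bar>L 1\<bar> + norm h * \<bar>L \<i>\<bar>"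
    by (intro add_mono mult_right_mono abs_Re_le_cmod abs_Im_le_cmod) auto
  finally show ?thesis by (simp add: algebra_simps)
qed

lemma disc_C1_bound:
  assumes "disc_C1 u u'"
  obtains B where "B \<ge> 0" "\<And>z h. z \<in> ball 0 1 \<Longrightarrow> \<bar>u' z h\<bar> \<le> B * norm h"
proof -
  have "compact ((\<lambda>z. \<bar>u' z 1\<bar> + \<bar>u' z \<i>\<bar>) ` cball 0 1)"
    using assms unfolding disc_C1_def by (intro compact_continuous_image continuous_intros) auto
  from compact_imp_bounded[OF this] obtain B where B: "\<And>z. z \<in> cball 0 1 \<Longrightarrow> \<bar>u' z 1\<bar> + \<bar>u' z \<i>\<bar> \<le> B"
    unfolding bounded_iff by fastforce
  show ?thesis
  proof (rule that)
    show "B \<ge> 0" using B[of 0] by auto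
    fix z h :: complex assume z: "z \<in> ball 0 1"
    have lin: "linear (u' z)" using assms z unfolding disc_C1_def by (blast intro:
        has_derivative_linear)
    have "\<bar>u' z h\<bar> \<le> (\<bar>u' z 1\<bar> + \<bar>u' z \<i>\<bar>) * norm h" by (rule linear_complex_bound[OF lin])
    also have "\<dots> \<le> B * norm h" using B[of z] z by (intro mult_right_mono) auto
    finally show "\<bar>u' z h\<bar> \<le> B * norm h" .
  qed
qed

lemma integral_translation_UNIV:
  fixes f :: "'a::euclidean_space \<Rightarrow> real"
  assumes "integrable lborel f"
  shows "((\<lambda>z. f (z + c)) has_integral (LINT z|lborel. f z)) UNIV"
proof -
  have f: "f \<in> borel_measurable borel" using borel_measurable_integrable[OF assms] by simp
  have "integrable (distr lborel borel ((+) c)) f" using assms by (simp add: lborel_distr_plus)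
  then have "integrable lborel (\<lambda>z. f (c + z))"
    by (subst (asm) integrable_distr_eq) (use f in auto)
  moreover have "(LINT z|distr lborel borel ((+) c). f z) = (LINT z|lborel. f (c + z))"
    by (rule integral_distr) (use f in auto)
  then have "(LINT z|lborel. f (c + z)) = (LINT z|lborel. f z)" by (simp add: lborel_distr_plus)
  ultimately show ?thesis using has_integral_integral_lborel[of "\<lambda>z. f (c + z)"]
      by (simp add: add.commute)
qed

text \<open>
  A function that vanishes on the circle extends by zero to a Lipschitz function \<open>F\<close> of compact
  support on the plane. By translation invariance of Lebesgue measure the difference quotients of \<open>F\<close>
  have integral zero, and they converge boundedly, off the null set formed by the circle, to the
  derivative. Composing with the nearest point projection gives the extension and its Lipschitz
  constant at once.
\<close>

lemma integral_derivative_zero_boundary: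
  assumes C1: "disc_C1 f f'" and zero: "\<And>z. norm z = 1 \<Longrightarrow> f z = 0"
  shows "((\<lambda>z. f' z v) has_integral 0) (cball 0 1)"
proof -
  let ?D = "cball (0::complex) 1"
  define \<rho> where "\<rho> = closest_point ?D"
  define F where "F = f \<circ> \<rho>"
  obtain B where B: "B \<ge> 0" "\<And>z h. z \<in> ball 0 1 \<Longrightarrow> \<bar>f' z h\<bar> \<le> B * norm h"
      by (rule disc_C1_bound[OF C1]) blast
  have cf: "continuous_on ?D f" and df: "\<And>z. z \<in> ball 0 1 \<Longrightarrow> (f has_derivative f' z) (at z)"
    using C1 by (auto simp: disc_C1_def)
  have "B-lipschitz_on (ball 0 1) f"
  proof (rule lipschitz_onI)
    fix x y :: complex assume xy: "x \<in> ball 0 1" "y \<in> ball 0 1"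
    have "norm (f x - f y) \<le> B * norm (x - y)"
    proof (rule differentiable_bound[OF convex_ball _ _ xy])
      show "(f has_derivative f' z) (at z within ball 0 1)" if "z \<in> ball 0 1" for z
        using df[OF that] by (rule has_derivative_at_withinI)
      show "onorm (f' z) \<le> B" if "z \<in> ball 0 1" for z
        using B(2)[OF that] B(1) by (intro onorm_bound) auto
    qed
    then show "dist (f x) (f y) \<le> B * dist x y" by (simp add: dist_norm)
  qed (rule B)
  then have lip: "B-lipschitz_on ?D f"
    using lipschitz_on_closure[of B "ball 0 1" f] cf by simp
  have \<rho>D: "\<rho> z \<in> ?D" for z unfolding \<rho>_def by (rule closest_point_in_set) auto
  have \<rho>id: "\<rho> z = z" if "z \<in> ?D" for z unfolding \<rho>_def using that by (rule closest_point_self)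
  have \<rho>lip: "dist (\<rho> x) (\<rho> y) \<le> dist x y" for x y
    unfolding \<rho>_def by (rule closest_point_lipschitz) auto
  have Flip: "\<bar>F x - F y\<bar> \<le> B * norm (x - y)" for x y
  proof -
    have "dist (F x) (F y) \<le> B * dist (\<rho> x) (\<rho> y)"
      unfolding F_def using lipschitz_onD[OF lip \<rho>D \<rho>D] by simp
    also have "\<dots> \<le> B * dist x y" using \<rho>lip B(1) by (rule mult_left_mono)
    finally show ?thesis by (simp add: dist_norm)
  qed
  have Fout: "F z = 0" if "z \<notin> ball 0 1" for z
  proof -
    have ri: "rel_interior ?D = ball 0 1"
      using rel_interior_interior[of ?D] affine_hull_nonempty_interior[of ?D]
          by (simp add: interior_cball)
    have "\<rho> z \<notin> ball 0 1"
      unfolding \<rho>_def using closest_point_in_rel_interior[of ?D z] that ri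
          affine_hull_nonempty_interior[of ?D]
      by (auto simp: interior_cball)
    then have "norm (\<rho> z) = 1" using \<rho>D[of z] by auto
    then show ?thesis by (simp add: F_def zero)
  qed
  have Fin: "F z = f z" if "z \<in> ?D" for z using \<rho>id[OF that] by (simp add: F_def)
  have "(\<lambda>z. indicator ?D z *\<^sub>R f z) = F"
    using Fin Fout by (auto simp: indicator_def fun_eq_iff)
  then have Fint: "integrable lborel F" using borel_integrable_compact[OF compact_cball cf] by metis
  define h :: "nat \<Rightarrow> real" where "h n = inverse (real (Suc n))" for n
  have h: "h n > 0" "h n \<le> 1" for n by (auto simp: h_def divide_simps)
  define g where "g n z = (F (z + h n *\<^sub>R v) - F z) / h n" for n z
  have gint: "(g n has_integral 0) UNIV" for n
    using has_integral_divide[OF has_integral_diff[OF integral_translation_UNIV[OF Fint, of "h n *\<^sub>R v"]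
          integral_translation_UNIV[OF Fint, of 0]], of "h n"]
    unfolding g_def by simp
  define S where "S = sphere (0::complex) 1"
  have neg: "negligible S" unfolding S_def by (rule negligible_sphere)
  \<comment> \<open>On the circle the quotients need not converge; it is a null set.\<close>
  define g0 where "g0 n z = (if z \<in> S then 0 else g n z)" for n z
  have g0int: "(g0 n has_integral 0) UNIV" for n
    by (rule has_integral_spike[OF neg _ gint[of n]]) (simp add: g0_def)
  define dom where "dom z = (if z \<in> cball 0 (1 + norm v) then B * norm v else 0)" for z :: complex
  have domint: "dom integrable_on UNIV"
    unfolding dom_def integrable_restrict_UNIV
    by (rule integrable_on_const) (simp add: lmeasurable_cball)
  have gle: "norm (g0 n z) \<le> dom z" for n z
  proof (cases "z \<in> cball 0 (1 + norm v)")
    case True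
    have "\<bar>F (z + h n *\<^sub>R v) - F z\<bar> \<le> B * norm v * h n"
      using Flip[of "z + h n *\<^sub>R v" z] h[of n] by (simp add: mult_ac)
    then have "norm (g n z) \<le> B * norm v" using h[of n] by (simp add: g_def pos_divide_le_eq)
    then show ?thesis using True B(1) by (auto simp: dom_def g0_def)
  next
    case False
    have a: "norm z > 1 + norm v" using False by simp
    have "norm (h n *\<^sub>R v) \<le> norm v" using h[of n] by (simp add: mult_left_le_one_le)
    then have "norm (z + h n *\<^sub>R v) > 1"
      using a norm_diff_ineq[of z "h n *\<^sub>R v"] by linarith
    moreover have "norm z > 1" using a norm_ge_zero[of v] by linarith
    ultimately have "F (z + h n *\<^sub>R v) = 0" "F z = 0" by (auto intro!: Fout)
    then show ?thesis using False by (simp add: g0_def g_def dom_def)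
  qed
  define G where "G z = (if z \<in> ball 0 1 then f' z v else 0)" for z
  have hlim: "h \<longlonglongrightarrow> 0" unfolding h_def by (rule LIMSEQ_inverse_real_of_nat)
  have conv: "(\<lambda>n. g0 n z) \<longlonglongrightarrow> G z" for z
  proof -
    have key: "(\<lambda>n. (F (z + h n *\<^sub>R v) - F z) / h n) \<longlonglongrightarrow> d v"
      if "(F has_derivative d) (at z)" for d
    proof -
      have "((\<lambda>s. z + s *\<^sub>R v) has_derivative (\<lambda>s. s *\<^sub>R v)) (at 0)"
        by (auto intro!: derivative_eq_intros)
      from has_derivative_compose[OF this, of F d] that
      have "((\<lambda>s. F (z + s *\<^sub>R v)) has_real_derivative d v) (at 0)"
        using linear_cmul[OF has_derivative_linear[OF that]]
        by (intro has_derivative_imp_has_field_derivative) auto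
      then have lim: "((\<lambda>s. (F (z + s *\<^sub>R v) - F z) / s) \<longlongrightarrow> d v) (at 0)"
        by (simp add: DERIV_def)
      show ?thesis
        by (rule filterlim_compose[OF lim]) (use hlim h(1) in \<open>auto simp: filterlim_at
            less_imp_neq[symmetric]\<close>)
    qed
    consider "z \<in> ball 0 1" | "norm z > 1" | "norm z = 1" by (cases "norm z" "1::real" rule:
        linorder_cases) auto
    then show ?thesis
    proof cases
      case 1
      have "(F has_derivative f' z) (at z)"
        by (rule has_derivative_transform_within_open[OF df[OF 1] open_ball 1]) (simp add: Fin)
      from key[OF this] 1 show ?thesis by (simp add: g0_def g_def G_def S_def)
    next
      case 2
      have "open (- cball (0::complex) 1)" by auto
      then have "(F has_derivative (\<lambda>_. 0)) (at z)"
        by (rule has_derivative_transform_within_open[OF has_derivative_const[of 0]])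
            (use 2 Fout in auto)
      from key[OF this] 2 show ?thesis by (simp add: g0_def g_def G_def S_def)
    next
      case 3
      then show ?thesis by (simp add: g0_def G_def S_def)
    qed
  qed
  have "G integrable_on UNIV" "(\<lambda>n. integral UNIV (g0 n)) \<longlonglongrightarrow> integral UNIV G"
    using dominated_convergence[of g0 UNIV dom G, OF has_integral_integrable[OF g0int] domint gle conv]
    by simp_all
  moreover have "integral UNIV (g0 n) = 0" for n using g0int by (rule integral_unique)
  ultimately have "integral UNIV G = 0" "G integrable_on UNIV"
    using LIMSEQ_unique[OF tendsto_const, of 0 "integral UNIV G"] by simp_all
  then have G: "(G has_integral 0) UNIV" by (metis integrable_integral)
  have "((\<lambda>z. if z \<in> ?D then f' z v else 0) has_integral 0) UNIV"
    by (rule has_integral_spike[OF neg _ G]) (auto simp: G_def S_def)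
  then show ?thesis by (simp only: has_integral_restrict_UNIV)
qed

definition jacobian ::
    "(complex \<Rightarrow> complex \<Rightarrow> real) \<Rightarrow> (complex \<Rightarrow> complex \<Rightarrow> real) \<Rightarrow> complex \<Rightarrow> real" where
  "jacobian u' w' z = u' z 1 * w' z \<i> - u' z \<i> * w' z 1"

text \<open>
  Stokes' theorem for the one-form \<open>u dw\<close> in the case where \<open>u\<close> vanishes on the boundary: the integrand
  is the curl of the vector field \<open>u \<nabla>w\<close>, since the second derivatives of \<open>w\<close> cancel by symmetry.
\<close>

lemma integral_jacobian_zero_boundary:
  assumes u: "disc_C1 u u'" and zero: "\<And>z. norm z = 1 \<Longrightarrow> u z = 0" and w: "disc_C2 w w'"
  shows "(jacobian u' w' has_integral 0) (cball 0 1)"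
proof -
  obtain g h where g: "disc_C1 (\<lambda>z. w' z \<i>) g" and h: "disc_C1 (\<lambda>z. w' z 1) h" and w1: "disc_C1 w w'"
    using w unfolding disc_C2_def by metis
  have sym: "g z 1 = h z \<i>" if "z \<in> ball 0 1" for z
    by (rule second_derivative_symmetric[OF open_ball that, where f = w and f' = w'])
      (use w1 g h in \<open>auto simp: disc_C1_def intro: continuous_on_subset[OF _ ball_subset_cball]\<close>)
  have int: "((\<lambda>z. (u z * g z 1 + u' z 1 * w' z \<i>) - (u z * h z \<i> + u' z \<i> * w' z 1)) has_integral 0
      - 0) (cball 0 1)"
    by (intro has_integral_diff integral_derivative_zero_boundary[OF disc_C1_mult[OF u g]]
       integral_derivative_zero_boundary[OF disc_C1_mult[OF u h]]) (simp_all add: zero)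
  have eq: "u z * g z 1 + u' z 1 * w' z \<i> - (u z * h z \<i> + u' z \<i> * w' z 1) = jacobian u' w' z"
    if "z \<in> cball 0 1" for z
  proof -
    have "z \<in> ball 0 1" if "norm z \<noteq> 1" using \<open>z \<in> cball 0 1\<close> that by simp
    then show ?thesis by (cases "norm z = 1") (use sym zero in \<open>auto simp: jacobian_def\<close>)
  qed
  show ?thesis using has_integral_eq[OF eq int] by simp
qed

section \<open>Antiderivatives and angle functions\<close>

lemmas vector_deriv_iff = has_real_derivative_iff_has_vector_derivative

text \<open>
  The antiderivative vanishing at \<open>0\<close>. Integrating over a fixed interval covers negative arguments
  and makes parameters in \<open>g\<close> easy to differentiate.
\<close>

definition primitive :: "(real \<Rightarrow> 'b::banach) \<Rightarrow> real \<Rightarrow> 'b" where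
  "primitive g x = x *\<^sub>R integral {0..1} (\<lambda>s. g (s * x))"

lemma primitive_has_vector_derivative:
  fixes g :: "real \<Rightarrow> 'b::banach"
  assumes g: "continuous_on UNIV g"
  shows "(primitive g has_vector_derivative g x) (at x)"
proof -
  define N where "N = \<bar>x\<bar> + 1"
  define G where "G y = integral {-N..y} g" for y
  have G: "(G has_vector_derivative g y) (at y)" if y: "y \<in> {-N<..<N}" for y
  proof -
    have "(G has_vector_derivative g y) (at y within {-N..N})"
      unfolding G_def by (rule integral_has_vector_derivative)
          (use y continuous_on_subset[OF g] in auto)
    then have "(G has_vector_derivative g y) (at y within {-N<..<N})"
      by (rule has_vector_derivative_within_subset) auto
    then show ?thesis using y by (simp add: at_within_open[of y "{-N<..<N}"])
  qed
  have eq: "G y - G 0 = primitive g y" if y: "y \<in> {-N<..<N}" for y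
  proof -
    have "((\<lambda>s. y *\<^sub>R g (s * y)) has_integral (G (1 * y) - G (0 * y))) {0..1}"
    proof (rule fundamental_theorem_of_calculus)
      fix s :: real assume s: "s \<in> {0..1}"
      have "\<bar>s * y\<bar> \<le> \<bar>y\<bar>" using s by (simp add: abs_mult mult_left_le_one_le)
      then have "s * y \<in> {-N<..<N}" using y by auto
      moreover have "((\<lambda>s. s * y) has_vector_derivative y) (at s)"
        unfolding vector_deriv_iff[symmetric]
            by (auto intro!: derivative_eq_intros)
      ultimately have "((G \<circ> (\<lambda>s. s * y)) has_vector_derivative y *\<^sub>R g (s * y)) (at s)"
        using vector_diff_chain_at G by blast
      then show "((\<lambda>s. G (s * y)) has_vector_derivative y *\<^sub>R g (s * y)) (at s within {0..1})"
        by (simp add: o_def has_vector_derivative_at_within)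
    qed simp
    from integral_unique[OF this] show ?thesis by (simp add: primitive_def)
  qed
  have x: "x \<in> {-N<..<N}" by (auto simp: N_def)
  have "((\<lambda>y. G y - G 0) has_vector_derivative g x) (at x)"
    using has_vector_derivative_diff[OF G[OF x] has_vector_derivative_const[of "G 0"]] by simp
  then show ?thesis
    by (rule has_vector_derivative_transform_within_open[where S = "{-N<..<N}"]) (use x eq in auto)
qed

text \<open>
  If \<open>A\<close> is this function, then \<open>A dq\<^sub>2\<close> is a primitive of the two-form \<open>F dq\<^sub>1 \<and> dq\<^sub>2\<close> on the
  plane.
\<close>

definition x_primitive :: "(real \<times> real \<Rightarrow> real) \<Rightarrow> real \<times> real \<Rightarrow> real" where
  "x_primitive F p = primitive (\<lambda>x. F (x, snd p)) (fst p)"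

text \<open>
  The first partial derivative comes from the fundamental theorem of calculus, the second from
  differentiation under the integral sign.
\<close>

lemma x_primitive_has_derivative:
  fixes F :: "real \<times> real \<Rightarrow> real"
  assumes "Ck_on 1 F UNIV"
  obtains A2 where "continuous_on UNIV A2"
    "\<And>p. (x_primitive F has_derivative (\<lambda>h. F p * fst h + A2 p * snd h)) (at p)"
proof -
  let ?F2 = "\<lambda>p. frechet_derivative F (at p) (0, 1)"
  define A2 where "A2 p = fst p * integral {0..1} (\<lambda>s. ?F2 (s * fst p, snd p))" for p
  have contF: "continuous_on S F" for S
    using Ck_on_continuous[OF assms] continuous_on_subset by blast
  have contF2: "continuous_on S ?F2" for S
    using assms continuous_on_subset[of UNIV ?F2] by simp
  have dF: "(F has_derivative frechet_derivative F (at p)) (at p)" for p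
    using Ck_on_Suc_has_derivative[of 0 F UNIV p] assms by simp
  have contA2: "continuous_on UNIV A2"
  proof -
    have "continuous_on UNIV (\<lambda>p::real\<times>real. integral (cbox 0 1) (\<lambda>s. ?F2 (s * fst p, snd p)))"
      by (rule integral_continuous_on_param)
        (auto simp: case_prod_unfold intro!: continuous_intros continuous_on_compose2[OF contF2[of
            UNIV]])
    then show ?thesis unfolding A2_def by (auto intro!: continuous_intros)
  qed
  show thesis
  proof (rule that[OF contA2])
    fix p :: "real \<times> real"
    obtain x y where p: "p = (x, y)" by (cases p)
    have "((\<lambda>(x, y). x_primitive F (x, y)) has_derivative (\<lambda>(tx, ty). F (x, y) * tx
        + blinfun_mult_right (A2 (x, y)) ty))
       (at (x, y) within UNIV \<times> UNIV)"
    proof (rule has_derivative_partialsI)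
      have "continuous_on UNIV (\<lambda>x. F (x, y))"
        by (auto intro!: continuous_intros continuous_on_compose2[OF contF[of UNIV]])
      from primitive_has_vector_derivative[OF this, of x]
      show "((\<lambda>x. x_primitive F (x, y)) has_derivative (*) (F (x, y))) (at x)"
        by (simp add: x_primitive_def[abs_def]
            vector_deriv_iff[symmetric] has_field_derivative_def)
    next
      fix x y :: real
      have "((\<lambda>y. integral (cbox 0 1) (\<lambda>s. F (s * x, y))) has_field_derivative
          integral (cbox 0 1) (\<lambda>s. ?F2 (s * x, y))) (at y within UNIV)"
      proof (rule leibniz_rule_field_derivative)
        fix y s :: real
        have "((\<lambda>y. F (s * x, y)) has_derivative (\<lambda>h. frechet_derivative F (at (s * x, y)) (0, h)))
            (at y)"
          by (rule has_derivative_compose[OF has_derivative_Pair[OF has_derivative_const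
              has_derivative_ident] dF])
        then show "((\<lambda>y. F (s * x, y)) has_field_derivative ?F2 (s * x, y)) (at y)"
        proof (rule has_derivative_imp_has_field_derivative)
          fix h :: real
          show "h * ?F2 (s * x, y) = frechet_derivative F (at (s * x, y)) (0, h)"
            using linear_cmul[OF has_derivative_linear[OF dF[of "(s * x, y)"]], of h "(0, 1)"]
            by (simp only: scaleR_Pair real_scaleR_def mult_zero_right mult_1_right)
        qed
      next
        show "(\<lambda>s. F (s * x, y)) integrable_on cbox 0 1" for y
          by (intro integrable_continuous) (auto intro!: continuous_intros continuous_on_compose2[OF
              contF[of UNIV]])
        show "continuous_on (UNIV \<times> cbox 0 1) (\<lambda>(y, s). ?F2 (s * x, y))"
          by (auto simp: case_prod_unfold intro!: continuous_intros continuous_on_compose2[OF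
              contF2[of UNIV]])
      qed auto
      then have "((\<lambda>y. x_primitive F (x, y)) has_field_derivative A2 (x, y)) (at y)"
        using DERIV_cmult[of _ _ y UNIV x] by (simp add: x_primitive_def primitive_def A2_def)
      then show "((\<lambda>y. x_primitive F (x, y)) has_derivative blinfun_apply (blinfun_mult_right (A2
          (x, y)))) (at y)"
        by (simp add: has_field_derivative_def)
    next
      have "continuous_on UNIV (\<lambda>p. blinfun_mult_right (A2 p))"
        by (intro bounded_linear.continuous_on[OF bounded_linear_blinfun_mult_right] contA2)
      then have "isCont (\<lambda>p. blinfun_mult_right (A2 p)) (x, y)"
        by (simp only: continuous_on_eq_continuous_at[OF open_UNIV] UNIV_I)
      then show "continuous (at (x, y) within UNIV \<times> UNIV) (\<lambda>(x, y). blinfun_mult_right (A2 (x, y)))"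
        by (simp only: case_prod_unfold prod.collapse UNIV_Times_UNIV)
    qed auto
    moreover have "(\<lambda>(x, y). x_primitive F (x, y)) = x_primitive F" by (rule ext) (simp add: split_beta)
    moreover have "(\<lambda>(tx, ty). F (x, y) * tx + blinfun_mult_right (A2 (x, y)) ty)
        = (\<lambda>h. F p * fst h + A2 p * snd h)"
      by (rule ext) (simp add: p split_beta)
    ultimately show "(x_primitive F has_derivative (\<lambda>h. F p * fst h + A2 p * snd h)) (at p)"
      by (simp only: p UNIV_Times_UNIV)
  qed
qed

lemma disc_C1_compose2:
  assumes A: "\<And>p. (A has_derivative (\<lambda>h. a p * fst h + b p * snd h)) (at (p :: real \<times> real))"
    and ab: "continuous_on UNIV a" "continuous_on UNIV b"
    and u: "disc_C1 u u'" and w: "disc_C1 w w'"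
  shows "disc_C1 (\<lambda>z. A (u z, w z)) (\<lambda>z h. a (u z, w z) * u' z h + b (u z, w z) * w' z h)"
proof -
  have cA: "continuous_on UNIV A"
    using A by (meson continuous_at_imp_continuous_on has_derivative_continuous)
  have "((\<lambda>z. A (u z, w z)) has_derivative (\<lambda>h. a (u z, w z) * u' z h + b (u z, w z) * w' z h)) (at z)"
    if "z \<in> ball 0 1" for z
    using has_derivative_compose[OF has_derivative_Pair A, of u "u' z" z UNIV w "w' z"] u w that
    by (simp add: disc_C1_def)
  then show ?thesis using u w unfolding disc_C1_def
    by (auto intro!: continuous_intros continuous_on_compose2[OF cA] continuous_on_compose2[OF
        ab(1)] continuous_on_compose2[OF ab(2)])
qed

lemma disc_C1_of_Ck_on:
  assumes "cball 0 1 \<subseteq> U" "Ck_on 1 u U"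
  shows "disc_C1 u (\<lambda>z. frechet_derivative u (at z))"
proof -
  have "continuous_on (cball 0 1) u" using Ck_on_continuous[OF assms(2)] assms(1)
      continuous_on_subset by blast
  moreover have "(u has_derivative frechet_derivative u (at z)) (at z)" if "z \<in> ball 0 1" for z
    using Ck_on_Suc_has_derivative[of 0 u U z] assms(2) subsetD[OF assms(1), of z] that by simp
  moreover have "continuous_on (cball 0 1) (\<lambda>z. frechet_derivative u (at z) h)" for h
    using continuous_on_subset[OF _ assms(1), of "\<lambda>z. frechet_derivative u (at z) h"] assms(2) by simp
  ultimately show ?thesis by (simp add: disc_C1_def)
qed

lemma disc_C2_of_Ck_on:
  assumes U: "cball 0 1 \<subseteq> U" and d: "\<And>z. z \<in> U \<Longrightarrow> (u has_derivative u' z) (at z)"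
    and Ck: "\<And>k h. Ck_on k (\<lambda>z. u' z h) U"
  shows "disc_C2 u u'"
proof -
  have "continuous_on (cball 0 1) u"
    by (intro continuous_at_imp_continuous_on ballI) (rule has_derivative_continuous[OF d[OF
        subsetD[OF U]]])
  moreover have "(u has_derivative u' z) (at z)" if "z \<in> ball 0 1" for z
    by (rule d) (use U that in auto)
  ultimately have "disc_C1 u u'"
    unfolding disc_C1_def using continuous_on_subset[OF Ck_on_continuous[OF Ck[of 0]] U] by blast
  moreover have "disc_C1 (\<lambda>z. u' z h) (\<lambda>z. frechet_derivative (\<lambda>z. u' z h) (at z))" for h
    by (rule disc_C1_of_Ck_on[OF U Ck])
  ultimately show ?thesis unfolding disc_C2_def by blast
qed

lemma disc_C2_add_const: "disc_C2 u u' \<Longrightarrow> disc_C2 (\<lambda>z. u z + c) u'"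
  unfolding disc_C2_def disc_C1_def by (auto intro!: continuous_intros derivative_eq_intros)

text \<open>
  A continuous logarithm exists because the disc is contractible. Near a point \<open>z\<close> the angle equals
  \<open>Q z + Im (Ln (cnj (v z) * v y))\<close>, because both sides are continuous lifts of the same map; this
  gives the derivative, which is exactly the pullback of the angular form.
\<close>

lemma angle_lift:
  fixes v :: "complex \<Rightarrow> complex"
  assumes U: "open U" "cball 0 1 \<subseteq> U" and Ck: "\<And>k. Ck_on k v U" "\<And>k h. Ck_on k (\<lambda>z. D z h) U"
    and D: "\<And>z. z \<in> U \<Longrightarrow> (v has_derivative D z) (at z)"
    and unit: "\<And>z. z \<in> cball 0 1 \<Longrightarrow> norm (v z) = 1"
  obtains Q where "disc_C2 Q (\<lambda>z h. Im (cnj (v z) * D z h))"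
    "\<And>z. z \<in> cball 0 1 \<Longrightarrow> v z = cis (Q z)"
proof -
  have contv: "continuous_on (cball 0 1) v"
    using Ck_on_continuous[OF Ck(1)[of 0]] U(2) continuous_on_subset by blast
  have "v z \<noteq> 0" if "z \<in> cball 0 1" for z using unit[OF that] by auto
  then obtain g where g: "continuous_on (cball 0 1) g" "\<And>z. z \<in> cball 0 1 \<Longrightarrow> v z = exp (g z)"
    using continuous_logarithm_on_contractible[OF contv convex_imp_contractible[OF convex_cball]]
        by metis
  define Q where "Q z = Im (g z)" for z
  have Q: "v z = cis (Q z)" if "z \<in> cball 0 1" for z
  proof -
    have "exp (Re (g z)) = 1" using unit[OF that] g(2)[OF that] by (simp add: norm_exp_eq_Re)
    then show ?thesis using g(2)[OF that] by (simp add: Q_def exp_eq_polar[of "g z"])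
  qed
  have contQ: "continuous_on (cball 0 1) Q" unfolding Q_def by (intro continuous_intros g)
  have dv: "(v has_derivative D z) (at z)" if "z \<in> cball 0 1" for z
    by (rule D[OF subsetD[OF U(2) that]])
  have dQ: "(Q has_derivative (\<lambda>h. Im (cnj (v z) * D z h))) (at z)" if z: "z \<in> ball 0 1" for z
  proof -
    have "continuous (at z) Q"
      by (rule continuous_on_interior[OF contQ]) (use z in simp)
    then have "eventually (\<lambda>y. dist (Q y) (Q z) < pi) (at z)"
      unfolding continuous_at tendsto_iff using pi_gt_zero by simp
    moreover have "eventually (\<lambda>y. y \<in> ball 0 1) (at z)"
      by (rule eventually_at_in_open'[OF open_ball z])
    ultimately have ev: "eventually (\<lambda>y. Q z + Im (Ln (cnj (v z) * v y)) = Q y) (at z)"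
    proof eventually_elim
      case (elim y)
      have "cnj (v z) * v y = exp (\<i> * complex_of_real (Q y - Q z))"
        unfolding cis_conv_exp[symmetric] using Q[of z] Q[of y] elim z by (simp add: cis_cnj cis_mult)
      moreover have "Ln (exp (\<i> * complex_of_real (Q y - Q z))) = \<i> * complex_of_real (Q y - Q z)"
        using elim by (intro Ln_exp) (auto simp: dist_real_def)
      ultimately show ?case by simp
    qed
    have one: "cnj (v z) * v z = 1"
      using Q[of z] z by (simp add: cis_cnj cis_mult)
    have "((\<lambda>y. cnj (v z) * v y) has_derivative (\<lambda>h. cnj (v z) * D z h)) (at z)"
      using dv[of z] z by (auto intro!: derivative_eq_intros)
    moreover have "(Ln has_derivative (\<lambda>h. h)) (at (cnj (v z) * v z))"
      using has_field_derivative_Ln[of 1] unfolding one by (simp add: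
          has_field_derivative_def mult_1[abs_def])
    ultimately have "((\<lambda>y. Ln (cnj (v z) * v y)) has_derivative (\<lambda>h. cnj (v z) * D z h)) (at z)"
      by (rule has_derivative_compose)
    then have "((\<lambda>y. Q z + Im (Ln (cnj (v z) * v y))) has_derivative (\<lambda>h. Im (cnj (v z) * D z h)))
        (at z)"
      by (auto intro!: derivative_eq_intros)
    then show ?thesis
      by (rule has_derivative_transform_eventually[OF _ ev]) (simp_all add: one)
  qed
  have Ck1: "Ck_on k (\<lambda>z. Im (cnj (v z) * D z h)) U" for h k
    by (intro Ck_on_linear_compose[OF bounded_linear_Im U(1)] Ck_on_mult[OF U(1)]
        Ck_on_linear_compose[OF bounded_linear_cnj U(1)] Ck)
  have "disc_C1 Q (\<lambda>z h. Im (cnj (v z) * D z h))"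
    unfolding disc_C1_def
    using contQ dQ continuous_on_subset[OF Ck_on_continuous[OF Ck1[of 0]] U(2)] by simp
  moreover have "disc_C1 (\<lambda>z. Im (cnj (v z) * D z h))
      (\<lambda>z. frechet_derivative (\<lambda>z. Im (cnj (v z) * D z h)) (at z))" for h
    by (rule disc_C1_of_Ck_on[OF U(2) Ck1])
  ultimately have "disc_C2 Q (\<lambda>z h. Im (cnj (v z) * D z h))"
    unfolding disc_C2_def by blast
  then show thesis by (rule that) (rule Q)
qed

section \<open>The symplectic area does not depend on the capping disc\<close>

abbreviation torus_lift :: "(complex \<times> complex \<Rightarrow> real) \<Rightarrow> real \<times> real \<Rightarrow> real" where
  "torus_lift F \<equiv> \<lambda>q. F (cis (fst q), cis (snd q))"

lemma disc_C2_continuous_on_circle: "disc_C2 u u' \<Longrightarrow> continuous_on (sphere 0 1) u"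
  unfolding disc_C2_def disc_C1_def by (meson continuous_on_subset sphere_cball)

text \<open>
  A capping disc lifts to the universal cover, and the pullbacks of \<open>dp\<^sub>i\<close> and \<open>dq\<^sub>i\<close> are the
  differentials of the coordinates of the lift.
\<close>

lemma capping_disc_coordinates:
  assumes "smooth_capping_disc T x v"
  defines "D \<equiv> \<lambda>z. frechet_derivative v (at z)"
  obtains P1 P2 Q1 Q2 where
    "disc_C2 P1 (\<lambda>z h. dp1 (D z h))" "disc_C2 P2 (\<lambda>z h. dp2 (D z h))"
    "disc_C2 Q1 (\<lambda>z h. dq1 (fst (v z)) (fst (D z h)))"
    "disc_C2 Q2 (\<lambda>z h. dq2 (fst (v z)) (fst (D z h)))"
    "\<And>z. z \<in> cball 0 1 \<Longrightarrow> v z = ((cis (Q1 z), cis (Q2 z)), (P1 z, P2 z))"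
proof -
  obtain U where U: "open U" "cball 0 1 \<subseteq> U" and sm: "\<And>k. Ck_on k v U"
    and im: "v ` cball 0 1 \<subseteq> cotangent_torus"
    using assms unfolding smooth_capping_disc_def smooth_on_def by blast
  have dv: "(v has_derivative D z) (at z)" if "z \<in> U" for z
    unfolding D_def by (rule Ck_on_Suc_has_derivative[OF sm[of "Suc 0"] that])
  have CkD: "Ck_on k (\<lambda>z. D z h) U" for k h using sm[of "Suc k"] by (simp add: D_def)
  have bl: "bounded_linear (\<lambda>y::phase. fst (fst y))" "bounded_linear (\<lambda>y::phase. snd (fst y))"
      "bounded_linear (\<lambda>y::phase. fst (snd y))" "bounded_linear (\<lambda>y::phase. snd (snd y))"
    by (intro bounded_linear_fst_comp bounded_linear_snd_comp bounded_linear_fst bounded_linear_snd)+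
  note d = bounded_linear.has_derivative[OF _ dv]
  note Ck = Ck_on_linear_compose[OF _ U(1) sm] and CkD = Ck_on_linear_compose[OF _ U(1) CkD]
  have unit: "norm (fst (fst (v z))) = 1" "norm (snd (fst (v z))) = 1" if "z \<in> cball 0 1" for z
    using im that unfolding cotangent_torus_def torus_def by fastforce+
  obtain Q1 where Q1: "disc_C2 Q1 (\<lambda>z h. Im (cnj (fst (fst (v z))) * fst (fst (D z h))))"
      "\<And>z. z \<in> cball 0 1 \<Longrightarrow> fst (fst (v z)) = cis (Q1 z)"
    by (rule angle_lift[OF U Ck[OF bl(1)] CkD[OF bl(1)] d[OF bl(1)] unit(1)]) blast+
  obtain Q2 where Q2: "disc_C2 Q2 (\<lambda>z h. Im (cnj (snd (fst (v z))) * snd (fst (D z h))))"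
      "\<And>z. z \<in> cball 0 1 \<Longrightarrow> snd (fst (v z)) = cis (Q2 z)"
    by (rule angle_lift[OF U Ck[OF bl(2)] CkD[OF bl(2)] d[OF bl(2)] unit(2)]) blast+
  show thesis
  proof (rule that)
    show "disc_C2 (\<lambda>z. fst (snd (v z))) (\<lambda>z h. dp1 (D z h))" unfolding dp1_def
      by (rule disc_C2_of_Ck_on[OF U(2) d[OF bl(3)] CkD[OF bl(3)]])
    show "disc_C2 (\<lambda>z. snd (snd (v z))) (\<lambda>z h. dp2 (D z h))" unfolding dp2_def
      by (rule disc_C2_of_Ck_on[OF U(2) d[OF bl(4)] CkD[OF bl(4)]])
    show "disc_C2 Q1 (\<lambda>z h. dq1 (fst (v z)) (fst (D z h)))" unfolding dq1_def by (rule Q1(1))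
    show "disc_C2 Q2 (\<lambda>z h. dq2 (fst (v z)) (fst (D z h)))" unfolding dq2_def by (rule Q2(1))
    show "v z = ((cis (Q1 z), cis (Q2 z)), (fst (snd (v z)), snd (snd (v z))))"
      if "z \<in> cball 0 1" for z
      using Q1(2)[OF that] Q2(2)[OF that] by (simp add: prod_eq_iff)
  qed
qed

text \<open>
  Two lifts of the same map differ by a continuous function with values in the discrete set
  \<open>2\<pi>\<int>\<close>.
\<close>

lemma cis_lifts_differ_by_constant:
  fixes a b :: "'a::topological_space \<Rightarrow> real"
  assumes "connected S" "continuous_on S a" "continuous_on S b" "\<And>z. z \<in> S \<Longrightarrow> cis (a z) = cis (b z)"
  obtains c where "cis c = 1" "\<And>z. z \<in> S \<Longrightarrow> a z = b z + c"
proof (cases "S = {}")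
  case True
  then show ?thesis using that[of 0] by simp
next
  case False
  then obtain z0 where z0: "z0 \<in> S" by blast
  have one: "cis (a z - b z) = 1" if "z \<in> S" for z
    using assms(4)[OF that] by (simp add: cis_divide[symmetric])
  have "(\<lambda>z. a z - b z) constant_on S"
  proof (rule continuous_discrete_range_constant[OF assms(1)])
    show "continuous_on S (\<lambda>z. a z - b z)" by (intro continuous_intros assms)
    fix z assume z: "z \<in> S"
    have "pi \<le> norm ((a y - b y) - (a z - b z))" if y: "y \<in> S" "a y - b y \<noteq> a z - b z" for y
    proof -
      define d where "d = (a y - b y) - (a z - b z)"
      have "cis d = 1" using one[OF z] one[OF y(1)] by (simp add: d_def cis_divide[symmetric])
      then have "cos d = 1" by (metis cis.simps(1) one_complex.simps(1))
      then obtain n :: int where "d = of_int n * 2 * pi" using cos_one_2pi_int by metis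
      moreover have "d \<noteq> 0" using y(2) by (simp add: d_def)
      ultimately have "1 \<le> \<bar>of_int n :: real\<bar>" "\<bar>d\<bar> = \<bar>of_int n :: real\<bar> * (2 * pi)"
        by (auto simp: abs_mult)
      then have "1 * (2 * pi) \<le> \<bar>d\<bar>" by (metis mult_right_mono pi_ge_zero mult_nonneg_nonneg
          zero_le_numeral)
      then show ?thesis using pi_gt_zero by (simp add: d_def[symmetric])
    qed
    then show "\<exists>e>0. \<forall>y. y \<in> S \<and> a y - b y \<noteq> a z - b z \<longrightarrow> e \<le> norm ((a y - b y) - (a z - b z))"
      using pi_gt_zero by blast
  qed
  then obtain c where c: "\<And>z. z \<in> S \<Longrightarrow> a z - b z = c" unfolding constant_on_def by blast
  show ?thesis
    by (rule that[of c]) (use one[OF z0] c[OF z0] c in \<open>auto simp: algebra_simps\<close>)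
qed

lemma capping_discs_agree_on_circle:
  assumes "smooth_capping_disc T x v" "smooth_capping_disc T x w" "norm z = 1"
  shows "v z = w z"
proof -
  have "z = cis (2 * pi * (Arg z / (2 * pi)))"
  proof -
    have "z \<noteq> 0" using assms(3) by auto
    then show ?thesis using cis_Arg[of z] assms(3) by (simp add: sgn_eq)
  qed
  then show ?thesis using assms unfolding smooth_capping_disc_def by metis
qed

text \<open>
  Let \<open>(P, Q)\<close> and \<open>(p, q)\<close> be lifts of the two discs, chosen to agree on the boundary circle, and
  write \<open>{u, w}\<close> for the Jacobian \<open>u\<^sub>x w\<^sub>y - u\<^sub>y w\<^sub>x\<close>. The area densities differ by
  \<open>{P\<^sub>i - p\<^sub>i, Q\<^sub>i} - {Q\<^sub>i - q\<^sub>i, p\<^sub>i}\<close>, summed over \<open>i\<close>, plus the magnetic terms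
  \<open>{A(Q\<^sub>1, Q\<^sub>2) - A(q\<^sub>1, Q\<^sub>2), Q\<^sub>2} - {B(Q\<^sub>2, q\<^sub>1) - B(q\<^sub>2, q\<^sub>1), q\<^sub>1}\<close>, where \<open>A\<close> and \<open>B\<close> are
  antiderivatives of the lift of \<open>F\<close> in the first and in the second variable. In each
  Jacobian the first entry vanishes on the circle, so its integral is zero. Changing
  one coordinate at a time has the effect that \<open>A\<close> and \<open>B\<close> only have to be once differentiable.
\<close>

lemma disc_area_unique:
  assumes F: "smooth_on_torus F" and v: "smooth_capping_disc T x v" and w: "smooth_capping_disc T x w"
  shows "disc_area F v = disc_area F w"
proof -
  define V where "V z = frechet_derivative v (at z)" for z
  define W where "W z = frechet_derivative w (at z)" for z
  obtain P1 P2 Q1 Q2 where P: "disc_C2 P1 (\<lambda>z h. dp1 (V z h))" "disc_C2 P2 (\<lambda>z h. dp2 (V z h))"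
    and Q: "disc_C2 Q1 (\<lambda>z h. dq1 (fst (v z)) (fst (V z h)))" "disc_C2 Q2
        (\<lambda>z h. dq2 (fst (v z)) (fst (V z h)))"
    and veq: "\<And>z. z \<in> cball 0 1 \<Longrightarrow> v z = ((cis (Q1 z), cis (Q2 z)), (P1 z, P2 z))"
    unfolding V_def by (rule capping_disc_coordinates[OF v]) blast
  obtain p1 p2 r1 r2 where p: "disc_C2 p1 (\<lambda>z h. dp1 (W z h))" "disc_C2 p2 (\<lambda>z h. dp2 (W z h))"
    and r: "disc_C2 r1 (\<lambda>z h. dq1 (fst (w z)) (fst (W z h)))" "disc_C2 r2
        (\<lambda>z h. dq2 (fst (w z)) (fst (W z h)))"
    and weq: "\<And>z. z \<in> cball 0 1 \<Longrightarrow> w z = ((cis (r1 z), cis (r2 z)), (p1 z, p2 z))"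
    unfolding W_def by (rule capping_disc_coordinates[OF w]) blast
  have agree: "v z = w z" if "norm z = 1" for z
    by (rule capping_discs_agree_on_circle[OF v w that])
  have Pp: "P1 z = p1 z" "P2 z = p2 z" and Qr: "cis (Q1 z) = cis (r1 z)" "cis (Q2 z) = cis (r2 z)"
    if "z \<in> sphere 0 1" for z
    using agree[of z] veq[of z] weq[of z] that by auto
  have conn: "connected (sphere (0::complex) 1)" by (rule connected_sphere) simp
  have cont: "continuous_on (sphere 0 1) Q1" "continuous_on (sphere 0 1) Q2"
     "continuous_on (sphere 0 1) r1" "continuous_on (sphere 0 1) r2"
    by (intro disc_C2_continuous_on_circle[OF Q(1)] disc_C2_continuous_on_circle[OF Q(2)]
        disc_C2_continuous_on_circle[OF r(1)] disc_C2_continuous_on_circle[OF r(2)])+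
  obtain c1 where c1: "cis c1 = 1" "\<And>z. z \<in> sphere 0 1 \<Longrightarrow> Q1 z = r1 z + c1"
    by (rule cis_lifts_differ_by_constant[OF conn cont(1,3) Qr(1)]) blast+
  obtain c2 where c2: "cis c2 = 1" "\<And>z. z \<in> sphere 0 1 \<Longrightarrow> Q2 z = r2 z + c2"
    by (rule cis_lifts_differ_by_constant[OF conn cont(2,4) Qr(2)]) blast+
  \<comment> \<open>Shift the lift of \<open>w\<close> by a deck transformation, so that the lifts agree on the circle.\<close>
  define q1 where "q1 z = r1 z + c1" for z
  define q2 where "q2 z = r2 z + c2" for z
  have q: "disc_C2 q1 (\<lambda>z h. dq1 (fst (w z)) (fst (W z h)))" "disc_C2 q2
      (\<lambda>z h. dq2 (fst (w z)) (fst (W z h)))"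
    unfolding q1_def q2_def by (intro disc_C2_add_const r)+
  have weq': "w z = ((cis (q1 z), cis (q2 z)), (p1 z, p2 z))" if "z \<in> cball 0 1" for z
    using weq[OF that] c1(1) c2(1) by (simp add: q1_def q2_def cis_mult[symmetric])

  let ?F = "torus_lift F"
  have Fk: "Ck_on k ?F UNIV" for k using F by (simp add: smooth_on_torus_def smooth_on_def)
  have contF: "continuous_on UNIV ?F" by (rule Ck_on_continuous[OF Fk[of 0]])
  obtain A2 where A: "continuous_on UNIV A2"
     "\<And>p. (x_primitive ?F has_derivative (\<lambda>h. ?F p * fst h + A2 p * snd h)) (at p)"
    by (rule x_primitive_has_derivative[OF Fk]) blast
  \<comment> \<open>Swapping the variables turns \<open>x_primitive\<close> into an antiderivative in the second variable.\<close>
  define sF where "sF q = ?F (snd q, fst q)" for q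
  have "Ck_on k sF UNIV" for k
  proof -
    have "bounded_linear (\<lambda>q::real\<times>real. (snd q, fst q))"
      by (intro bounded_linear_Pair bounded_linear_fst bounded_linear_snd)
    then show ?thesis unfolding sF_def
      by (rule Ck_on_compose[OF open_UNIV open_UNIV subset_UNIV Fk Ck_on_bounded_linear[OF _
          open_UNIV]])
  qed
  then obtain B1 where B1: "continuous_on UNIV B1"
     "\<And>p. (x_primitive sF has_derivative (\<lambda>h. sF p * fst h + B1 p * snd h)) (at p)"
    by (rule x_primitive_has_derivative) blast
  have contsF: "continuous_on UNIV sF" unfolding sF_def
    by (intro continuous_on_compose2[OF contF] continuous_intros) auto

  let ?P1' = "\<lambda>z h. dp1 (V z h)" and ?P2' = "\<lambda>z h. dp2 (V z h)"
  let ?Q1' = "\<lambda>z h. dq1 (fst (v z)) (fst (V z h))" and ?Q2' = "\<lambda>z h. dq2 (fst (v z)) (fst (V z h))"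
  let ?p1' = "\<lambda>z h. dp1 (W z h)" and ?p2' = "\<lambda>z h. dp2 (W z h)"
  let ?q1' = "\<lambda>z h. dq1 (fst (w z)) (fst (W z h))" and ?q2' = "\<lambda>z h. dq2 (fst (w z)) (fst (W z h))"
  define \<phi> where "\<phi> z = jacobian ?P1' ?Q1' z + jacobian ?P2' ?Q2' z
     + ?F (Q1 z, Q2 z) * jacobian ?Q1' ?Q2' z" for z
  define \<psi> where "\<psi> z = jacobian ?p1' ?q1' z + jacobian ?p2' ?q2' z
     + ?F (q1 z, q2 z) * jacobian ?q1' ?q2' z" for z
  note unfold = twisted_form_def canonical_form_def magnetic_form_def wedge_def jacobian_def
  have areav: "disc_area F v = integral (cball 0 1) \<phi>" unfolding disc_area_def
    by (rule integral_cong) (use veq in \<open>simp add: \<phi>_def unfold V_def algebra_simps\<close>)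
  have areaw: "disc_area F w = integral (cball 0 1) \<psi>" unfolding disc_area_def
    by (rule integral_cong) (use weq' in \<open>simp add: \<psi>_def unfold W_def algebra_simps\<close>)
  note C1 = P[unfolded disc_C2_def, THEN conjunct1] Q[unfolded disc_C2_def, THEN conjunct1]
     p[unfolded disc_C2_def, THEN conjunct1] q[unfolded disc_C2_def, THEN conjunct1]
  note a = disc_C1_compose2[OF A(2) contF A(1)]
  note b = disc_C1_compose2[OF B1(2) contsF B1(1)]
  note zero = integral_jacobian_zero_boundary
  have I1: "(jacobian (\<lambda>z h. ?P1' z h - ?p1' z h) ?Q1' has_integral 0) (cball 0 1)"
    by (rule zero[OF disc_C1_diff[OF C1(1) C1(5)] _ Q(1)]) (use Pp in auto)
  have I2: "(jacobian (\<lambda>z h. ?Q1' z h - ?q1' z h) ?p1' has_integral 0) (cball 0 1)"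
    by (rule zero[OF disc_C1_diff[OF C1(3) C1(7)] _ p(1)]) (use c1(2) in \<open>auto simp: q1_def\<close>)
  have I3: "(jacobian (\<lambda>z h. ?P2' z h - ?p2' z h) ?Q2' has_integral 0) (cball 0 1)"
    by (rule zero[OF disc_C1_diff[OF C1(2) C1(6)] _ Q(2)]) (use Pp in auto)
  have I4: "(jacobian (\<lambda>z h. ?Q2' z h - ?q2' z h) ?p2' has_integral 0) (cball 0 1)"
    by (rule zero[OF disc_C1_diff[OF C1(4) C1(8)] _ p(2)]) (use c2(2) in \<open>auto simp: q2_def\<close>)
  note I5 = zero[OF disc_C1_diff[OF a[OF C1(3) C1(4)] a[OF C1(7) C1(4)]] _ Q(2)]
  note I6 = zero[OF disc_C1_diff[OF b[OF C1(4) C1(7)] b[OF C1(8) C1(7)]] _ q(1)]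
  note I56 = has_integral_diff[OF has_integral_add[OF has_integral_diff[OF has_integral_add[OF
        has_integral_diff[OF I1 I2] I3] I4] I5] I6]
  have "((\<lambda>z. \<phi> z - \<psi> z) has_integral 0 - 0 + 0 - 0 + 0 - 0) (cball 0 1)"
    by (rule has_integral_eq[OF _ I56])
      (use c1 c2 in \<open>simp_all add: \<phi>_def \<psi>_def sF_def q1_def q2_def jacobian_def algebra_simps\<close>)
  then have diff: "((\<lambda>z. \<phi> z - \<psi> z) has_integral 0) (cball 0 1)" by simp
  have "integral (cball 0 1) \<phi> = integral (cball 0 1) \<psi>"
  proof (cases "\<psi> integrable_on cball 0 1")
    case True
    then show ?thesis using integral_unique[OF has_integral_add[OF diff integrable_integral[OF
        True]]] by simp
  next
    case False
    have "\<psi> integrable_on cball 0 1" if "\<phi> integrable_on cball 0 1"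
      using has_integral_integrable[OF has_integral_diff[OF integrable_integral[OF that] diff]] by simp
    then show ?thesis using False by (metis not_integrable_integral)
  qed
  then show ?thesis by (simp add: areav areaw)
qed

section \<open>Extending a smooth loop over the disc\<close>

text \<open>
  This family is closed under differentiation up to linear combinations, which makes every member
  smooth; \<open>flat 0\<close> is the usual function that is flat at the origin.
\<close>

definition flat :: "nat \<Rightarrow> real \<Rightarrow> real" where
  "flat n x = (if x > 0 then exp (- 1 / x) / x ^ n else 0)"

text \<open>
  With \<open>k = n + 1\<close> and \<open>y = 1/x\<close>, the inequality \<open>y/k \<le> exp (y/k)\<close> is raised to the power \<open>k\<close>.
\<close>

lemma flat_bound: "\<bar>flat n x\<bar> \<le> real (Suc n) ^ Suc n * \<bar>x\<bar>"
proof (cases "x > 0")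
  case True
  let ?m = "real (Suc n)"
  have "1 / x / ?m \<le> exp (1 / x / ?m)" using exp_ge_add_one_self[of "1 / x / ?m"] by linarith
  then have "(1 / x / ?m) ^ Suc n \<le> exp (1 / x / ?m) ^ Suc n"
    using True by (intro power_mono) auto
  also have "\<dots> = exp (?m * (1 / x / ?m))" by (rule exp_of_nat_mult[symmetric])
  also have "\<dots> = exp (1 / x)" by simp
  finally have "1 \<le> exp (1 / x) * (?m ^ Suc n * x ^ Suc n)"
    using True by (simp add: power_divide divide_simps mult_ac del: power_Suc of_nat_Suc)
  then have "exp (- 1 / x) \<le> ?m ^ Suc n * x ^ Suc n"
    by (simp add: exp_minus divide_simps mult_ac del: power_Suc of_nat_Suc)
  then show ?thesis
    using True by (simp add: flat_def pos_divide_le_eq mult_ac del: of_nat_Suc)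
next
  case False
  have "0 \<le> real (Suc n) ^ Suc n * \<bar>x\<bar>" by (intro mult_nonneg_nonneg) auto
  then show ?thesis using False by (simp add: flat_def)
qed

lemma flat_has_derivative:
  "(flat n has_real_derivative flat (n + 2) x - n * flat (n + 1) x) (at x)"
proof -
  consider "x > 0" | "x < 0" | "x = 0" by linarith
  then show ?thesis
  proof cases
    case 1
    have "((\<lambda>x. exp (- 1 / x) / x ^ n) has_real_derivative flat (n + 2) x - n * flat (n + 1) x) (at x)"
    proof (cases n)
      case 0
      then show ?thesis using 1
        by (auto intro!: derivative_eq_intros simp: flat_def power2_eq_square divide_simps)
    next
      case (Suc m)
      then show ?thesis using 1
        by (auto intro!: derivative_eq_intros simp: flat_def)
          (cases m; simp add: divide_simps algebra_simps)
    qed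
    then show ?thesis
      by (rule has_field_derivative_transform_within_open[where S = "{0<..}"])
        (use 1 in \<open>auto simp: flat_def\<close>)
  next
    case 2
    have "((\<lambda>x::real. 0) has_real_derivative flat (n + 2) x - n * flat (n + 1) x) (at x)"
      using 2 by (simp add: flat_def)
    then show ?thesis
      by (rule has_field_derivative_transform_within_open[where S = "{..<0}"])
        (use 2 in \<open>auto simp: flat_def\<close>)
  next
    case 3
    have "((\<lambda>y. real (Suc (Suc n)) ^ Suc (Suc n) * \<bar>y\<bar>) \<longlongrightarrow> 0) (at 0)"
      by (auto intro!: tendsto_eq_intros)
    then have "((\<lambda>y. flat (Suc n) y) \<longlongrightarrow> 0) (at 0)"
      by (rule Lim_null_comparison[rotated]) (use flat_bound[of "Suc n"] in auto)
    moreover have "flat (Suc n) y = (flat n (0 + y) - flat n 0) / y" for y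
      by (simp add: flat_def divide_simps)
    ultimately show ?thesis by (simp add: DERIV_def 3 flat_def[of _ 0])
  qed
qed

lemma Ck_on_flat: "Ck_on k (flat n) UNIV"
proof (induction k arbitrary: n)
  case 0
  show ?case using flat_has_derivative
    by (auto intro!: continuous_at_imp_continuous_on DERIV_isCont)
next
  case (Suc k)
  have "Ck_on k (\<lambda>x. flat (n + 2) x + - (real n * flat (n + 1) x)) UNIV"
    by (intro Ck_on_add[OF open_UNIV] Suc Ck_on_linear_compose[OF bounded_linear_minus[OF
        bounded_linear_mult_right] open_UNIV Suc])
  moreover have "(flat n has_vector_derivative flat (n + 2) x + - (real n * flat (n + 1) x))
      (at x)" for x
    using flat_has_derivative[of n x] by (simp add: vector_deriv_iff)
  ultimately show ?case by (intro Ck_on_vector_derivative[OF open_UNIV, of "flat n"])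
qed

text \<open>
  A smooth function that is \<open>1\<close> on the unit circle and \<open>0\<close> near the origin, where the angle is
  singular.
\<close>

definition radial_cutoff :: "complex \<Rightarrow> real" where
  "radial_cutoff z = flat 0 (z \<bullet> z - 1 / 4) / flat 0 (3 / 4)"

lemma Ck_on_radial_cutoff: "Ck_on k radial_cutoff UNIV"
proof -
  have id: "Ck_on k (\<lambda>z::complex. z) UNIV" by (rule Ck_on_bounded_linear[OF bounded_linear_ident
      open_UNIV])
  have "Ck_on k (\<lambda>z::complex. z \<bullet> z + - 1 / 4) UNIV"
    by (rule Ck_on_add[OF open_UNIV Ck_on_inner[OF open_UNIV id id] Ck_on_const[OF open_UNIV]])
  then have "Ck_on k (\<lambda>z::complex. flat 0 (z \<bullet> z + - 1 / 4)) UNIV"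
    by (rule Ck_on_compose[OF open_UNIV open_UNIV subset_UNIV Ck_on_flat])
  from Ck_on_linear_compose[OF bounded_linear_mult_left[of "1 / flat 0 (3 / 4)"] open_UNIV this]
  show ?thesis by (simp add: radial_cutoff_def[abs_def])
qed

lemma radial_cutoff_circle: "norm z = 1 \<Longrightarrow> radial_cutoff z = 1"
proof -
  assume "norm z = 1"
  then have "z \<bullet> z - 1 / 4 = 3 / 4" using norm_eq_1[of z] by simp
  moreover have "flat 0 (3 / 4) \<noteq> 0" unfolding flat_def by simp
  ultimately show ?thesis by (simp add: radial_cutoff_def)
qed

lemma radial_cutoff_centre: "norm z < 1 / 2 \<Longrightarrow> radial_cutoff z = 0"
proof -
  assume "norm z < 1 / 2"
  then have "(norm z)\<^sup>2 < (1 / 2)\<^sup>2" by (intro power_strict_mono) auto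
  then show ?thesis by (simp add: radial_cutoff_def dot_square_norm flat_def power2_eq_square)
qed

lemma periodic_eq_of_cis_eq:
  fixes u :: "real \<Rightarrow> 'b"
  assumes "\<And>s. u (s + 2 * pi) = u s" "cis a = cis b"
  shows "u a = u b"
proof -
  have nat: "u (s + 2 * pi * real n) = u s" for s n
  proof (induction n)
    case (Suc n)
    have "u (s + 2 * pi * real (Suc n)) = u ((s + 2 * pi * real n) + 2 * pi)"
        by (simp add: algebra_simps)
    then show ?case using Suc assms(1) by simp
  qed simp
  have "sin a = sin b \<and> cos a = cos b" using assms(2) by (simp add: complex_eq_iff)
  then obtain n :: int where n: "a = b + 2 * pi * n" using sin_cos_eq_iff by blast
  show ?thesis
  proof (cases "n \<ge> 0")
    case True
    then show ?thesis using n nat[of b "nat n"] by simp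
  next
    case False
    then have "b = a + 2 * pi * real (nat (- n))" using n by simp
    then show ?thesis using nat[of a "nat (- n)"] by simp
  qed
qed

lemma slit_plane_derivative_Arg:
  assumes "z \<notin> \<real>\<^sub>\<le>\<^sub>0"
  shows "(Arg has_derivative (\<lambda>h. Im (h / z))) (at z)"
proof -
  have "(*) (inverse z) = (\<lambda>h. h / z)" by (rule ext) (simp add: divide_inverse)
  then have "(Ln has_derivative (\<lambda>h. h / z)) (at z)"
    using has_field_derivative_Ln[OF assms] by (simp only: has_field_derivative_def)
  then have "((\<lambda>z. Im (Ln z)) has_derivative (\<lambda>h. Im (h / z))) (at z)"
    by (rule has_derivative_Im)
  moreover have "z \<in> - {0}" using assms by auto
  ultimately show ?thesis
    by (rule has_derivative_transform_within_open[OF _ open_Compl[OF closed_singleton]]) (simp add: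
        Arg_eq_Im_Ln)
qed

lemma Ck_on_Arg: "Ck_on k Arg (- \<real>\<^sub>\<le>\<^sub>0)"
proof -
  have op: "open (- \<real>\<^sub>\<le>\<^sub>0 :: complex set)" by (simp add: open_Compl)
  have "Ck_on (Suc k) Ln (- \<real>\<^sub>\<le>\<^sub>0)"
  proof (rule Ck_on_field_derivative[OF op])
    show "(Ln has_field_derivative inverse z) (at z)" if "z \<in> - \<real>\<^sub>\<le>\<^sub>0" for z
      using that by (intro has_field_derivative_Ln) simp
    show "Ck_on k inverse (- \<real>\<^sub>\<le>\<^sub>0 :: complex set)"
      by (rule Ck_on_subset[OF Ck_on_inverse]) auto
  qed
  then have "Ck_on k (\<lambda>z. Im (Ln z)) (- \<real>\<^sub>\<le>\<^sub>0)"
    by (rule Ck_on_linear_compose[OF bounded_linear_Im op Ck_on_lower])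
  then show ?thesis
  proof (rule Ck_on_cong[OF op, rotated])
    fix z :: complex assume "z \<in> - \<real>\<^sub>\<le>\<^sub>0"
    then have "z \<noteq> 0" by auto
    then show "Im (Ln z) = Arg z" by (simp add: Arg_eq_Im_Ln)
  qed
qed

text \<open>
  The principal argument is smooth off the negative real axis. Near that axis, the argument of \<open>-z\<close>
  plus \<open>\<pi>\<close> is used instead; it gives the same value because \<open>u\<close> is periodic.
\<close>

lemma angular_function:
  fixes u :: "real \<Rightarrow> 'b::euclidean_space"
  assumes Ck: "\<And>k. Ck_on k u UNIV" and per: "\<And>s. u (s + 2 * pi) = u s"
    and der: "\<And>s. (u has_vector_derivative u' s) (at s)"
  shows "Ck_on k (\<lambda>z. u (Arg z)) (- {0})"
    and "z \<noteq> 0 \<Longrightarrow> \<exists>s. ((\<lambda>z. u (Arg z)) has_derivative (\<lambda>h. Im (h / z) *\<^sub>R u' s)) (at z)"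
proof -
  let ?S = "- \<real>\<^sub>\<le>\<^sub>0 :: complex set" and ?S' = "{z::complex. - z \<notin> \<real>\<^sub>\<le>\<^sub>0}"
  have op: "open ?S" by (simp add: open_Compl)
  have "?S' = uminus -` ?S" by auto
  moreover have "open (uminus -` ?S)" by (intro open_vimage op continuous_intros)
  ultimately have op': "open ?S'" by simp
  have un: "?S \<union> ?S' = - {0}"
    by (auto simp: complex_nonpos_Reals_iff complex_eq_iff)
  have eq: "u (Arg (- z) + pi) = u (Arg z)" if "z \<noteq> 0" for z
  proof (rule periodic_eq_of_cis_eq[where u = u, OF per])
    have "cis (Arg (- z) + pi) = cis (Arg (- z)) * cis pi" by (rule cis_mult[symmetric])
    also have "\<dots> = sgn z" using that by (simp add: cis_Arg sgn_minus)
    finally show "cis (Arg (- z) + pi) = cis (Arg z)" using that by (simp add: cis_Arg)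
  qed
  have neg: "Ck_on k (\<lambda>z::complex. - z) ?S'" for k
    by (intro Ck_on_bounded_linear bounded_linear_minus bounded_linear_ident op')
  have "Ck_on k (\<lambda>z. Arg (- z) + pi) ?S'"
    by (intro Ck_on_add[OF op'] Ck_on_const[OF op'] Ck_on_compose[OF op' op _ Ck_on_Arg neg]) auto
  then have "Ck_on k (\<lambda>z. u (Arg (- z) + pi)) ?S'"
    by (rule Ck_on_compose[OF op' open_UNIV subset_UNIV Ck])
  then have "Ck_on k (\<lambda>z. u (Arg z)) ?S'"
    by (rule Ck_on_cong[OF op', rotated]) (auto intro!: eq)
  moreover have "Ck_on k (\<lambda>z. u (Arg z)) ?S"
    by (rule Ck_on_compose[OF op open_UNIV subset_UNIV Ck Ck_on_Arg])
  ultimately show "Ck_on k (\<lambda>z. u (Arg z)) (- {0})"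
    using Ck_on_Un[OF op op', of k "\<lambda>z. u (Arg z)"] un by simp
  have du: "(u has_derivative (\<lambda>h. h *\<^sub>R u' s)) (at s)" for s
    using der unfolding has_vector_derivative_def .
  assume z: "z \<noteq> 0"
  show "\<exists>s. ((\<lambda>z. u (Arg z)) has_derivative (\<lambda>h. Im (h / z) *\<^sub>R u' s)) (at z)"
  proof (cases "z \<in> ?S")
    case True
    then show ?thesis using has_derivative_compose[OF slit_plane_derivative_Arg du, of z] by auto
  next
    case False
    then have z': "z \<in> ?S'" using un z by blast
    have "((\<lambda>z. Arg (- z)) has_derivative (\<lambda>h. Im ((- h) / (- z)))) (at z)"
      by (rule has_derivative_compose[OF has_derivative_minus[OF
          has_derivative_ident] slit_plane_derivative_Arg])
        (use z' in auto)
    then have "((\<lambda>z. Arg (- z) + pi) has_derivative (\<lambda>h. Im (h / z))) (at z)"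
      by (auto intro!: derivative_eq_intros)
    from has_derivative_compose[OF this du]
    have "((\<lambda>z. u (Arg (- z) + pi)) has_derivative (\<lambda>h. Im (h / z) *\<^sub>R u' (Arg (- z) + pi))) (at z)" .
    then have "((\<lambda>z. u (Arg z)) has_derivative (\<lambda>h. Im (h / z) *\<^sub>R u' (Arg (- z) + pi))) (at z)"
      by (rule has_derivative_transform_within_open[OF _ op' z']) (auto intro!: eq)
    then show ?thesis by blast
  qed
qed

lemma radial_cutoff_bounds:
  obtains K where "K \<ge> 0" "\<And>z. z \<in> cball 0 1 \<Longrightarrow> \<bar>radial_cutoff z\<bar> \<le> K"
    "\<And>z h. z \<in> cball 0 1 \<Longrightarrow> \<bar>frechet_derivative radial_cutoff (at z) h\<bar> \<le> K * norm h"
proof -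
  let ?D = "\<lambda>z. frechet_derivative radial_cutoff (at z)"
  let ?g = "\<lambda>z. \<bar>radial_cutoff z\<bar> + (\<bar>?D z 1\<bar> + \<bar>?D z \<i>\<bar>)"
  have "continuous_on (cball 0 1) (\<lambda>z. ?D z h)" for h
    using Ck_on_radial_cutoff[of "Suc 0"] continuous_on_subset[of UNIV "\<lambda>z. ?D z h" "cball 0 1"] by simp
  moreover have "continuous_on (cball 0 1) radial_cutoff"
    using Ck_on_continuous[OF Ck_on_radial_cutoff[of 0]] continuous_on_subset by blast
  ultimately have "compact (?g ` cball 0 1)"
    by (intro compact_continuous_image continuous_intros) auto
  from compact_imp_bounded[OF this] obtain K where K: "\<And>z. z \<in> cball 0 1 \<Longrightarrow> ?g z \<le> K"
    unfolding bounded_iff by fastforce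
  show thesis
  proof (rule that)
    show "K \<ge> 0" using K[of 0] by auto
    show "\<bar>radial_cutoff z\<bar> \<le> K" if "z \<in> cball 0 1" for z using K[OF that] by linarith
    show "\<bar>?D z h\<bar> \<le> K * norm h" if "z \<in> cball 0 1" for z h
    proof -
      have lin: "linear (?D z)"
        by (rule has_derivative_linear[OF Ck_on_Suc_has_derivative[OF Ck_on_radial_cutoff[of "Suc
            0"]]]) simp
      have "(\<bar>?D z 1\<bar> + \<bar>?D z \<i>\<bar>) * norm h \<le> K * norm h"
        using K[OF that] by (intro mult_right_mono) auto
      with linear_complex_bound[OF lin, of h] show ?thesis by linarith
    qed
  qed
qed

text \<open>
  The extension is the loop as a function of the angle, multiplied by the radial cutoff. The constant
  \<open>K\<close> depends on the cutoff only and not on the loop, which is what makes the areas of the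
  orbits uniformly bounded.
\<close>

lemma smooth_extension_to_disc:
  obtains K :: real where "K \<ge> 0"
    "\<And>(u :: real \<Rightarrow> 'b::euclidean_space) u' B. \<lbrakk>\<And>k. Ck_on k u UNIV; \<And>s. u (s + 2 * pi) = u s;
       \<And>s. (u has_vector_derivative u' s) (at s); \<And>s. norm (u s) \<le> B; \<And>s. norm (u' s) \<le> B\<rbrakk> \<Longrightarrow>
       \<exists>Y. (\<forall>k. Ck_on k Y UNIV) \<and> (\<forall>s. Y (cis s) = u s) \<and>
         (\<forall>z\<in>cball 0 1. \<forall>h. norm (frechet_derivative Y (at z) h) \<le> K * B * norm h)"
proof -
  obtain K where K: "K \<ge> 0" "\<And>z. z \<in> cball 0 1 \<Longrightarrow> \<bar>radial_cutoff z\<bar> \<le> K"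
    "\<And>z h. z \<in> cball 0 1 \<Longrightarrow> \<bar>frechet_derivative radial_cutoff (at z) h\<bar> \<le> K * norm h"
    by (rule radial_cutoff_bounds) blast
  show thesis
  proof (rule that[of "3 * K"])
    show "3 * K \<ge> 0" using K by simp
    fix u :: "real \<Rightarrow> 'b" and u' B
    assume Ck: "\<And>k. Ck_on k u UNIV" and per: "\<And>s. u (s + 2 * pi) = u s"
       and der: "\<And>s. (u has_vector_derivative u' s) (at s)"
       and B: "\<And>s. norm (u s) \<le> B" "\<And>s. norm (u' s) \<le> B"
    define Y where "Y z = radial_cutoff z *\<^sub>R u (Arg z)" for z
    have B0: "B \<ge> 0" using B(1)[of 0] norm_ge_zero order_trans by blast
    have op: "open (- {0::complex})" by auto
    have zero: "Y z = 0" if "z \<in> ball 0 (1/2)" for z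
      using that by (simp add: Y_def radial_cutoff_centre)
    have Ck1: "Ck_on k Y (- {0})" for k unfolding Y_def
      by (rule Ck_on_scaleR[OF op Ck_on_subset[OF Ck_on_radial_cutoff] angular_function(1)[OF Ck per
          der]]) auto
    have Ck2: "Ck_on k Y (ball 0 (1/2))" for k
      by (rule Ck_on_cong[OF open_ball _ Ck_on_const[OF open_ball, where c = 0]]) (use zero in auto)
    have "- {0} \<union> ball 0 (1/2) = (UNIV :: complex set)" by auto
    then have CkY: "Ck_on k Y UNIV" for k using Ck_on_Un[OF op open_ball Ck1 Ck2] by metis
    have circ: "Y (cis s) = u s" for s
    proof -
      have "u (Arg (cis s)) = u s"
        by (rule periodic_eq_of_cis_eq[where u = u, OF per]) (simp add: cis_Arg sgn_eq)
      then show ?thesis by (simp add: Y_def radial_cutoff_circle)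
    qed
    have "norm (frechet_derivative Y (at z) h) \<le> 3 * K * B * norm h" if z: "z \<in> cball 0 1" for z h
    proof (cases "norm z < 1 / 2")
      case True
      have "(Y has_derivative (\<lambda>_. 0)) (at z)"
        by (rule has_derivative_transform_within_open[OF has_derivative_const[of 0] open_ball[of 0
            "1/2"]])
          (use True zero in auto)
      then have "frechet_derivative Y (at z) = (\<lambda>_. 0)" by (rule frechet_derivative_at[symmetric])
      then show ?thesis using K(1) B0 by simp
    next
      case False
      then have z0: "z \<noteq> 0" "norm z \<ge> 1 / 2" by auto
      obtain s where s: "((\<lambda>z. u (Arg z)) has_derivative (\<lambda>h. Im (h / z) *\<^sub>R u' s)) (at z)"
        using angular_function(2)[OF Ck per der z0(1)] by blast
      have "(radial_cutoff has_derivative frechet_derivative radial_cutoff (at z)) (at z)"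
        by (rule Ck_on_Suc_has_derivative[OF Ck_on_radial_cutoff[of "Suc 0"]]) simp
      from frechet_derivative_at[OF has_derivative_scaleR[OF this s]]
      have "frechet_derivative Y (at z) h = radial_cutoff z *\<^sub>R (Im (h / z) *\<^sub>R u' s)
          + frechet_derivative radial_cutoff (at z) h *\<^sub>R u (Arg z)"
        unfolding Y_def[abs_def] by (rule fun_cong[symmetric])
      also have "norm \<dots> \<le> \<bar>radial_cutoff z\<bar> * (\<bar>Im (h / z)\<bar> * norm (u' s))
          + \<bar>frechet_derivative radial_cutoff (at z) h\<bar> * norm (u (Arg z))"
        by (rule order_trans[OF norm_triangle_ineq]) (simp add: abs_mult)
      also have "\<dots> \<le> K * ((2 * norm h) * B) + (K * norm h) * B"
      proof -
        have "\<bar>Im (h / z)\<bar> \<le> norm h / norm z" using abs_Im_le_cmod[of "h / z"]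
            by (simp add: norm_divide)
        also have "\<dots> \<le> norm h / (1 / 2)" using z0 by (intro divide_left_mono) auto
        finally have im: "\<bar>Im (h / z)\<bar> \<le> 2 * norm h" by simp
        have "\<bar>Im (h / z)\<bar> * norm (u' s) \<le> (2 * norm h) * B"
          by (rule mult_mono[OF im B(2)]) simp_all
        then have "\<bar>radial_cutoff z\<bar> * (\<bar>Im (h / z)\<bar> * norm (u' s)) \<le> K * ((2 * norm h) * B)"
          by (rule mult_mono[OF K(2)[OF z] _ K(1)]) simp
        moreover have "\<bar>frechet_derivative radial_cutoff (at z) h\<bar> * norm (u (Arg z))
            \<le> (K * norm h) * B"
          by (rule mult_mono[OF K(3)[OF z] B(1)]) (simp_all add: K(1))
        ultimately show ?thesis by (rule add_mono)
      qed
      also have "\<dots> = 3 * K * B * norm h" by simp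
      finally show ?thesis .
    qed
    then show "\<exists>Y. (\<forall>k. Ck_on k Y UNIV) \<and> (\<forall>s. Y (cis s) = u s) \<and>
         (\<forall>z\<in>cball 0 1. \<forall>h. norm (frechet_derivative Y (at z) h) \<le> 3 * K * B * norm h)"
      using CkY circ by blast
  qed
qed

section \<open>A bound for the symplectic area\<close>

lemma cnj_cis_tangent: "cnj (cis x) * (r *\<^sub>R (\<i> * cis x)) = r *\<^sub>R \<i>"
proof -
  have "cnj (cis x) * cis x = 1" by (simp add: cis_cnj cis_mult)
  then show ?thesis by (metis (no_types, lifting) mult.commute mult.left_commute mult_scaleR_right
      mult.right_neutral)
qed

lemma abs_wedge_le:
  fixes a b c d :: real
  assumes "\<bar>a\<bar> \<le> N" "\<bar>b\<bar> \<le> N" "\<bar>c\<bar> \<le> N" "\<bar>d\<bar> \<le> N"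
  shows "\<bar>a * b - c * d\<bar> \<le> 2 * N\<^sup>2"
proof -
  have "\<bar>a * b\<bar> \<le> N * N" "\<bar>c * d\<bar> \<le> N * N"
    unfolding abs_mult using assms by (auto intro!: mult_mono order_trans[OF abs_ge_zero assms(1)])
  then show ?thesis unfolding power2_eq_square by linarith
qed

text \<open>
  The universal covering of the cotangent bundle, with position and momentum as complex numbers.
\<close>

definition phase_point :: "complex \<Rightarrow> complex \<Rightarrow> phase" where
  "phase_point q p = ((cis (Re q), cis (Im q)), (Re p, Im p))"

text \<open>
  A smooth loop of period \<open>T\<close> in the universal cover, together with its velocity, of size at most \<open>B\<close>
  after the period is rescaled to \<open>1\<close>.
\<close>

definition bounded_loop :: "real \<Rightarrow> complex \<Rightarrow> real \<Rightarrow> (real \<Rightarrow> complex) \<Rightarrow> (real \<Rightarrow> complex) \<Rightarrow>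
    (real \<Rightarrow> complex) \<Rightarrow> (real \<Rightarrow> complex) \<Rightarrow> bool" where
  "bounded_loop T a B q q' p p' \<longleftrightarrow> T > 0 \<and> (\<forall>k. Ck_on k q UNIV) \<and> (\<forall>k. Ck_on k p UNIV) \<and>
     (\<forall>t. q (t + T) = q t \<and> p (t + T) = p t \<and>
        (q has_vector_derivative q' t) (at t) \<and> (p has_vector_derivative p' t) (at t) \<and>
        norm (q t - a) \<le> B \<and> norm (p t) \<le> B \<and> T * norm (q' t) \<le> B \<and> T * norm (p' t) \<le> B)"

text \<open>
  The lifted loop is contracted to the point \<open>(a, 0)\<close> by \<open>smooth_extension_to_disc\<close>. The area density
  is quadratic in the derivative of the resulting disc, hence the bound \<open>K * B\<^sup>2\<close>.
\<close>

lemma symplectic_area_bound: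
  assumes F: "smooth_on_torus F" and M: "\<And>z. z \<in> torus \<Longrightarrow> \<bar>F z\<bar> \<le> M"
  obtains K where "K \<ge> 0"
    "\<And>T q p q' p' a B. bounded_loop T a B q q' p p' \<Longrightarrow>
     \<exists>A. has_symplectic_area F T (\<lambda>t. phase_point (q t) (p t)) A \<and> \<bar>A\<bar> \<le> K * B\<^sup>2"
proof -
  obtain K0 :: real where K0: "K0 \<ge> 0"
    and ext: "\<And>(u :: real \<Rightarrow> complex \<times> complex) u' B. \<lbrakk>\<And>k. Ck_on k u UNIV; \<And>s. u (s + 2 * pi) = u s;
       \<And>s. (u has_vector_derivative u' s) (at s); \<And>s. norm (u s) \<le> B; \<And>s. norm (u' s) \<le> B\<rbrakk> \<Longrightarrow>
       \<exists>Y. (\<forall>k. Ck_on k Y UNIV) \<and> (\<forall>s. Y (cis s) = u s) \<and>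
         (\<forall>z\<in>cball 0 1. \<forall>h. norm (frechet_derivative Y (at z) h) \<le> K0 * B * norm h)"
    by (rule smooth_extension_to_disc[where 'b = "complex \<times> complex"]) blast
  define m where "m = integral (cball (0::complex) 1) (\<lambda>_. 1::real)"
  have one: "(\<lambda>_. c::real) integrable_on cball (0::complex) 1" for c
    by (rule integrable_on_const) (simp add: lmeasurable_cball)
  have m0: "m \<ge> 0" unfolding m_def by (rule integral_nonneg[OF one]) simp
  have "(1, 1) \<in> torus" by (simp add: torus_def)
  with M have M0: "M \<ge> 0" by (meson abs_ge_zero order_trans)
  \<comment> \<open>Three wedge products, the last one weighted by \<open>F\<close>, each at most twice the square of the
    bound \<open>K0 * (2 * B)\<close> for the derivative of the disc, times the area \<open>m\<close> of the unit disc.\<close>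
  define K where "K = (4 + 2 * M) * (2 * K0)\<^sup>2 * m"
  show thesis
  proof (rule that[of K])
    show "K \<ge> 0" using m0 M0 by (simp add: K_def)
    fix T :: real and q p q' p' :: "real \<Rightarrow> complex" and a :: complex and B :: real
    assume "bounded_loop T a B q q' p p'"
    then have T: "T > 0" and Ckq: "\<And>k. Ck_on k q UNIV" and Ckp: "\<And>k. Ck_on k p UNIV"
      and per: "\<And>t. q (t + T) = q t" "\<And>t. p (t + T) = p t"
      and der: "\<And>t. (q has_vector_derivative q' t) (at t)" "\<And>t. (p has_vector_derivative p' t) (at t)"
      and bd: "\<And>t. norm (q t - a) \<le> B" "\<And>t. norm (p t) \<le> B"
      and bd': "\<And>t. T * norm (q' t) \<le> B" "\<And>t. T * norm (p' t) \<le> B"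
      unfolding bounded_loop_def by blast+
    let ?x = "\<lambda>t. phase_point (q t) (p t)"
    define \<tau> where "\<tau> = T / (2 * pi)"
    have \<tau>: "\<tau> > 0" "\<tau> * (2 * pi) = T" "\<tau> \<le> T"
      using T pi_gt3 by (auto simp: \<tau>_def divide_simps mult_le_cancel_left1)
    define u where "u s = (q (\<tau> * s) - a, p (\<tau> * s))" for s
    define u' where "u' s = \<tau> *\<^sub>R (q' (\<tau> * s), p' (\<tau> * s))" for s
    have sc: "bounded_linear (\<lambda>s. \<tau> * s)" by (rule bounded_linear_mult_right)
    have Cku: "Ck_on k u UNIV" for k
    proof -
      have "Ck_on k (\<lambda>s. q (\<tau> * s) + - a) UNIV" "Ck_on k (\<lambda>s. p (\<tau> * s)) UNIV"
        by (intro Ck_on_add[OF open_UNIV _ Ck_on_const[OF open_UNIV]]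
            Ck_on_compose[OF open_UNIV open_UNIV subset_UNIV Ckq Ck_on_bounded_linear[OF sc open_UNIV]]
            Ck_on_compose[OF open_UNIV open_UNIV subset_UNIV Ckp Ck_on_bounded_linear[OF sc
                open_UNIV]])+
      from Ck_on_Pair[OF open_UNIV this] show ?thesis by (simp add: u_def[abs_def])
    qed
    have peru: "u (s + 2 * pi) = u s" for s
      using per(1)[of "\<tau> * s"] per(2)[of "\<tau> * s"] \<tau>(2) by (simp add: u_def distrib_left)
    have deru: "(u has_vector_derivative u' s) (at s)" for s
    proof -
      have "((\<lambda>s. \<tau> * s) has_vector_derivative \<tau>) (at s)"
        unfolding vector_deriv_iff[symmetric]
            by (auto intro!: derivative_eq_intros)
      from vector_diff_chain_at[OF this der(1)] vector_diff_chain_at[OF this der(2)]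
      have "((\<lambda>s. q (\<tau> * s) - a) has_vector_derivative \<tau> *\<^sub>R q' (\<tau> * s)) (at s)"
        "((\<lambda>s. p (\<tau> * s)) has_vector_derivative \<tau> *\<^sub>R p' (\<tau> * s)) (at s)"
        by (simp_all add: o_def has_vector_derivative_diff_const)
      from has_vector_derivative_Pair[OF this] show ?thesis
        by (simp add: u_def[abs_def] u'_def)
    qed
    have nu: "norm (u s) \<le> 2 * B" for s
      using norm_Pair_le[of "q (\<tau> * s) - a" "p (\<tau> * s)"] bd(1)[of "\<tau> * s"] bd(2)[of "\<tau> * s"]
      unfolding u_def by linarith
    have nu': "norm (u' s) \<le> 2 * B" for s
    proof -
      have "norm (u' s) = \<tau> * norm (q' (\<tau> * s), p' (\<tau> * s))"
        using \<tau>(1) unfolding u'_def norm_scaleR by simp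
      also have "\<dots> \<le> T * (norm (q' (\<tau> * s)) + norm (p' (\<tau> * s)))"
        by (rule mult_mono[OF \<tau>(3) norm_Pair_le]) (use T in auto)
      also have "\<dots> \<le> 2 * B" using bd'(1)[of "\<tau> * s"] bd'(2)[of "\<tau> * s"] by (simp add: distrib_left)
      finally show ?thesis .
    qed
    obtain Y where CkY: "\<And>k. Ck_on k Y UNIV" and Yu: "\<And>s. Y (cis s) = u s"
      and DY: "\<And>z h. z \<in> cball 0 1 \<Longrightarrow> norm (frechet_derivative Y (at z) h) \<le> K0 * (2 * B) * norm h"
      using ext[OF Cku peru deru nu nu'] by blast
    define D where "D z = frechet_derivative Y (at z)" for z
    define v where "v z = ((cis (Re (a + fst (Y z))), cis (Im (a
        + fst (Y z)))), (Re (snd (Y z)), Im (snd (Y z))))" for z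
    have dY: "(Y has_derivative D z) (at z)" for z
      unfolding D_def by (rule Ck_on_Suc_has_derivative[OF CkY[of "Suc 0"]]) simp
    have dv: "(v has_derivative (\<lambda>h. ((Re (fst (D z h)) *\<^sub>R (\<i> * cis (Re (a + fst (Y z)))),
         Im (fst (D z h)) *\<^sub>R (\<i> * cis (Im (a + fst (Y z))))), (Re (snd (D z h)), Im (snd (D z
             h)))))) (at z)" for z
    proof -
      have f: "((\<lambda>z. a + fst (Y z)) has_derivative (\<lambda>h. fst (D z h))) (at z)"
        using has_derivative_add[OF has_derivative_const has_derivative_fst[OF dY], of a z] by simp
      have s: "((\<lambda>z. snd (Y z)) has_derivative (\<lambda>h. snd (D z h))) (at z)"
        by (rule has_derivative_snd[OF dY])
      show ?thesis unfolding v_def[abs_def]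
        by (intro has_derivative_Pair has_derivative_cis has_derivative_Re has_derivative_Im f s)
    qed
    have Dv: "frechet_derivative v (at z) = (\<lambda>h. ((Re (fst (D z h)) *\<^sub>R (\<i> * cis (Re (a + fst (Y z)))),
         Im (fst (D z h)) *\<^sub>R (\<i> * cis (Im (a + fst (Y z))))), (Re (snd (D z h)), Im (snd (D z
             h)))))" for z
      by (rule frechet_derivative_at[OF dv, symmetric])
    have Ckv: "Ck_on k v UNIV" for k
    proof -
      have f: "Ck_on k (\<lambda>z. a + fst (Y z)) UNIV"
        by (rule Ck_on_add[OF open_UNIV Ck_on_const[OF open_UNIV] Ck_on_linear_compose[OF
            bounded_linear_fst open_UNIV CkY]])
      have s: "Ck_on k (\<lambda>z. snd (Y z)) UNIV"
        by (rule Ck_on_linear_compose[OF bounded_linear_snd open_UNIV CkY])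
      note c = Ck_on_compose[OF open_UNIV open_UNIV subset_UNIV Ck_on_cis]
      show ?thesis unfolding v_def[abs_def]
        by (intro Ck_on_Pair[OF open_UNIV] c Ck_on_linear_compose[OF bounded_linear_Re open_UNIV f]
            Ck_on_linear_compose[OF bounded_linear_Im open_UNIV f]
            Ck_on_linear_compose[OF bounded_linear_Re open_UNIV s]
            Ck_on_linear_compose[OF bounded_linear_Im open_UNIV s])
    qed
    have cap: "smooth_capping_disc T ?x v"
    proof -
      have "v (cis (2 * pi * s)) = ?x (T * s)" for s
        using \<tau>(2) Yu[of "2 * pi * s"] by (simp add: v_def u_def phase_point_def mult.assoc[symmetric])
      moreover have "v ` cball 0 1 \<subseteq> cotangent_torus"
        by (auto simp: v_def cotangent_torus_def torus_def)
      ultimately show ?thesis unfolding smooth_capping_disc_def smooth_on_def using Ckv by blast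
    qed
    define N where "N = K0 * (2 * B)"
    have DN: "norm (D z h) \<le> N" if "z \<in> cball 0 1" "norm h = 1" for z h
      using DY[OF that(1), of h] that(2) by (simp add: D_def N_def)
    have comp: "\<bar>Re (fst (D z h))\<bar> \<le> N" "\<bar>Im (fst (D z h))\<bar> \<le> N" "\<bar>Re (snd (D z h))\<bar>
        \<le> N" "\<bar>Im (snd (D z h))\<bar> \<le> N"
      if "z \<in> cball 0 1" "norm h = 1" for z h
    proof -
      have "norm (fst (D z h)) \<le> N" "norm (snd (D z h)) \<le> N"
        using norm_fst_le[of "fst (D z h)" "snd (D z h)"] norm_snd_le[of "snd (D z h)" "fst (D z
            h)"] DN[OF that]
        by (simp_all only: prod.collapse order_trans)
      then show "\<bar>Re (fst (D z h))\<bar> \<le> N" "\<bar>Im (fst (D z h))\<bar> \<le> N" "\<bar>Re (snd (D z h))\<bar>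
          \<le> N" "\<bar>Im (snd (D z h))\<bar> \<le> N"
        using abs_Re_le_cmod abs_Im_le_cmod order_trans by blast+
    qed
    let ?\<omega> = "\<lambda>z. twisted_form F (v z) (frechet_derivative v (at z) 1) (frechet_derivative v (at z) \<i>)"
    have \<omega>: "norm (?\<omega> z) \<le> (4 + 2 * M) * N\<^sup>2" if z: "z \<in> cball 0 1" for z
    proof -
      define Fv where "Fv = F (fst (v z))"
      have "fst (v z) \<in> torus" by (simp add: v_def torus_def)
      then have Fv: "\<bar>Fv\<bar> \<le> M" unfolding Fv_def by (rule M)
      have "?\<omega> z = (Re (snd (D z 1)) * Re (fst (D z \<i>)) - Re (snd (D z \<i>)) * Re (fst (D z 1)))
        + (Im (snd (D z 1)) * Im (fst (D z \<i>)) - Im (snd (D z \<i>)) * Im (fst (D z 1)))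
        + Fv * (Re (fst (D z 1)) * Im (fst (D z \<i>)) - Re (fst (D z \<i>)) * Im (fst (D z 1)))"
        unfolding twisted_form_def canonical_form_def magnetic_form_def wedge_def dq1_def dq2_def
            dp1_def dp2_def Dv Fv_def
        by (simp only: v_def fst_conv snd_conv cnj_cis_tangent) simp
      moreover have "\<bar>Re (snd (D z 1)) * Re (fst (D z \<i>)) - Re (snd (D z \<i>)) * Re (fst (D z 1))\<bar>
          \<le> 2 * N\<^sup>2"
        "\<bar>Im (snd (D z 1)) * Im (fst (D z \<i>)) - Im (snd (D z \<i>)) * Im (fst (D z 1))\<bar> \<le> 2 * N\<^sup>2"
        "\<bar>Re (fst (D z 1)) * Im (fst (D z \<i>)) - Re (fst (D z \<i>)) * Im (fst (D z 1))\<bar> \<le> 2 * N\<^sup>2"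
        by (intro abs_wedge_le comp[OF z] norm_one norm_ii)+
      moreover from this(3) have "\<bar>Fv * (Re (fst (D z 1)) * Im (fst (D z \<i>))
          - Re (fst (D z \<i>)) * Im (fst (D z 1)))\<bar> \<le> M * (2 * N\<^sup>2)"
        unfolding abs_mult[of Fv] using Fv M0 by (intro mult_mono) auto
      ultimately show ?thesis by (simp add: algebra_simps)
    qed
    have area: "\<bar>disc_area F v\<bar> \<le> (4 + 2 * M) * N\<^sup>2 * m"
    proof (cases "?\<omega> integrable_on cball 0 1")
      case True
      from integral_norm_bound_integral[OF True one \<omega>]
      have "\<bar>disc_area F v\<bar> \<le> integral (cball (0::complex) 1) (\<lambda>_. (4 + 2 * M) * N\<^sup>2 * 1)"
        by (simp add: disc_area_def)
      also have "\<dots> = (4 + 2 * M) * N\<^sup>2 * m" unfolding m_def by (rule integral_mult_right)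
      finally show ?thesis .
    next
      case False
      then show ?thesis using M0 m0 by (simp add: disc_area_def not_integrable_integral)
    qed
    have "has_symplectic_area F T ?x (disc_area F v)"
      unfolding has_symplectic_area_def using cap disc_area_unique[OF F _ cap] by blast
    moreover have "(4 + 2 * M) * N\<^sup>2 * m = K * B\<^sup>2" by (simp add: K_def N_def power_mult_distrib)
    ultimately show "\<exists>A. has_symplectic_area F T ?x A \<and> \<bar>A\<bar> \<le> K * B\<^sup>2"
      using area by auto
  qed
qed

section \<open>Closed curves parametrised by their direction\<close>

lemma primitive_0: "primitive g 0 = 0" by (simp add: primitive_def)

lemma zero_derivative_constant:
  fixes f :: "real \<Rightarrow> 'b::real_normed_vector"
  assumes "\<And>x. (f has_vector_derivative 0) (at x)" shows "f x = f y"
proof -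
  have "f constant_on UNIV"
    by (rule has_derivative_zero_constant[OF convex_UNIV, of f, unfolded constant_on_def[symmetric]])
      (use assms in \<open>simp add: has_vector_derivative_def\<close>)
  then show ?thesis by (auto simp: constant_on_def)
qed

lemma eq_primitive:
  assumes "continuous_on UNIV g" "\<And>x. (f has_vector_derivative g x) (at x)"
  shows "f x = f 0 + primitive g x"
proof -
  have "((\<lambda>x. f x - primitive g x) has_vector_derivative 0) (at x)" for x
    using has_vector_derivative_diff[OF assms(2) primitive_has_vector_derivative[OF assms(1)], of x]
        by simp
  from zero_derivative_constant[of "\<lambda>x. f x - primitive g x", OF this, of x 0]
  show ?thesis by (simp add: primitive_0 algebra_simps)
qed

lemma primitive_periodic:
  assumes g: "continuous_on UNIV g" and per: "\<And>x. g (x + p) = g x" and p: "p \<ge> 0" and int: "integral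
      {0..p} g = 0"
  shows "primitive g (x + p) = primitive g x"
proof -
  have "((\<lambda>x. primitive g (x + p)) has_vector_derivative g x) (at x)" for x
  proof -
    have "((\<lambda>x. x + p) has_vector_derivative 1) (at x)"
      unfolding vector_deriv_iff[symmetric]
          by (auto intro!: derivative_eq_intros)
    from vector_diff_chain_at[OF this primitive_has_vector_derivative[OF g]]
    show ?thesis by (simp add: o_def per)
  qed
  from eq_primitive[OF g this] have "primitive g (x + p) = primitive g p + primitive g x" by simp
  moreover have "(g has_integral (primitive g p - primitive g 0)) {0..p}"
    by (rule fundamental_theorem_of_calculus[OF p])
      (rule has_vector_derivative_at_within[OF primitive_has_vector_derivative[OF g]])
  ultimately show ?thesis using int by (simp add: primitive_0 integral_unique)
qed

lemma primitive_diff_bound: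
  fixes g h :: "real \<Rightarrow> 'b::banach"
  assumes "continuous_on UNIV g" "continuous_on UNIV h" "\<And>x. norm (g x - h x) \<le> B"
  shows "norm (primitive g x - primitive h x) \<le> B * \<bar>x\<bar>"
proof -
  have c: "continuous_on {0..1} (\<lambda>s. g (s * x))" "continuous_on {0..1} (\<lambda>s. h (s * x))"
    by (auto intro!: continuous_intros continuous_on_compose2[OF assms(1)] continuous_on_compose2[OF
        assms(2)])
  have "primitive g x - primitive h x = x *\<^sub>R integral {0..1} (\<lambda>s. g (s * x) - h (s * x))"
    unfolding primitive_def by (simp add: integral_diff integrable_continuous_real c scaleR_diff_right)
  moreover have "norm (integral {0..1} (\<lambda>s. g (s * x) - h (s * x))) \<le> B * (1 - 0)"
    by (rule integral_bound) (use c assms(3) in \<open>auto intro!: continuous_intros\<close>)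
  then have "\<bar>x\<bar> * norm (integral {0..1} (\<lambda>s. g (s * x) - h (s * x))) \<le> \<bar>x\<bar> * B"
    by (intro mult_left_mono) auto
  ultimately show ?thesis by (simp add: mult.commute)
qed

lemma periodic_representative:
  fixes u :: "real \<Rightarrow> 'b"
  assumes "\<And>s. u (s + 2 * pi) = u s"
  obtains r where "r \<in> {0..2 * pi}" "u r = u s"
proof (rule that)
  show "Arg2pi (cis s) \<in> {0..2 * pi}" using Arg2pi[of "cis s"] by auto
  have "is_Arg (cis s) (Arg2pi (cis s))" using Arg2pi[of "cis s"] by blast
  then have "cis s = cis (Arg2pi (cis s))" by (simp add: is_Arg_def cis_conv_exp[symmetric])
  then have "cis (Arg2pi (cis s)) = cis s" by (rule sym)
  then show "u (Arg2pi (cis s)) = u s" by (rule periodic_eq_of_cis_eq[where u = u, OF assms])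
qed

text \<open>
  In the application, \<open>f\<close> is the lift of \<open>F\<close> to the plane.
\<close>

locale field_bounds =
  fixes f :: "complex \<Rightarrow> real" and m M L :: real
  assumes m: "m > 0" and f_lower: "\<And>z. m \<le> f z" and f_upper: "\<And>z. f z \<le> M"
    and L: "L \<ge> 0" and f_lip: "\<And>z w. \<bar>f z - f w\<bar> \<le> L * norm (z - w)"
begin

lemma M_pos: "M > 0" using m f_lower[of 0] f_upper[of 0] by linarith

lemma f_pos: "f z > 0" using m f_lower[of z] by linarith

lemma f_cont: "continuous_on S f"
proof -
  have "L-lipschitz_on S f" by (rule lipschitz_onI) (use f_lip L in \<open>auto simp: dist_norm\<close>)
  then show ?thesis by (rule lipschitz_on_continuous_on)
qed

lemma f_comp_cont: "continuous_on S q \<Longrightarrow> continuous_on S (\<lambda>\<theta>. f (q \<theta>))"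
  by (rule continuous_on_compose2[OF f_cont[of UNIV]]) auto

text \<open>
  A closed curve with \<open>f(q) q' = c - \<epsilon> cis \<theta>\<close> satisfies
  \<open>c * mass q = \<epsilon> * moment q\<close>; this determines the constant \<open>c\<close>, called \<open>drift\<close>.
\<close>

definition mass :: "(real \<Rightarrow> complex) \<Rightarrow> real" where
  "mass q = integral {0..2 * pi} (\<lambda>\<theta>. 1 / f (q \<theta>))"

definition moment :: "(real \<Rightarrow> complex) \<Rightarrow> complex" where
  "moment q = integral {0..2 * pi} (\<lambda>\<theta>. (1 / f (q \<theta>)) *\<^sub>R cis \<theta>)"

definition drift :: "real \<Rightarrow> (real \<Rightarrow> complex) \<Rightarrow> complex" where
  "drift \<epsilon> q = (\<epsilon> / mass q) *\<^sub>R moment q"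

definition velocity :: "real \<Rightarrow> (real \<Rightarrow> complex) \<Rightarrow> real \<Rightarrow> complex" where
  "velocity \<epsilon> q \<theta> = (1 / f (q \<theta>)) *\<^sub>R (drift \<epsilon> q - \<epsilon> *\<^sub>R cis \<theta>)"

lemma recip_cont: "continuous_on S q \<Longrightarrow> continuous_on S (\<lambda>\<theta>. 1 / f (q \<theta>))"
  by (intro continuous_intros f_comp_cont) (simp_all add: less_imp_neq[OF f_pos, symmetric])

lemma cis_recip_cont: "continuous_on S q \<Longrightarrow> continuous_on S (\<lambda>\<theta>. (1 / f (q \<theta>)) *\<^sub>R cis \<theta>)"
  by (intro continuous_on_scaleR recip_cont continuous_intros)

lemma velocity_cont: "continuous_on S q \<Longrightarrow> continuous_on S (velocity \<epsilon> q)"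
  unfolding velocity_def[abs_def] by (intro continuous_on_scaleR recip_cont continuous_intros)

lemma recip_bounds: "1 / M \<le> 1 / f z" "1 / f z \<le> 1 / m" "0 < 1 / f z"
  using f_lower[of z] f_upper[of z] f_pos[of z] m by (auto intro!: divide_left_mono)

lemma recip_difference_le: "\<bar>1 / f z - 1 / f w\<bar> \<le> L / m\<^sup>2 * norm (z - w)"
proof -
  have "\<bar>1 / f z - 1 / f w\<bar> = \<bar>f z - f w\<bar> / (f z * f w)"
    using f_pos[of z] f_pos[of w] by (simp add: field_simps abs_minus_commute abs_mult)
  also have "\<dots> \<le> (L * norm (z - w)) / (m * m)"
    using f_lower[of z] f_lower[of w] f_lip[of z w] m f_pos[of z]
        by (intro frac_le mult_mono mult_pos_pos) auto
  finally show ?thesis by (simp add: power2_eq_square)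
qed

lemma mass_lower: "continuous_on {0..2 * pi} q \<Longrightarrow> 2 * pi / M \<le> mass q"
proof -
  assume q: "continuous_on {0..2 * pi} q"
  have "integral {0..2 * pi} (\<lambda>_::real. 1 / M) \<le> mass q" unfolding mass_def
    by (intro integral_le integrable_continuous_real recip_cont q continuous_intros recip_bounds)
  then show ?thesis by simp
qed

lemma mass_pos: "continuous_on {0..2 * pi} q \<Longrightarrow> mass q > 0"
  using mass_lower[of q] M_pos by (meson divide_pos_pos less_le_trans pi_gt_zero mult_pos_pos
      zero_less_numeral)

lemma moment_le_mass: "continuous_on {0..2 * pi} q \<Longrightarrow> norm (moment q) \<le> mass q"
  unfolding moment_def mass_def
  by (rule integral_norm_bound_integral)
    (use recip_bounds(3) in \<open>auto intro!: integrable_continuous_real recip_cont cis_recip_cont simp: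
        less_imp_le\<close>)

lemma drift_le: 
  assumes "continuous_on {0..2 * pi} q" "\<epsilon> \<ge> 0" shows "norm (drift \<epsilon> q) \<le> \<epsilon>"
proof -
  have "norm (drift \<epsilon> q) = \<epsilon> * (norm (moment q) / mass q)"
    using mass_pos[OF assms(1)] assms(2) by (simp add: drift_def)
  also have "\<dots> \<le> \<epsilon> * 1"
    using moment_le_mass[OF assms(1)] mass_pos[OF assms(1)] assms(2) by (intro mult_left_mono) auto
  finally show ?thesis by simp
qed

lemma velocity_le:
  assumes "continuous_on {0..2 * pi} q" "\<epsilon> \<ge> 0" shows "norm (velocity \<epsilon> q \<theta>) \<le> 2 * \<epsilon> / m"
proof -
  have "norm (drift \<epsilon> q - \<epsilon> *\<^sub>R cis \<theta>) \<le> \<epsilon> + \<epsilon>"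
    using norm_triangle_ineq4[of "drift \<epsilon> q" "\<epsilon> *\<^sub>R cis \<theta>"] drift_le[OF assms] assms(2) by simp
  then have "(1 / f (q \<theta>)) * norm (drift \<epsilon> q - \<epsilon> *\<^sub>R cis \<theta>) \<le> (1 / m) * (\<epsilon> + \<epsilon>)"
    using recip_bounds[of "q \<theta>"] m by (intro mult_mono) auto
  then show ?thesis using recip_bounds(3)[of "q \<theta>"] by (simp add: velocity_def)
qed

text \<open>
  The difference of two quotients \<open>moment / mass\<close> is a multiple of \<open>Z\<close> below. Because the quotients
  themselves have norm at most \<open>1\<close>, both terms of \<open>Z\<close> are bounded by \<open>2\<pi>\<delta>\<close>.
\<close>

lemma drift_difference_le:
  assumes q: "continuous_on {0..2 * pi} q" and r: "continuous_on {0..2 * pi} r" and \<epsilon>: "\<epsilon> \<ge> 0"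
    and d: "\<And>\<theta>. norm (q \<theta> - r \<theta>) \<le> d"
  shows "norm (drift \<epsilon> q - drift \<epsilon> r) \<le> \<epsilon> * (2 * M * (L / m\<^sup>2)) * d"
proof -
  define \<delta> where "\<delta> = L / m\<^sup>2 * d"
  have \<delta>: "\<bar>1 / f (q \<theta>) - 1 / f (r \<theta>)\<bar> \<le> \<delta>" for \<theta>
  proof -
    have "L / m\<^sup>2 * norm (q \<theta> - r \<theta>) \<le> \<delta>" unfolding \<delta>_def using L by (intro mult_left_mono d) auto
    then show ?thesis using recip_difference_le[of "q \<theta>" "r \<theta>"] by linarith
  qed
  have n: "norm (moment q - moment r) \<le> \<delta> * (2 * pi - 0)"
  proof -
    have "moment q - moment r = integral {0..2 * pi} (\<lambda>\<theta>. (1 / f (q \<theta>)) *\<^sub>R cis \<theta>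
        - (1 / f (r \<theta>)) *\<^sub>R cis \<theta>)"
      unfolding moment_def by (intro integral_diff[symmetric] integrable_continuous_real
          cis_recip_cont q r)
    also have "norm \<dots> \<le> \<delta> * (2 * pi - 0)"
    proof (rule integral_bound)
      show "continuous_on {0..2 * pi} (\<lambda>\<theta>. (1 / f (q \<theta>)) *\<^sub>R cis \<theta> - (1 / f (r \<theta>)) *\<^sub>R cis \<theta>)"
        by (intro continuous_on_diff cis_recip_cont q r)
      show "norm ((1 / f (q \<theta>)) *\<^sub>R cis \<theta> - (1 / f (r \<theta>)) *\<^sub>R cis \<theta>) \<le> \<delta>" for \<theta>
        using \<delta>[of \<theta>] unfolding scaleR_diff_left[symmetric] norm_scaleR by simp
    qed simp
    finally show ?thesis .
  qed
  have k: "norm (mass q - mass r) \<le> \<delta> * (2 * pi - 0)"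
  proof -
    have "mass q - mass r = integral {0..2 * pi} (\<lambda>\<theta>. 1 / f (q \<theta>) - 1 / f (r \<theta>))"
      unfolding mass_def by (intro integral_diff[symmetric] integrable_continuous_real recip_cont q r)
    also have "norm \<dots> \<le> \<delta> * (2 * pi - 0)"
      by (rule integral_bound) (use \<delta> in \<open>auto intro!: continuous_on_diff recip_cont q r\<close>)
    finally show ?thesis .
  qed
  have Mq: "mass q > 0" and Mr: "mass r > 0" using mass_pos q r by auto
  define Z where "Z = (moment q - moment r) - ((mass q - mass r) / mass r) *\<^sub>R moment r"
  have eq: "drift \<epsilon> q - drift \<epsilon> r = (\<epsilon> / mass q) *\<^sub>R Z"
    using Mq Mr unfolding drift_def Z_def
    by (simp add: scaleR_diff_right diff_divide_distrib) (simp add: scaleR_diff_left[symmetric]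
        field_simps)
  have "norm Z \<le> norm (moment q - moment r) + \<bar>mass q - mass r\<bar> * (norm (moment r) / mass r)"
    unfolding Z_def using norm_triangle_ineq4[of "moment q - moment r" "((mass q
        - mass r) / mass r) *\<^sub>R moment r"] Mr
    by (simp add: abs_mult)
  also have "\<dots> \<le> norm (moment q - moment r) + \<bar>mass q - mass r\<bar> * 1"
    using moment_le_mass[OF r] Mr by (intro add_left_mono mult_left_mono) auto
  also have "\<dots> \<le> 4 * pi * \<delta>" using n k by (simp add: algebra_simps)
  finally have Z: "norm Z \<le> 4 * pi * \<delta>" .
  have "norm (drift \<epsilon> q - drift \<epsilon> r) = (\<epsilon> / mass q) * norm Z" using eq \<epsilon> Mq by simp
  also have "\<dots> \<le> (\<epsilon> / (2 * pi / M)) * (4 * pi * \<delta>)"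
    using mass_lower[OF q] Mq M_pos Z \<epsilon> by (intro mult_mono divide_left_mono) auto
  also have "\<dots> = \<epsilon> * (2 * M * (L / m\<^sup>2)) * d" by (simp add: \<delta>_def)
  finally show ?thesis .
qed

text \<open>
  The Lipschitz constant of \<open>q \<mapsto> velocity \<epsilon> q\<close> in the supremum norm is at most \<open>\<epsilon>\<close> times this
  number, so that small \<open>\<epsilon>\<close> gives a contraction.
\<close>

definition velocity_lipschitz :: real where
  "velocity_lipschitz = 2 * (L / m\<^sup>2) * (1 + M / m)"

lemma velocity_lipschitz_nonneg: "velocity_lipschitz \<ge> 0"
  unfolding velocity_lipschitz_def using L m M_pos by (intro mult_nonneg_nonneg add_nonneg_nonneg
      divide_nonneg_pos) auto

lemma velocity_difference_le:
  assumes q: "continuous_on {0..2 * pi} q" and r: "continuous_on {0..2 * pi} r" and \<epsilon>: "\<epsilon> \<ge> 0"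
    and d: "\<And>\<theta>. norm (q \<theta> - r \<theta>) \<le> d"
  shows "norm (velocity \<epsilon> q \<theta> - velocity \<epsilon> r \<theta>) \<le> \<epsilon> * velocity_lipschitz * d"
proof -
  have d0: "d \<ge> 0" using d[of 0] norm_ge_zero order_trans by blast
  have "velocity \<epsilon> q \<theta> - velocity \<epsilon> r \<theta> = (1 / f (q \<theta>) - 1 / f (r \<theta>)) *\<^sub>R (drift \<epsilon> q - \<epsilon> *\<^sub>R cis \<theta>)
     + (1 / f (r \<theta>)) *\<^sub>R (drift \<epsilon> q - drift \<epsilon> r)"
    unfolding velocity_def by (simp add: scaleR_diff_left scaleR_diff_right left_diff_distrib)
  also have "norm \<dots> \<le> \<bar>1 / f (q \<theta>) - 1 / f (r \<theta>)\<bar> * norm (drift \<epsilon> q - \<epsilon> *\<^sub>R cis \<theta>)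
     + (1 / f (r \<theta>)) * norm (drift \<epsilon> q - drift \<epsilon> r)"
    using recip_bounds(3)[of "r \<theta>"] by (intro order_trans[OF norm_triangle_ineq]) simp
  also have "\<dots> \<le> (L / m\<^sup>2 * d) * (2 * \<epsilon>) + (1 / m) * (\<epsilon> * (2 * M * (L / m\<^sup>2)) * d)"
  proof (rule add_mono)
    show "\<bar>1 / f (q \<theta>) - 1 / f (r \<theta>)\<bar> * norm (drift \<epsilon> q - \<epsilon> *\<^sub>R cis \<theta>) \<le> (L / m\<^sup>2 * d) * (2 * \<epsilon>)"
    proof (rule mult_mono)
      have "L / m\<^sup>2 * norm (q \<theta> - r \<theta>) \<le> L / m\<^sup>2 * d" using L by (intro mult_left_mono d) auto
      then show "\<bar>1 / f (q \<theta>) - 1 / f (r \<theta>)\<bar> \<le> L / m\<^sup>2 * d" using recip_difference_le[of "q \<theta>" "r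
          \<theta>"] by linarith
      show "norm (drift \<epsilon> q - \<epsilon> *\<^sub>R cis \<theta>) \<le> 2 * \<epsilon>"
        using norm_triangle_ineq4[of "drift \<epsilon> q" "\<epsilon> *\<^sub>R cis \<theta>"] drift_le[OF q \<epsilon>] \<epsilon> by simp
    qed (use L d0 in auto)
    show "(1 / f (r \<theta>)) * norm (drift \<epsilon> q - drift \<epsilon> r) \<le> (1 / m) * (\<epsilon> * (2 * M * (L / m\<^sup>2)) * d)"
      using recip_bounds[of "r \<theta>"] m by (intro mult_mono drift_difference_le[OF q r \<epsilon> d]) auto
  qed
  also have "\<dots> = \<epsilon> * velocity_lipschitz * d" using m unfolding velocity_lipschitz_def
      by (simp add: field_simps)
  finally show ?thesis .
qed

lemma velocity_integral: 
  assumes q: "continuous_on {0..2 * pi} q" shows "integral {0..2 * pi} (velocity \<epsilon> q) = 0"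
proof -
  have "integral {0..2 * pi} (velocity \<epsilon> q)
      = integral {0..2 * pi} (\<lambda>\<theta>. (1 / f (q \<theta>)) *\<^sub>R drift \<epsilon> q - \<epsilon> *\<^sub>R ((1 / f (q \<theta>)) *\<^sub>R cis \<theta>))"
    unfolding velocity_def[abs_def] by (simp add: scaleR_diff_right mult.commute)
  also have "\<dots> = integral {0..2 * pi} (\<lambda>\<theta>. (1 / f (q \<theta>)) *\<^sub>R drift \<epsilon> q)
      - integral {0..2 * pi} (\<lambda>\<theta>. \<epsilon> *\<^sub>R ((1 / f (q \<theta>)) *\<^sub>R cis \<theta>))"
    by (intro integral_diff integrable_continuous_real continuous_on_scaleR continuous_on_const
        recip_cont cis_recip_cont q)
  also have "integral {0..2 * pi} (\<lambda>\<theta>. (1 / f (q \<theta>)) *\<^sub>R drift \<epsilon> q) = mass q *\<^sub>R drift \<epsilon> q"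
  proof -
    have "(\<lambda>\<theta>. 1 / f (q \<theta>)) integrable_on {0..2 * pi}"
      by (intro integrable_continuous_real recip_cont q)
    then have "((\<lambda>\<theta>. (1 / f (q \<theta>)) *\<^sub>R drift \<epsilon> q) has_integral mass q *\<^sub>R drift \<epsilon> q) {0..2 * pi}"
      unfolding mass_def by (intro has_integral_scaleR_left integrable_integral)
    then show ?thesis by (rule integral_unique)
  qed
  also have "integral {0..2 * pi} (\<lambda>\<theta>. \<epsilon> *\<^sub>R ((1 / f (q \<theta>)) *\<^sub>R cis \<theta>)) = \<epsilon> *\<^sub>R moment q"
    unfolding moment_def by (rule integral_cmul)
  also have "mass q *\<^sub>R drift \<epsilon> q = \<epsilon> *\<^sub>R moment q"
    using mass_pos[OF q] by (simp add: drift_def)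
  finally show ?thesis by simp
qed

text \<open>
  The closed curves with \<open>f(q) q' = c - \<epsilon> cis \<theta>\<close> for some constant \<open>c\<close>. Those with \<open>c = 0\<close> are
  projections of periodic orbits, parametrised by the direction of the momentum.
\<close>

definition solution :: "real \<Rightarrow> (real \<Rightarrow> complex) \<Rightarrow> bool" where
  "solution \<epsilon> q \<longleftrightarrow> (\<forall>\<theta>. q (\<theta> + 2 * pi) = q \<theta>) \<and> (\<forall>\<theta>. (q has_vector_derivative velocity \<epsilon> q \<theta>) (at \<theta>))"

lemma solution_cont: "solution \<epsilon> q \<Longrightarrow> continuous_on S q"
  unfolding solution_def by (meson continuous_at_imp_continuous_on has_vector_derivative_continuous)

lemma velocity_periodic:
  "(\<And>\<theta>. q (\<theta> + 2 * pi) = q \<theta>) \<Longrightarrow> velocity \<epsilon> q (\<theta> + 2 * pi) = velocity \<epsilon> q \<theta>"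
  by (simp add: velocity_def cis_mult[symmetric])

text \<open>
  Banach's fixed point theorem for \<open>q \<mapsto> a + \<integral> velocity \<epsilon> q\<close> on the \<open>2\<pi>\<close>-periodic bounded continuous
  functions. The choice of the drift keeps the image periodic, and periodicity
  reduces the estimate to one period, where the integral gains at most the factor \<open>2\<pi>\<close>.
\<close>

lemma solution_exists:
  assumes \<epsilon>: "\<epsilon> \<ge> 0" "2 * pi * (\<epsilon> * velocity_lipschitz) \<le> 1 / 3"
  shows "\<exists>q. solution \<epsilon> q \<and> q 0 = a"
proof -
  define S where "S = {w :: real \<Rightarrow>\<^sub>C complex. \<forall>\<theta>. apply_bcontfun w (\<theta> + 2 * pi) = apply_bcontfun w \<theta>}"
  let ?V = "\<lambda>w. velocity \<epsilon> (apply_bcontfun w)"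
  define g where "g w \<theta> = a + primitive (?V w) \<theta>" for w \<theta>
  define T where "T w = Bcontfun (g w)" for w
  have vc: "continuous_on X (?V w)" for w X
    by (rule velocity_cont) auto
  have dg: "(g w has_vector_derivative ?V w \<theta>) (at \<theta>)" for w \<theta>
    using has_vector_derivative_add[OF has_vector_derivative_const
        primitive_has_vector_derivative[OF vc]]
    by (simp add: g_def[abs_def])
  have cg: "continuous_on X (g w)" for w X
    using dg by (meson continuous_at_imp_continuous_on has_vector_derivative_continuous)
  have pg: "g w (\<theta> + 2 * pi) = g w \<theta>" if "w \<in> S" for w \<theta>
  proof -
    have "primitive (?V w) (\<theta> + 2 * pi) = primitive (?V w) \<theta>"
    proof (rule primitive_periodic[OF vc])
      show "?V w (x + 2 * pi) = ?V w x" for x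
        by (rule velocity_periodic) (use that in \<open>simp add: S_def\<close>)
      show "integral {0..2 * pi} (?V w) = 0"
        by (rule velocity_integral) auto
    qed simp
    then show ?thesis by (simp add: g_def)
  qed
  have app: "apply_bcontfun (T w) = g w" if wS: "w \<in> S" for w
  proof -
    have "bounded (g w ` {0..2 * pi})"
      by (intro compact_imp_bounded compact_continuous_image cg) auto
    then obtain B where B: "\<And>\<theta>. \<theta> \<in> {0..2 * pi} \<Longrightarrow> norm (g w \<theta>) \<le> B"
      unfolding bounded_iff by blast
    have "norm (g w \<theta>) \<le> B" for \<theta>
    proof -
      obtain r where "r \<in> {0..2 * pi}" "g w r = g w \<theta>"
        by (rule periodic_representative[where u = "g w", OF pg[OF wS]])
      then show ?thesis using B by metis
    qed
    then have "g w \<in> bcontfun" by (intro bcontfun_normI cg)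
    then show ?thesis unfolding T_def by (rule Bcontfun_inverse)
  qed
  have "complete S"
  proof -
    have "S = (\<Inter>\<theta>. {w. apply_bcontfun w (\<theta> + 2 * pi) = apply_bcontfun w \<theta>})" by (auto simp: S_def)
    moreover have "closed {w :: real \<Rightarrow>\<^sub>C complex. apply_bcontfun w (\<theta> + 2 * pi)
        = apply_bcontfun w \<theta>}" for \<theta>
    proof (rule closed_Collect_eq)
      have "continuous_on UNIV (\<lambda>w :: real \<Rightarrow>\<^sub>C complex. apply_bcontfun w x)" for x
      proof -
        have "1-lipschitz_on UNIV (\<lambda>w :: real \<Rightarrow>\<^sub>C complex. apply_bcontfun w x)"
          by (rule lipschitz_onI) (auto simp: dist_bounded)
        then show ?thesis by (rule lipschitz_on_continuous_on)
      qed
      then show "continuous_on UNIV (\<lambda>w :: real \<Rightarrow>\<^sub>C complex. apply_bcontfun w (\<theta> + 2 * pi))"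
        "continuous_on UNIV (\<lambda>w :: real \<Rightarrow>\<^sub>C complex. apply_bcontfun w \<theta>)" by blast+
    qed
    ultimately have "closed S" by auto
    then show ?thesis by (simp add: complete_eq_closed)
  qed
  moreover have "S \<noteq> {}"
  proof -
    have "const_bcontfun 0 \<in> S" by (simp add: S_def const_bcontfun.rep_eq)
    then show ?thesis by blast
  qed
  moreover have "T ` S \<subseteq> S" using app pg by (auto simp: S_def)
  moreover have "dist (T v) (T w) \<le> 1 / 3 * dist v w" if "v \<in> S" "w \<in> S" for v w
  proof (rule dist_bound)
    fix \<theta>
    have per: "g v (\<theta> + 2 * pi) - g w (\<theta> + 2 * pi) = g v \<theta> - g w \<theta>" for \<theta> using pg that by simp
    obtain r where r: "r \<in> {0..2 * pi}" "g v r - g w r = g v \<theta> - g w \<theta>"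
      by (rule periodic_representative[where u = "\<lambda>\<theta>. g v \<theta> - g w \<theta>", OF per])
    have "norm (g v r - g w r) \<le> (\<epsilon> * velocity_lipschitz * dist v w) * \<bar>r\<bar>"
      unfolding g_def add_diff_cancel_left
    proof (rule primitive_diff_bound[OF vc vc])
      show "norm (?V v x - ?V w x) \<le> \<epsilon> * velocity_lipschitz * dist v w" for x
        by (rule velocity_difference_le[OF _ _ \<epsilon>(1)]) (auto simp: dist_norm[symmetric] dist_bounded)
    qed
    also have "\<dots> \<le> (\<epsilon> * velocity_lipschitz * dist v w) * (2 * pi)"
      using r(1) \<epsilon>(1) velocity_lipschitz_nonneg by (intro mult_left_mono) auto
    also have "\<dots> = (2 * pi * (\<epsilon> * velocity_lipschitz)) * dist v w" by simp
    also have "\<dots> \<le> 1 / 3 * dist v w" by (intro mult_right_mono \<epsilon>(2)) auto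
    finally show "dist (apply_bcontfun (T v) \<theta>) (apply_bcontfun (T w) \<theta>) \<le> 1 / 3 * dist v w"
      using r(2) app that by (simp add: dist_norm)
  qed
  ultimately have "\<exists>!w. w \<in> S \<and> T w = w"
    by (intro Banach_fix[of S "1 / 3" T]) auto
  then obtain w where w: "w \<in> S" "T w = w" by blast
  then have eq: "apply_bcontfun w = g w" using app by metis
  have "solution \<epsilon> (apply_bcontfun w)"
    unfolding solution_def using dg[of w, folded eq] w(1) by (simp add: S_def)
  moreover have "apply_bcontfun w 0 = a" unfolding eq by (simp add: g_def primitive_0)
  ultimately show ?thesis by blast
qed

text \<open>
  If \<open>d\<close> is the largest distance of the two curves, then integrating the difference of their
  velocities gives \<open>d \<le> d/3 + \<delta>\<close>. In particular a solution is determined by its starting point.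
\<close>

lemma solution_difference_le:
  assumes \<epsilon>: "\<epsilon> \<ge> 0" "2 * pi * (\<epsilon> * velocity_lipschitz) \<le> 1 / 3"
    and q: "solution \<epsilon> q" and r: "solution \<epsilon> r"
  defines "\<delta> \<equiv> norm (q 0 - r 0)"
  shows "norm (q \<theta> - r \<theta>) \<le> 3 / 2 * \<delta>" "norm ((q \<theta> - r \<theta>) - (q 0 - r 0)) \<le> 1 / 2 * \<delta>"
    "norm (velocity \<epsilon> q \<theta> - velocity \<epsilon> r \<theta>) \<le> \<delta>"
proof -
  have cq: "continuous_on S q" and cr: "continuous_on S r" for S using solution_cont q r by auto
  have per: "q (\<theta> + 2 * pi) - r (\<theta> + 2 * pi) = q \<theta> - r \<theta>" for \<theta>
    using q r by (simp add: solution_def)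
  have "continuous_on {0..2 * pi} (\<lambda>\<theta>. norm (q \<theta> - r \<theta>))" by (intro continuous_intros cq cr)
  then obtain \<theta>0 where \<theta>0: "\<theta>0 \<in> {0..2 * pi}" "\<And>\<theta>. \<theta> \<in> {0..2 * pi} \<Longrightarrow> norm (q \<theta> - r \<theta>) \<le> norm (q \<theta>0
      - r \<theta>0)"
    using continuous_attains_sup[of "{0..2 * pi}" "\<lambda>\<theta>. norm (q \<theta> - r \<theta>)"] by (auto simp: pi_ge_zero)
  define d where "d = norm (q \<theta>0 - r \<theta>0)"
  have rep: "\<exists>s\<in>{0..2 * pi}. q s - r s = q \<theta> - r \<theta>" for \<theta>
    using periodic_representative[where u = "\<lambda>\<theta>. q \<theta> - r \<theta>", OF per] by metis
  have d: "norm (q \<theta> - r \<theta>) \<le> d" for \<theta> using rep[of \<theta>] \<theta>0(2) unfolding d_def by metis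
  have vd: "norm (velocity \<epsilon> q \<theta> - velocity \<epsilon> r \<theta>) \<le> \<epsilon> * velocity_lipschitz * d" for \<theta>
    by (rule velocity_difference_le[OF cq cr \<epsilon>(1) d])
  have d0: "d \<ge> 0" by (simp add: d_def)
  have diff: "norm ((q \<theta> - r \<theta>) - (q 0 - r 0)) \<le> 1 / 3 * d" for \<theta>
  proof -
    obtain s where s: "s \<in> {0..2 * pi}" "q s - r s = q \<theta> - r \<theta>" using rep[of \<theta>] by blast
    have "q s = q 0 + primitive (velocity \<epsilon> q) s" "r s = r 0 + primitive (velocity \<epsilon> r) s"
      using q r by (auto intro!: eq_primitive velocity_cont cq cr simp: solution_def)
    then have "(q s - r s) - (q 0 - r 0) = primitive (velocity \<epsilon> q) s - primitive (velocity \<epsilon> r) s"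
        by simp
    then have "norm ((q s - r s) - (q 0 - r 0)) \<le> (\<epsilon> * velocity_lipschitz * d) * \<bar>s\<bar>"
      using primitive_diff_bound[OF velocity_cont[OF cq] velocity_cont[OF cr] vd, of s] by simp
    also have "\<dots> \<le> (\<epsilon> * velocity_lipschitz * d) * (2 * pi)"
      using s(1) \<epsilon>(1) velocity_lipschitz_nonneg d0 by (intro mult_left_mono) auto
    also have "\<dots> = (2 * pi * (\<epsilon> * velocity_lipschitz)) * d" by simp
    also have "\<dots> \<le> 1 / 3 * d" by (intro mult_right_mono \<epsilon>(2) d0)
    finally show ?thesis using s(2) by simp
  qed
  have "norm (q \<theta>0 - r \<theta>0) \<le> norm ((q \<theta>0 - r \<theta>0) - (q 0 - r 0)) + norm (q 0 - r 0)"
    using norm_triangle_ineq[of "(q \<theta>0 - r \<theta>0) - (q 0 - r 0)" "q 0 - r 0"] by simp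
  then have "d \<le> 1 / 3 * d + \<delta>" using diff[of \<theta>0] unfolding d_def \<delta>_def by linarith
  then have d\<delta>: "d \<le> 3 / 2 * \<delta>" by simp
  show "norm (q \<theta> - r \<theta>) \<le> 3 / 2 * \<delta>" using d[of \<theta>] d\<delta> by linarith
  show "norm ((q \<theta> - r \<theta>) - (q 0 - r 0)) \<le> 1 / 2 * \<delta>" using diff[of \<theta>] d\<delta> by linarith
  have e: "\<epsilon> * velocity_lipschitz \<le> 1 / 3"
  proof -
    have "1 * (\<epsilon> * velocity_lipschitz) \<le> 2 * pi * (\<epsilon> * velocity_lipschitz)"
      using \<epsilon>(1) velocity_lipschitz_nonneg pi_gt3 by (intro mult_right_mono) auto
    then show ?thesis using \<epsilon>(2) by linarith
  qed
  have "\<epsilon> * velocity_lipschitz * d \<le> 1 / 3 * d" by (intro mult_right_mono e d0)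
  then show "norm (velocity \<epsilon> q \<theta> - velocity \<epsilon> r \<theta>) \<le> \<delta>" using vd[of \<theta>] d\<delta> d0 by linarith
qed

end

section \<open>The action functional\<close>

text \<open>
  The area form of the plane.
\<close>

definition cross :: "complex \<Rightarrow> complex \<Rightarrow> real" where
  "cross u v = Re u * Im v - Im u * Re v"

lemma abs_cross_le: "\<bar>cross u v\<bar> \<le> norm u * norm v"
proof -
  have "cross u v = Im (cnj u * v)" by (simp add: cross_def)
  then show ?thesis using abs_Im_le_cmod[of "cnj u * v"] by (simp add: norm_mult)
qed

lemma cross_rotate: "cross u (\<i> * u) = (norm u)\<^sup>2"
  using cmod_power2[of u] by (simp add: cross_def power2_eq_square)

lemma cross_scaleR_right: "cross u (t *\<^sub>R v) = t * cross u v"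
  by (simp add: cross_def algebra_simps)

text \<open>
  The one-form \<open>A dq\<^sub>2\<close> is a primitive of the magnetic form. It is invariant under translation by
  \<open>2\<pi>\<close> in \<open>q\<^sub>2\<close>, but in general not in \<open>q\<^sub>1\<close>.
\<close>

locale magnetic_action = field_bounds f m M L for f m M L +
  fixes A A2 :: "real \<times> real \<Rightarrow> real"
  assumes A_deriv: "\<And>p. (A has_derivative (\<lambda>h. f (Complex (fst p) (snd p)) * fst h + A2 p * snd h))
      (at p)"
    and A2_cont: "continuous_on UNIV A2"
    and A_periodic: "\<And>x y. A (x, y + 2 * pi) = A (x, y)"
    and f_periodic: "\<And>z. f (z + of_real (2 * pi)) = f z" "\<And>z. f (z + \<i> * of_real (2 * pi)) = f z"
begin

abbreviation "Az z \<equiv> A (Re z, Im z)"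
abbreviation "A2z z \<equiv> A2 (Re z, Im z)"

lemma A_cont: "continuous_on UNIV A"
  using A_deriv by (meson continuous_at_imp_continuous_on has_derivative_continuous)

lemma A_comp_cont: "continuous_on S q \<Longrightarrow> continuous_on S (\<lambda>\<theta>. Az (q \<theta>))"
  by (rule continuous_on_compose2[OF A_cont]) (auto intro!: continuous_intros)

lemma A2_comp_cont: "continuous_on S q \<Longrightarrow> continuous_on S (\<lambda>\<theta>. A2z (q \<theta>))"
  by (rule continuous_on_compose2[OF A2_cont]) (auto intro!: continuous_intros)

text \<open>
  Its Euler-Lagrange equation is \<open>f(q) q' = - \<epsilon> cis \<theta>\<close>. The term in \<open>A\<close> is minus the magnetic flux
  through the loop.
\<close>

definition action :: "real \<Rightarrow> (real \<Rightarrow> complex) \<Rightarrow> (real \<Rightarrow> complex) \<Rightarrow> real" where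
  "action \<epsilon> q q' = integral {0..2 * pi} (\<lambda>\<theta>. \<epsilon> * cross (cis \<theta>) (q \<theta>) - Az (q \<theta>) * Im (q' \<theta>))"

lemma A_chain:
  assumes "(q has_vector_derivative q') (at s)"
  shows "((\<lambda>s. Az (q s)) has_real_derivative f (q s) * Re q' + A2z (q s) * Im q') (at s)"
proof -
  have "((\<lambda>s. (Re (q s), Im (q s))) has_derivative (\<lambda>h. (Re (h *\<^sub>R q'), Im (h *\<^sub>R q')))) (at s)"
    using assms unfolding has_vector_derivative_def by (intro has_derivative_Pair has_derivative_Re
        has_derivative_Im)
  from has_derivative_compose[OF this A_deriv]
  have "((\<lambda>s. Az (q s)) has_derivative
    (\<lambda>h. f (q s) * (h * Re q') + A2z (q s) * (h * Im q'))) (at s)" by simp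
  then show ?thesis
    by (rule has_derivative_imp_has_field_derivative) (simp add: algebra_simps)
qed

definition loop :: "(real \<Rightarrow> complex) \<Rightarrow> (real \<Rightarrow> complex) \<Rightarrow> bool" where
  "loop q q' \<longleftrightarrow> q (2 * pi) = q 0 \<and> (\<forall>\<theta>. (q has_vector_derivative q' \<theta>) (at \<theta>)) \<and> continuous_on UNIV q'"

lemma loop_cont: "loop q q' \<Longrightarrow> continuous_on UNIV q"
  unfolding loop_def by (meson continuous_at_imp_continuous_on has_vector_derivative_continuous)

text \<open>
  Differentiate under the integral sign and integrate the term with \<open>d'\<close> by parts. The partial
  derivative \<open>A2\<close> cancels, and what remains is gauge invariant: it contains \<open>f\<close> only.
\<close>

lemma first_variation:
  assumes q: "loop q q'" and d: "loop d d'"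
  defines "qs \<equiv> \<lambda>s \<theta>. q \<theta> + s *\<^sub>R d \<theta>" and "qs' \<equiv> \<lambda>s \<theta>. q' \<theta> + s *\<^sub>R d' \<theta>"
  shows "((\<lambda>s. action \<epsilon> (qs s) (qs' s)) has_real_derivative
     integral {0..2 * pi} (\<lambda>\<theta>. cross (f (qs s \<theta>) *\<^sub>R qs' s \<theta> + \<epsilon> *\<^sub>R cis \<theta>) (d \<theta>))) (at s)"
proof -
  let ?A = "\<lambda>s \<theta>. Az (qs s \<theta>)" and ?A2 = "\<lambda>s \<theta>. A2z (qs s \<theta>)"
  define h where "h s \<theta> = \<epsilon> * cross (cis \<theta>) (qs s \<theta>) - ?A s \<theta> * Im (qs' s \<theta>)" for s \<theta>
  define hs where "hs s \<theta> = \<epsilon> * cross (cis \<theta>) (d \<theta>)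
     - ((f (qs s \<theta>) * Re (d \<theta>) + ?A2 s \<theta> * Im (d \<theta>)) * Im (qs' s \<theta>) + ?A s \<theta> * Im (d' \<theta>))" for s \<theta>
  have cont: "continuous_on UNIV q" "continuous_on UNIV d" "continuous_on UNIV q'" "continuous_on
      UNIV d'"
    using loop_cont q d unfolding loop_def by blast+
  note cont2 = continuous_on_compose2[OF cont(1)] continuous_on_compose2[OF cont(2)]
     continuous_on_compose2[OF cont(3)] continuous_on_compose2[OF cont(4)]
  have cq: "continuous_on S (\<lambda>p. qs (fst p) (snd p))" "continuous_on S (\<lambda>p. qs' (fst p) (snd p))" for S
    unfolding qs_def qs'_def by (intro continuous_intros cont2; auto)+
  have cd: "continuous_on S (\<lambda>p. d (snd p))" "continuous_on S
      (\<lambda>p. d' (snd p))" for S :: "(real \<times> real) set"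
    by (intro continuous_intros cont2; auto)+
  have ch: "continuous_on S (\<lambda>p. h (fst p) (snd p))" for S
    unfolding h_def cross_def by (intro continuous_intros cq A_comp_cont)
  have chs: "continuous_on S (\<lambda>p. hs (fst p) (snd p))" for S
    unfolding hs_def cross_def by (intro continuous_intros cq cd A_comp_cont A2_comp_cont f_comp_cont)
  have slice: "continuous_on X (\<lambda>\<theta>. g s \<theta>)" if "\<And>S. continuous_on S
      (\<lambda>p. g (fst p) (snd p))" for X s and g :: "real \<Rightarrow> real \<Rightarrow> 'z::topological_space"
  proof -
    have "continuous_on X (\<lambda>\<theta>. (s, \<theta>))" by (intro continuous_intros)
    from continuous_on_compose2[OF that[of UNIV] this] show ?thesis by simp
  qed
  have dqs: "((\<lambda>s. qs s \<theta>) has_vector_derivative d \<theta>) (at s)" for s \<theta>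
    unfolding qs_def has_vector_derivative_def by (auto intro!: derivative_eq_intros)
  have dqs': "((\<lambda>s. Im (qs' s \<theta>)) has_real_derivative Im (d' \<theta>)) (at s)" for s \<theta>
    unfolding qs'_def by (auto intro!: derivative_eq_intros)
  have dcr: "((\<lambda>s. cross (cis \<theta>) (qs s \<theta>)) has_real_derivative cross (cis \<theta>) (d \<theta>)) (at s)" for s \<theta>
    unfolding qs_def cross_def by (auto intro!: derivative_eq_intros simp: algebra_simps)
  have dh: "((\<lambda>s. h s \<theta>) has_real_derivative hs s \<theta>) (at s)" for s \<theta>
    unfolding h_def hs_def
    using DERIV_diff[OF DERIV_cmult[OF dcr[of \<theta> s], of \<epsilon>] DERIV_mult[OF A_chain[OF dqs[of \<theta> s]]
        dqs'[of \<theta> s]]]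
    by (simp add: algebra_simps)
  have "((\<lambda>s. integral (cbox 0 (2 * pi)) (h s)) has_field_derivative integral (cbox 0 (2 * pi)) (hs
      s)) (at s within UNIV)"
  proof (rule leibniz_rule_field_derivative)
    show "((\<lambda>s. h s \<theta>) has_real_derivative hs s \<theta>) (at s)" for s \<theta> by (rule dh)
    show "h s integrable_on cbox 0 (2 * pi)" for s by (intro integrable_continuous slice ch)
    show "continuous_on (UNIV \<times> cbox 0 (2 * pi)) (\<lambda>(x, y). hs x y)"
      using chs by (simp add: case_prod_unfold)
  qed auto
  moreover have "integral {0..2 * pi} (hs s) = integral {0..2 * pi}
      (\<lambda>\<theta>. cross (f (qs s \<theta>) *\<^sub>R qs' s \<theta> + \<epsilon> *\<^sub>R cis \<theta>) (d \<theta>))"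
  proof -
    \<comment> \<open>The \<open>\<theta>\<close>-derivative of \<open>A(q) Im d\<close>, whose integral over the closed curve is zero.\<close>
    let ?p = "\<lambda>\<theta>. (f (qs s \<theta>) * Re (qs' s \<theta>) + ?A2 s \<theta> * Im (qs' s \<theta>)) * Im (d \<theta>) + ?A s \<theta> * Im (d' \<theta>)"
    have dq: "(qs s has_vector_derivative qs' s \<theta>) (at \<theta>)" for \<theta>
      unfolding qs_def qs'_def using q d unfolding loop_def
      by (intro has_vector_derivative_add bounded_linear.has_vector_derivative[OF
          bounded_linear_scaleR_right]) auto
    have dd: "((\<lambda>\<theta>. Im (d \<theta>)) has_real_derivative Im (d' \<theta>)) (at \<theta>)" for \<theta>
      using bounded_linear.has_vector_derivative[OF bounded_linear_Im, of d "d' \<theta>" "at \<theta>"] d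
      by (simp add: loop_def vector_deriv_iff)
    have "((\<lambda>\<theta>. ?A s \<theta> * Im (d \<theta>)) has_real_derivative ?p \<theta>) (at \<theta>)" for \<theta>
      using DERIV_mult[OF A_chain[OF dq[of \<theta>]] dd[of \<theta>]] by (simp add: algebra_simps)
    then have "(?p has_integral (?A s (2 * pi) * Im (d (2 * pi)) - ?A s 0 * Im (d 0))) {0..2 * pi}"
      by (intro fundamental_theorem_of_calculus)
        (auto simp: vector_deriv_iff intro:
            has_vector_derivative_at_within)
    moreover have "qs s (2 * pi) = qs s 0" "d (2 * pi) = d 0" using q d
        by (simp_all add: qs_def loop_def)
    ultimately have p: "(?p has_integral 0) {0..2 * pi}" by simp
    have hs: "(hs s has_integral integral {0..2 * pi} (hs s)) {0..2 * pi}"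
      by (intro integrable_integral integrable_continuous_real slice chs)
    have eq: "hs s \<theta> + ?p \<theta> = cross (f (qs s \<theta>) *\<^sub>R qs' s \<theta> + \<epsilon> *\<^sub>R cis \<theta>) (d \<theta>)" for \<theta>
      by (simp add: hs_def cross_def algebra_simps)
    from has_integral_add[OF hs p]
    have "((\<lambda>\<theta>. cross (f (qs s \<theta>) *\<^sub>R qs' s \<theta> + \<epsilon> *\<^sub>R cis \<theta>) (d \<theta>))
        has_integral integral {0..2 * pi} (hs s)) {0..2 * pi}"
      by (simp only: eq add_0_right)
    from integral_unique[OF this] show ?thesis by (rule sym)
  qed
  moreover have "integral {0..2 * pi} (h s) = action \<epsilon> (qs s) (qs' s)" for s
    by (simp add: action_def h_def[abs_def])
  ultimately show ?thesis by simp
qed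

lemma solution_loop: "solution \<epsilon> q \<Longrightarrow> loop q (velocity \<epsilon> q)"
  using solution_cont[of \<epsilon> q UNIV] velocity_cont[of UNIV q \<epsilon>] unfolding loop_def solution_def
  by (metis add_0)

text \<open>
  By the mean value theorem the difference of the actions is the first variation at an intermediate
  curve. There the vector field \<open>f(q) q' + \<epsilon> cis \<theta>\<close> differs from the constant \<open>drift \<epsilon> q\<close> by
  \<open>O(\<delta>)\<close>, and \<open>r - q\<close> differs from its initial value by at most \<open>\<delta>/2\<close>. The resulting error
  \<open>\<pi> * norm (drift \<epsilon> q) * \<delta>\<close> is linear in \<open>\<delta>\<close>, but it is only half of the main term when
  \<open>r 0 - q 0\<close> is orthogonal to the drift.
\<close>

lemma action_difference:
  assumes \<epsilon>: "\<epsilon> \<ge> 0" "2 * pi * (\<epsilon> * velocity_lipschitz) \<le> 1 / 3"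
    and q: "solution \<epsilon> q" and r: "solution \<epsilon> r"
  defines "\<delta> \<equiv> norm (r 0 - q 0)" and "C \<equiv> L * (3 / 2) * (2 * \<epsilon> / m) + M"
  shows "\<bar>action \<epsilon> r (velocity \<epsilon> r) - action \<epsilon> q (velocity \<epsilon> q) - 2 * pi * cross (drift \<epsilon> q) (r 0
      - q 0)\<bar>
     \<le> pi * norm (drift \<epsilon> q) * \<delta> + 3 * pi * C * \<delta>\<^sup>2"
proof -
  define d where "d \<theta> = r \<theta> - q \<theta>" for \<theta>
  define d' where "d' \<theta> = velocity \<epsilon> r \<theta> - velocity \<epsilon> q \<theta>" for \<theta>
  define qs where "qs s \<theta> = q \<theta> + s *\<^sub>R d \<theta>" for s \<theta>
  define qs' where "qs' s \<theta> = velocity \<epsilon> q \<theta> + s *\<^sub>R d' \<theta>" for s \<theta>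
  define c where "c = drift \<epsilon> q"
  have lq: "loop q (velocity \<epsilon> q)" and lr: "loop r (velocity \<epsilon> r)" using solution_loop q r by auto
  have cq: "continuous_on S q" and cr: "continuous_on S r" for S using solution_cont q r by auto
  have ld: "loop d d'"
    using lq lr unfolding loop_def d_def d'_def by (auto intro!:
        has_vector_derivative_diff continuous_intros)
  let ?W = "\<lambda>s \<theta>. f (qs s \<theta>) *\<^sub>R qs' s \<theta> + \<epsilon> *\<^sub>R cis \<theta>"
  let ?I = "\<lambda>s. integral {0..2 * pi} (\<lambda>\<theta>. cross (?W s \<theta>) (d \<theta>))"
  have "((\<lambda>s. action \<epsilon> (qs s) (qs' s)) has_real_derivative ?I s) (at s)" for s
    unfolding qs_def[abs_def] qs'_def[abs_def] by (rule first_variation[OF lq ld])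
  from MVT2[of 0 1, OF _ this] obtain s where s: "0 < s" "s < 1"
    and e: "action \<epsilon> (qs 1) (qs' 1) - action \<epsilon> (qs 0) (qs' 0) = ?I s" by auto
  have ends: "qs 1 = r" "qs' 1 = velocity \<epsilon> r" "qs 0 = q" "qs' 0 = velocity \<epsilon> q"
    by (auto simp: qs_def qs'_def d_def d'_def)
  have \<delta>': "\<delta> = norm (q 0 - r 0)" by (simp add: \<delta>_def norm_minus_commute)
  note lip = solution_difference_le[OF \<epsilon> q r, folded \<delta>']
  have d_le: "norm (d \<theta>) \<le> 3 / 2 * \<delta>" for \<theta> using lip(1)[of \<theta>] by (simp add: d_def norm_minus_commute)
  have d'_le: "norm (d' \<theta>) \<le> \<delta>" for \<theta> using lip(3)[of \<theta>] by (simp add: d'_def norm_minus_commute)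
  have d0_le: "norm (d \<theta> - (r 0 - q 0)) \<le> 1 / 2 * \<delta>" for \<theta>
    using lip(2)[of \<theta>] norm_minus_cancel[of "d \<theta> - (r 0 - q 0)"] by (simp add: d_def algebra_simps)
  have C0: "C \<ge> 0" unfolding C_def using L \<epsilon>(1) m M_pos by (intro add_nonneg_nonneg
      mult_nonneg_nonneg) auto
  have \<delta>0: "\<delta> \<ge> 0" by (simp add: \<delta>_def)
  have W: "norm (?W s \<theta> - c) \<le> C * \<delta>" for \<theta>
  proof -
    have "f (q \<theta>) *\<^sub>R velocity \<epsilon> q \<theta> + \<epsilon> *\<^sub>R cis \<theta> = c"
      using f_pos[of "q \<theta>"] by (simp add: velocity_def c_def)
    then have "?W s \<theta> - c = f (qs s \<theta>) *\<^sub>R qs' s \<theta> - f (q \<theta>) *\<^sub>R velocity \<epsilon> q \<theta>"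
        by (simp add: algebra_simps)
    also have "\<dots> = (f (qs s \<theta>) - f (q \<theta>)) *\<^sub>R qs' s \<theta> + f (q \<theta>) *\<^sub>R (s *\<^sub>R d' \<theta>)"
      by (simp add: qs'_def algebra_simps)
    also have "norm \<dots> \<le> \<bar>f (qs s \<theta>) - f (q \<theta>)\<bar> * norm (qs' s \<theta>) + f (q \<theta>) * (s * norm (d' \<theta>))"
      using f_pos[of "q \<theta>"] s by (intro order_trans[OF norm_triangle_ineq]) simp
    also have "\<dots> \<le> (L * (3 / 2 * \<delta>)) * (2 * \<epsilon> / m) + M * (1 * \<delta>)"
    proof (rule add_mono)
      have "norm (qs s \<theta> - q \<theta>) \<le> 1 * (3 / 2 * \<delta>)"
        using s d_le[of \<theta>] mult_mono[of s 1 "norm (d \<theta>)" "3 / 2 * \<delta>"] by (simp add: qs_def)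
      then have "L * norm (qs s \<theta> - q \<theta>) \<le> L * (3 / 2 * \<delta>)" using L by (intro mult_left_mono) auto
      then have a: "\<bar>f (qs s \<theta>) - f (q \<theta>)\<bar> \<le> L * (3 / 2 * \<delta>)" using f_lip[of "qs s \<theta>" "q \<theta>"] by linarith
      have "qs' s \<theta> = (1 - s) *\<^sub>R velocity \<epsilon> q \<theta> + s *\<^sub>R velocity \<epsilon> r \<theta>"
        by (simp add: qs'_def d'_def algebra_simps)
      then have "norm (qs' s \<theta>) \<le> (1 - s) * norm (velocity \<epsilon> q \<theta>) + s * norm (velocity \<epsilon> r \<theta>)"
        using norm_triangle_ineq[of "(1 - s) *\<^sub>R velocity \<epsilon> q \<theta>" "s *\<^sub>R velocity \<epsilon> r \<theta>"] s by simp
      also have "\<dots> \<le> (1 - s) * (2 * \<epsilon> / m) + s * (2 * \<epsilon> / m)"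
        using s velocity_le[OF cq \<epsilon>(1)] velocity_le[OF cr \<epsilon>(1)] by (intro add_mono mult_left_mono) auto
      also have "\<dots> = 2 * \<epsilon> / m" unfolding distrib_right[symmetric] by simp
      finally have b: "norm (qs' s \<theta>) \<le> 2 * \<epsilon> / m" .
      show "\<bar>f (qs s \<theta>) - f (q \<theta>)\<bar> * norm (qs' s \<theta>) \<le> (L * (3 / 2 * \<delta>)) * (2 * \<epsilon> / m)"
        by (rule mult_mono[OF a b]) (use L \<delta>0 in auto)
      have "s * norm (d' \<theta>) \<le> 1 * \<delta>" using s d'_le[of \<theta>] by (intro mult_mono) auto
      then show "f (q \<theta>) * (s * norm (d' \<theta>)) \<le> M * (1 * \<delta>)"
        by (rule mult_mono[OF f_upper]) (use s M_pos in auto)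
    qed
    also have "\<dots> = C * \<delta>" by (simp add: C_def algebra_simps)
    finally show ?thesis .
  qed
  have pt: "\<bar>cross (?W s \<theta>) (d \<theta>) - cross c (r 0 - q 0)\<bar> \<le> norm c * (1 / 2 * \<delta>)
      + (C * \<delta>) * (3 / 2 * \<delta>)" for \<theta>
  proof -
    have "cross (?W s \<theta>) (d \<theta>) - cross c (r 0 - q 0) = cross c (d \<theta> - (r 0 - q 0)) + cross (?W s \<theta>
        - c) (d \<theta>)"
      by (simp add: cross_def algebra_simps)
    moreover have "\<bar>cross c (d \<theta> - (r 0 - q 0))\<bar> \<le> norm c * (1 / 2 * \<delta>)"
      by (rule order_trans[OF abs_cross_le]) (intro mult_left_mono d0_le norm_ge_zero)
    moreover have "\<bar>cross (?W s \<theta> - c) (d \<theta>)\<bar> \<le> (C * \<delta>) * (3 / 2 * \<delta>)"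
      by (rule order_trans[OF abs_cross_le]) (intro mult_mono W d_le norm_ge_zero mult_nonneg_nonneg
          C0 \<delta>0)
    ultimately show ?thesis by linarith
  qed
  have cd: "continuous_on S d" "continuous_on S (qs s)" "continuous_on S (qs' s)" for S
    unfolding d_def[abs_def] qs_def[abs_def] qs'_def[abs_def] d'_def
    by (intro continuous_intros cq cr velocity_cont)+
  have cint: "continuous_on S (\<lambda>\<theta>. cross (?W s \<theta>) (d \<theta>))" for S
    unfolding cross_def by (intro continuous_intros cd f_comp_cont)
  have "?I s - 2 * pi * cross c (r 0 - q 0) = integral {0..2 * pi} (\<lambda>\<theta>. cross (?W s \<theta>) (d \<theta>)
      - cross c (r 0 - q 0))"
    by (subst integral_diff) (auto intro!: integrable_continuous_real cint)
  also have "norm \<dots> \<le> (norm c * (1 / 2 * \<delta>) + (C * \<delta>) * (3 / 2 * \<delta>)) * (2 * pi - 0)"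
    by (rule integral_bound) (use pt in \<open>auto intro!: continuous_on_diff cint continuous_on_const\<close>)
  also have "\<dots> = pi * norm c * \<delta> + 3 * pi * C * \<delta>\<^sup>2" by (simp add: algebra_simps power2_eq_square)
  finally show ?thesis using e by (simp add: ends c_def)
qed

lemma solution_shift:
  assumes "solution \<epsilon> q" and c: "\<And>z. f (z + c) = f z"
  shows "solution \<epsilon> (\<lambda>\<theta>. q \<theta> + c)" "velocity \<epsilon> (\<lambda>\<theta>. q \<theta> + c) = velocity \<epsilon> q"
proof -
  show v: "velocity \<epsilon> (\<lambda>\<theta>. q \<theta> + c) = velocity \<epsilon> q"
    by (simp add: fun_eq_iff velocity_def drift_def mass_def moment_def c)
  show "solution \<epsilon> (\<lambda>\<theta>. q \<theta> + c)"
    using assms(1) unfolding solution_def v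
    by (auto intro!: derivative_eq_intros simp: has_vector_derivative_add_const)
qed

lemma integral_cross_cis: "((\<lambda>\<theta>. \<epsilon> * cross (cis \<theta>) c) has_integral 0) {0..2 * pi}"
proof -
  let ?G = "\<lambda>\<theta>. \<epsilon> * (sin \<theta> * Im c + cos \<theta> * Re c)"
  have "(?G has_real_derivative \<epsilon> * cross (cis \<theta>) c) (at \<theta>)" for \<theta>
    unfolding cross_def by (auto intro!: derivative_eq_intros)
  then have "((\<lambda>\<theta>. \<epsilon> * cross (cis \<theta>) c) has_integral (?G (2 * pi) - ?G 0)) {0..2 * pi}"
    by (intro fundamental_theorem_of_calculus)
      (auto simp: vector_deriv_iff intro: has_vector_derivative_at_within)
  then show ?thesis by simp
qed

text \<open>
  Translating \<open>q\<^sub>1\<close> by \<open>2\<pi>\<close> changes \<open>A\<close> by a function of \<open>q\<^sub>2\<close> alone, the flux per unit length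
  through a strip of width \<open>2\<pi>\<close>. Such a function contributes nothing to the integral over a closed
  curve.
\<close>

lemma A_shift: "A (x + 2 * pi, y) = A (x, y) + (A (2 * pi, y) - A (0, y))"
proof -
  have "((\<lambda>x. A (x + 2 * pi, y) - A (x, y)) has_vector_derivative 0) (at x)" for x
  proof -
    have "((\<lambda>x. Complex (x + 2 * pi) y) has_vector_derivative 1) (at x)"
      "((\<lambda>x. Complex x y) has_vector_derivative 1) (at x)"
      by (auto simp: has_vector_derivative_complex_iff intro!: derivative_eq_intros)
    from DERIV_diff[OF A_chain[OF this(1)] A_chain[OF this(2)]]
    have "((\<lambda>x. A (x + 2 * pi, y) - A (x, y)) has_real_derivative f (Complex (x + 2 * pi) y)
        - f (Complex x y)) (at x)"
      by simp
    moreover have "Complex (x + 2 * pi) y = Complex x y + of_real (2 * pi)"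
        by (simp add: complex_eq_iff)
    ultimately show ?thesis using f_periodic(1) by (simp add:
        vector_deriv_iff)
  qed
  from zero_derivative_constant[OF this, of x 0] show ?thesis by simp
qed

lemma action_shift:
  assumes q: "solution \<epsilon> q"
  shows "action \<epsilon> (\<lambda>\<theta>. q \<theta> + of_real (2 * pi)) (velocity \<epsilon> q) = action \<epsilon> q (velocity \<epsilon> q)"
    and "action \<epsilon> (\<lambda>\<theta>. q \<theta> + \<i> * of_real (2 * pi)) (velocity \<epsilon> q) = action \<epsilon> q (velocity \<epsilon> q)"
proof -
  let ?v = "velocity \<epsilon> q"
  let ?g = "\<lambda>c \<theta>. \<epsilon> * cross (cis \<theta>) (q \<theta> + c) - Az (q \<theta> + c) * Im (?v \<theta>)"
  let ?c1 = "of_real (2 * pi) :: complex" and ?c2 = "\<i> * of_real (2 * pi)"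
  have cq: "continuous_on S q" and cv: "continuous_on S ?v" for S
      using solution_cont[OF q] velocity_cont by auto
  have g: "(?g 0 has_integral action \<epsilon> q ?v) {0..2 * pi}" unfolding action_def cross_def add_0_right
    by (intro integrable_integral integrable_continuous_real continuous_intros cq cv A_comp_cont)
  define \<mu> where "\<mu> y = A (2 * pi, y) - A (0, y)" for y
  have c\<mu>: "continuous_on UNIV \<mu>" unfolding \<mu>_def
    by (intro continuous_intros continuous_on_compose2[OF A_cont]) auto
  have "((\<lambda>\<theta>. \<mu> (Im (q \<theta>)) * Im (?v \<theta>)) has_integral (primitive \<mu> (Im (q (2 * pi)))
      - primitive \<mu> (Im (q 0)))) {0..2 * pi}"
  proof (rule fundamental_theorem_of_calculus)
    fix \<theta>
    have "(primitive \<mu> has_real_derivative \<mu> (Im (q \<theta>))) (at (Im (q \<theta>)))"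
      using primitive_has_vector_derivative[OF c\<mu>] by (simp add:
          vector_deriv_iff)
    moreover have "((\<lambda>\<theta>. Im (q \<theta>)) has_real_derivative Im (?v \<theta>)) (at \<theta>)"
      using bounded_linear.has_vector_derivative[OF bounded_linear_Im, of q "?v \<theta>" "at \<theta>"] q
      by (simp add: solution_def vector_deriv_iff)
    ultimately have "((\<lambda>\<theta>. primitive \<mu> (Im (q \<theta>))) has_real_derivative \<mu> (Im (q \<theta>)) * Im (?v \<theta>)) (at \<theta>)"
      by (rule DERIV_chain2)
    then show "((\<lambda>\<theta>. primitive \<mu> (Im (q \<theta>))) has_vector_derivative \<mu> (Im (q \<theta>)) * Im (?v \<theta>))
        (at \<theta> within {0..2 * pi})"
      by (simp add: vector_deriv_iff has_vector_derivative_at_within)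
  qed simp
  moreover have "q (2 * pi) = q 0" using q unfolding solution_def by (metis add_0)
  ultimately have flux: "((\<lambda>\<theta>. \<mu> (Im (q \<theta>)) * Im (?v \<theta>)) has_integral 0) {0..2 * pi}" by simp
  have "(?g ?c1 has_integral (action \<epsilon> q ?v + 0) - 0) {0..2 * pi}"
  proof (rule has_integral_eq[OF _ has_integral_diff[OF has_integral_add[OF g integral_cross_cis]
      flux]])
    fix \<theta>
    have "Az (q \<theta> + ?c1) = Az (q \<theta>) + \<mu> (Im (q \<theta>))"
      using A_shift[of "Re (q \<theta>)" "Im (q \<theta>)"] by (simp add: \<mu>_def)
    then show "(?g 0 \<theta> + \<epsilon> * cross (cis \<theta>) ?c1) - \<mu> (Im (q \<theta>)) * Im (?v \<theta>) = ?g ?c1 \<theta>"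
      by (simp only:) (simp add: cross_def algebra_simps)
  qed
  then show "action \<epsilon> (\<lambda>\<theta>. q \<theta> + ?c1) ?v = action \<epsilon> q ?v"
    unfolding action_def[of \<epsilon> "\<lambda>\<theta>. q \<theta> + ?c1"] by (simp add: integral_unique)
  have "(?g ?c2 has_integral (action \<epsilon> q ?v + 0)) {0..2 * pi}"
  proof (rule has_integral_eq[OF _ has_integral_add[OF g integral_cross_cis]])
    fix \<theta>
    show "?g 0 \<theta> + \<epsilon> * cross (cis \<theta>) ?c2 = ?g ?c2 \<theta>"
      using A_periodic[of "Re (q \<theta>)" "Im (q \<theta>)"] by (simp add: cross_def algebra_simps)
  qed
  then show "action \<epsilon> (\<lambda>\<theta>. q \<theta> + ?c2) ?v = action \<epsilon> q ?v"
    unfolding action_def[of \<epsilon> "\<lambda>\<theta>. q \<theta> + ?c2"] by (simp add: integral_unique)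
qed

text \<open>
  The action of the solution starting at \<open>a\<close> is a doubly periodic continuous function of \<open>a\<close>, so it
  has a global maximum. If the drift \<open>c\<close> did not vanish there, then moving the starting point by
  \<open>t \<i> c\<close> would raise the action by at least \<open>\<pi> t (norm c)\<^sup>2 (1 - 3 C t)\<close>, which is positive for
  small \<open>t\<close>.
\<close>

lemma drift_free_solution:
  assumes \<epsilon>: "\<epsilon> \<ge> 0" "2 * pi * (\<epsilon> * velocity_lipschitz) \<le> 1 / 3"
  obtains q where "solution \<epsilon> q" "drift \<epsilon> q = 0"
proof -
  define Q where "Q a = (SOME q. solution \<epsilon> q \<and> q 0 = a)" for a
  have "solution \<epsilon> (Q a) \<and> Q a 0 = a" for a
    unfolding Q_def by (rule someI_ex[OF solution_exists[OF \<epsilon>]])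
  then have Q: "solution \<epsilon> (Q a)" "Q a 0 = a" for a by auto
  define \<phi> where "\<phi> a = action \<epsilon> (Q a) (velocity \<epsilon> (Q a))" for a
  define C where "C = L * (3 / 2) * (2 * \<epsilon> / m) + M"
  have C0: "C \<ge> 0" unfolding C_def using L \<epsilon>(1) m M_pos by (intro add_nonneg_nonneg
      mult_nonneg_nonneg) auto
  have diff: "\<bar>\<phi> b - \<phi> a - 2 * pi * cross (drift \<epsilon> (Q a)) (b - a)\<bar>
      \<le> pi * norm (drift \<epsilon> (Q a)) * norm (b - a) + 3 * pi * C * (norm (b - a))\<^sup>2" for a b
    using action_difference[OF \<epsilon> Q(1)[of a] Q(1)[of b]] by (simp add: \<phi>_def C_def Q(2))
  have same: "\<phi> (r 0) = action \<epsilon> r (velocity \<epsilon> r)" if "solution \<epsilon> r" for r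
    using action_difference[OF \<epsilon> that Q(1)[of "r 0"]] by (simp add: \<phi>_def Q(2) cross_def)
  have per: "\<phi> (a + of_real (2 * pi)) = \<phi> a" "\<phi> (a + \<i> * of_real (2 * pi)) = \<phi> a" for a
    using same[OF solution_shift(1)[OF Q(1)[of a] f_periodic(1)]] same[OF solution_shift(1)[OF
        Q(1)[of a] f_periodic(2)]]
      same[OF Q(1)[of a]]
    by (simp_all only: Q(2) solution_shift(2)[OF Q(1)[of a] f_periodic(1)] solution_shift(2)[OF
        Q(1)[of a] f_periodic(2)]
        action_shift[OF Q(1)])
  have cont: "continuous_on UNIV \<phi>"
  proof -
    have "(\<phi> \<longlongrightarrow> \<phi> a) (at a)" for a
    proof (rule LIM_zero_cancel)
      let ?k = "norm (drift \<epsilon> (Q a))"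
      have "((\<lambda>b. pi * ?k * norm (b - a) + 3 * pi * C * (norm (b - a))\<^sup>2) \<longlongrightarrow> 0) (at a)"
        by (auto intro!: tendsto_eq_intros)
      then have "((\<lambda>b. \<phi> b - \<phi> a - 2 * pi * cross (drift \<epsilon> (Q a)) (b - a)) \<longlongrightarrow> 0) (at a)"
        by (rule Lim_null_comparison[rotated]) (use diff[of _ a] in auto)
      moreover have "((\<lambda>b. 2 * pi * cross (drift \<epsilon> (Q a)) (b - a)) \<longlongrightarrow> 0) (at a)"
        unfolding cross_def by (auto intro!: tendsto_eq_intros)
      ultimately show "((\<lambda>b. \<phi> b - \<phi> a) \<longlongrightarrow> 0) (at a)"
        using tendsto_add[of "\<lambda>b. \<phi> b - \<phi> a - 2 * pi * cross (drift \<epsilon> (Q a)) (b - a)" 0 "at a"]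
            by fastforce
    qed
    then show ?thesis by (simp add: continuous_on_def)
  qed
  let ?box = "cbox 0 (Complex (2 * pi) (2 * pi))"
  have "0 \<in> ?box" by (simp add: in_cbox_complex_iff)
  then have "?box \<noteq> {}" by blast
  from continuous_attains_sup[OF compact_cbox this continuous_on_subset[OF cont subset_UNIV]]
  obtain a where a: "a \<in> ?box" "\<And>b. b \<in> ?box \<Longrightarrow> \<phi> b \<le> \<phi> a" by blast
  have max: "\<phi> b \<le> \<phi> a" for b
  proof -
    obtain x where x: "x \<in> {0..2 * pi}" "\<phi> (Complex x (Im b)) = \<phi> (Complex (Re b) (Im b))"
    proof (rule periodic_representative[where u = "\<lambda>x. \<phi> (Complex x (Im b))"])
      have "Complex (s + 2 * pi) (Im b) = Complex s (Im b) + of_real (2 * pi)" for s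
        by (simp add: complex_eq_iff)
      then show "\<phi> (Complex (s + 2 * pi) (Im b)) = \<phi> (Complex s (Im b))" for s
        using per(1)[of "Complex s (Im b)"] by simp
    qed
    obtain y where y: "y \<in> {0..2 * pi}" "\<phi> (Complex x y) = \<phi> (Complex x (Im b))"
    proof (rule periodic_representative[where u = "\<lambda>y. \<phi> (Complex x y)"])
      have "Complex x (s + 2 * pi) = Complex x s + \<i> * of_real (2 * pi)" for s
          by (simp add: complex_eq_iff)
      then show "\<phi> (Complex x (s + 2 * pi)) = \<phi> (Complex x s)" for s
        using per(2)[of "Complex x s"] by simp
    qed
    have "Complex x y \<in> ?box" using x(1) y(1) by (simp add: in_cbox_complex_iff)
    then show ?thesis using a(2) x(2) y(2) by (metis complex_surj)
  qed
  have "drift \<epsilon> (Q a) = 0"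
  proof (rule ccontr)
    assume "drift \<epsilon> (Q a) \<noteq> 0"
    define c where "c = drift \<epsilon> (Q a)"
    have c: "norm c > 0" using \<open>drift \<epsilon> (Q a) \<noteq> 0\<close> by (simp add: c_def)
    \<comment> \<open>Any positive \<open>t\<close> with \<open>3 C t < 1\<close> would do.\<close>
    define t where "t = 1 / (6 * (C + 1))"
    have t: "t > 0" "3 * C * t < 1" using C0 by (auto simp: t_def divide_simps)
    define b where "b = a + t *\<^sub>R (\<i> * c)"
    have ba: "b - a = t *\<^sub>R (\<i> * c)" by (simp add: b_def)
    have nb: "norm (b - a) = t * norm c" using t by (simp add: ba norm_mult)
    have cr: "cross c (b - a) = t * (norm c)\<^sup>2" unfolding ba cross_scaleR_right cross_rotate ..
    from diff[of b a] have "2 * pi * (t * (norm c)\<^sup>2) - (\<phi> b - \<phi> a) \<le> pi * norm c * (t * norm c)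
        + 3 * pi * C * (t * norm c)\<^sup>2"
      unfolding c_def[symmetric] cr nb by linarith
    then have "2 * pi * (t * (norm c)\<^sup>2) \<le> pi * norm c * (t * norm c) + 3 * pi * C * (t * norm c)\<^sup>2"
      using max[of b] by linarith
    then have "(pi * t * (norm c)\<^sup>2) * 1 \<le> (pi * t * (norm c)\<^sup>2) * (3 * C * t)"
      by (simp add: power2_eq_square algebra_simps)
    moreover have "pi * t * (norm c)\<^sup>2 > 0" using t c by simp
    ultimately have "1 \<le> 3 * C * t" by (simp only: mult_le_cancel_left_pos)
    then show False using t by simp
  qed
  then show thesis using that Q(1) by blast
qed

end

section \<open>Periodic orbits on low energy levels\<close>

lemma cis_periodic: "cis (x + 2 * pi) = cis x"
  by (simp add: cis_mult[symmetric])

lemma doubly_periodic_representative: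
  fixes G :: "real \<times> real \<Rightarrow> 'b"
  assumes "\<And>x y. G (x + 2 * pi, y) = G (x, y)" "\<And>x y. G (x, y + 2 * pi) = G (x, y)"
  obtains r where "r \<in> cbox (0, 0) (2 * pi, 2 * pi)" "G r = G p"
proof -
  obtain x y where p: "p = (x, y)" by (cases p)
  obtain x' where x': "x' \<in> {0..2 * pi}" "G (x', y) = G (x, y)"
    by (rule periodic_representative[where u = "\<lambda>x. G (x, y)", OF assms(1)])
  obtain y' where y': "y' \<in> {0..2 * pi}" "G (x', y') = G (x', y)"
    by (rule periodic_representative[where u = "\<lambda>y. G (x', y)", OF assms(2)])
  show thesis
    by (rule that[of "(x', y')"]) (use x' y' p in \<open>auto simp: cbox_Pair_eq\<close>)
qed

text \<open>
  The lift of \<open>F\<close> and its derivative are doubly periodic, so their extreme values are attained on a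
  compact square.
\<close>

lemma field_bounds_exist:
  assumes F: "smooth_on_torus F" and pos: "\<forall>z\<in>torus. F z > 0"
  obtains m M L where "field_bounds (\<lambda>z. F (cis (Re z), cis (Im z))) m M L"
proof -
  define g where "g = torus_lift F"
  have Ck: "Ck_on k g UNIV" for k using F by (simp add: g_def smooth_on_torus_def smooth_on_def)
  define D where "D p = frechet_derivative g (at p)" for p
  have dg: "(g has_derivative D p) (at p)" for p
    unfolding D_def by (rule Ck_on_Suc_has_derivative[OF Ck[of "Suc 0"]]) simp
  have cD: "continuous_on S (\<lambda>p. D p h)" for h S
  proof -
    have "continuous_on UNIV (\<lambda>p. D p h)"
      unfolding D_def using Ck[of "Suc 0", unfolded Ck_on.simps] by blast
    then show ?thesis by (rule continuous_on_subset) simp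
  qed
  have cg: "continuous_on S g" for S
    using Ck_on_continuous[OF Ck[of 0]] continuous_on_subset by blast
  have gp: "g (x + 2 * pi, y) = g (x, y)" "g (x, y + 2 * pi) = g (x, y)" for x y
    by (simp_all add: g_def cis_periodic)
  have Dshift: "D (p + c) = D p" if c: "\<And>p. g (p + c) = g p" for p c
  proof -
    have "((\<lambda>p. p + c) has_derivative (\<lambda>h. h)) (at p)" by (auto intro!: derivative_eq_intros)
    from has_derivative_compose[OF this dg] have "(g has_derivative D (p + c)) (at p)" by (simp add: c)
    then show ?thesis using dg has_derivative_unique by blast
  qed
  have Dp: "D (x + 2 * pi, y) = D (x, y)" "D (x, y + 2 * pi) = D (x, y)" for x y
  proof -
    have "D ((x, y) + (2 * pi, 0)) = D (x, y)" by (rule Dshift) (metis add_Pair add_0_right gp(1)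
        surj_pair)
    then show "D (x + 2 * pi, y) = D (x, y)" by simp
    have "D ((x, y) + (0, 2 * pi)) = D (x, y)" by (rule Dshift) (metis add_Pair add_0_right gp(2)
        surj_pair)
    then show "D (x, y + 2 * pi) = D (x, y)" by simp
  qed
  let ?box = "cbox (0, 0) (2 * pi, 2 * pi) :: (real \<times> real) set"
  have "(0, 0) \<in> ?box" by (simp add: cbox_Pair_eq)
  then have ne: "?box \<noteq> {}" by blast
  obtain p1 where p1: "\<And>p. p \<in> ?box \<Longrightarrow> g p1 \<le> g p"
    using continuous_attains_inf[OF compact_cbox ne cg] by blast
  obtain p2 where p2: "\<And>p. p \<in> ?box \<Longrightarrow> g p \<le> g p2"
    using continuous_attains_sup[OF compact_cbox ne cg] by blast
  define N where "N p = \<bar>D p (1, 0)\<bar> + \<bar>D p (0, 1)\<bar>" for p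
  have "continuous_on ?box N" unfolding N_def by (intro continuous_intros cD)
  then obtain p3 where p3: "\<And>p. p \<in> ?box \<Longrightarrow> N p \<le> N p3"
    using continuous_attains_sup[OF compact_cbox ne] by blast
  have lower: "g p1 \<le> g p" and upper: "g p \<le> g p2" for p
    using doubly_periodic_representative[where G = g, OF gp, of p] p1 p2 by metis+
  have Np: "N (x + 2 * pi, y) = N (x, y)" "N (x, y + 2 * pi) = N (x, y)" for x y
      by (simp_all add: N_def Dp)
  have N: "N p \<le> N p3" for p
    using doubly_periodic_representative[where G = N, OF Np, of p] p3 by metis
  have Dle: "\<bar>D p h\<bar> \<le> N p3 * norm h" for p h
  proof -
    have lin: "linear (D p)" using dg has_derivative_linear by blast
    have "h = fst h *\<^sub>R (1, 0) + snd h *\<^sub>R (0, 1)" by (simp add: prod_eq_iff)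
    then have "D p h = fst h *\<^sub>R D p (1, 0) + snd h *\<^sub>R D p (0, 1)"
      by (metis linear_add[OF lin] linear_cmul[OF lin])
    then have "\<bar>D p h\<bar> \<le> \<bar>fst h\<bar> * \<bar>D p (1, 0)\<bar> + \<bar>snd h\<bar> * \<bar>D p (0, 1)\<bar>"
      by (metis abs_mult abs_triangle_ineq real_scaleR_def)
    also have "\<dots> \<le> norm h * \<bar>D p (1, 0)\<bar> + norm h * \<bar>D p (0, 1)\<bar>"
      using norm_fst_le[of "fst h" "snd h"] norm_snd_le[of "snd h" "fst h"]
          by (intro add_mono mult_right_mono) auto
    also have "\<dots> = N p * norm h" by (simp add: N_def algebra_simps)
    also have "\<dots> \<le> N p3 * norm h" by (intro mult_right_mono N) auto
    finally show ?thesis .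
  qed
  have lip: "norm (g p - g p') \<le> N p3 * norm (p - p')" for p p'
  proof (rule differentiable_bound[OF convex_UNIV])
    show "(g has_derivative D z) (at z)" for z by (rule dg)
    show "onorm (D z) \<le> N p3" for z
      by (rule onorm_bound) (use Dle in \<open>auto simp: N_def\<close>)
  qed auto
  have "field_bounds (\<lambda>z. F (cis (Re z), cis (Im z))) (g p1) (g p2) (N p3)"
  proof
    show "g p1 > 0" using pos by (simp add: g_def torus_def)
    show "N p3 \<ge> 0" by (simp add: N_def)
    fix z w
    show "g p1 \<le> F (cis (Re z), cis (Im z))" using lower[of "(Re z, Im z)"] by (simp add: g_def)
    show "F (cis (Re z), cis (Im z)) \<le> g p2" using upper[of "(Re z, Im z)"] by (simp add: g_def)
    have "norm ((Re z, Im z) - (Re w, Im w)) = norm (z - w)" by (simp add: norm_Pair cmod_def)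
    then show "\<bar>F (cis (Re z), cis (Im z)) - F (cis (Re w), cis (Im w))\<bar> \<le> N p3 * norm (z - w)"
      using lip[of "(Re z, Im z)" "(Re w, Im w)"] by (simp add: g_def)
  qed
  then show thesis by (rule that)
qed

text \<open>
  The inverse \<open>\<psi>\<close> of an antiderivative of \<open>h\<close>, used with \<open>h = 1 / f(q)\<close>, the absolute value of
  \<open>dt/d\<theta>\<close>. The integral of \<open>h\<close> over a period is then the period of the orbit.
\<close>

lemma time_change:
  fixes h :: "real \<Rightarrow> real"
  assumes h: "continuous_on UNIV h" and c: "c > 0" "\<And>x. c \<le> h x" and p: "p \<ge> 0"
    and per: "\<And>x. h (x + p) = h x"
  obtains \<psi> where "\<And>t. (\<psi> has_real_derivative 1 / h (\<psi> t)) (at t)"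
    "\<And>t. \<psi> (t + integral {0..p} h) = \<psi> t + p"
proof -
  define \<tau> where "\<tau> = primitive h"
  have d\<tau>: "(\<tau> has_real_derivative h x) (at x)" for x
    unfolding \<tau>_def vector_deriv_iff
        by (rule primitive_has_vector_derivative[OF h])
  have grow: "c * (y - x) \<le> \<tau> y - \<tau> x" if "x \<le> y" for x y
  proof (cases "x = y")
    case False
    then have "x < y" using that by simp
    from MVT2[OF this d\<tau>] obtain z where "\<tau> y - \<tau> x = (y - x) * h z" by blast
    moreover have "c * (y - x) \<le> h z * (y - x)" using c(2)[of z] that by (intro mult_right_mono) auto
    ultimately show ?thesis by (simp add: mult.commute)
  qed simp
  have \<tau>0: "\<tau> 0 = 0" by (simp add: \<tau>_def primitive_0)
  have cont: "isCont \<tau> x" for x using d\<tau> by (rule DERIV_isCont)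
  have "\<exists>x. \<tau> x = t" for t
  proof (cases "t \<ge> 0")
    case True
    have "t \<le> \<tau> (t / c)" using grow[of 0 "t / c"] True c by (simp add: \<tau>0)
    then show ?thesis using IVT[of \<tau> 0 t "t / c"] True c cont by (auto simp: \<tau>0)
  next
    case False
    have "\<tau> (t / c) \<le> t" using grow[of "t / c" 0] False c by (simp add: \<tau>0 divide_simps)
    then show ?thesis using IVT[of \<tau> "t / c" t 0] False c cont by (auto simp: \<tau>0 divide_simps)
  qed
  then obtain \<psi> where \<psi>: "\<And>t. \<tau> (\<psi> t) = t" by metis
  have inj: "x = y" if "\<tau> x = \<tau> y" for x y
  proof (rule ccontr)
    assume "x \<noteq> y"
    then consider "x < y" | "y < x" by linarith
    then show False
    proof cases
      case 1
      then have "0 < c * (y - x)" using c(1) by simp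
      then show False using grow[of x y] 1 that by linarith
    next
      case 2
      then have "0 < c * (x - y)" using c(1) by simp
      then show False using grow[of y x] 2 that by linarith
    qed
  qed
  have lip: "\<bar>\<psi> s - \<psi> t\<bar> \<le> 1 / c * \<bar>s - t\<bar>" for s t
  proof -
    have "c * \<bar>\<psi> s - \<psi> t\<bar> \<le> \<bar>s - t\<bar>"
      using grow[of "\<psi> s" "\<psi> t"] grow[of "\<psi> t" "\<psi> s"] unfolding \<psi> by (cases "\<psi> s \<le> \<psi> t") auto
    then show ?thesis using c(1) by (simp add: field_simps)
  qed
  have "(1 / c)-lipschitz_on UNIV \<psi>"
    by (rule lipschitz_onI) (use lip c in \<open>auto simp: dist_real_def\<close>)
  then have cont\<psi>: "isCont \<psi> t" for t
    using lipschitz_on_continuous_on continuous_on_eq_continuous_at[OF open_UNIV] by blast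
  have "(\<psi> has_real_derivative inverse (h (\<psi> t))) (at t)" for t
    by (rule DERIV_inverse_function[OF d\<tau>, where g = \<psi> and a = "t - 1" and b = "t + 1"])
       (use \<psi> c(2)[of "\<psi> t"] c(1) cont\<psi> in auto)
  moreover have "\<psi> (t + integral {0..p} h) = \<psi> t + p" for t
  proof (rule inj)
    have "((\<lambda>x. \<tau> (x + p)) has_vector_derivative h x) (at x)" for x
      using DERIV_shift[of \<tau> "h x" x p] d\<tau>[of "x + p"] by (simp add: per
          vector_deriv_iff)
    from eq_primitive[OF h this, of "\<psi> t"] have "\<tau> (\<psi> t + p) = \<tau> p + t"
      using \<psi>[of t] by (simp add: \<tau>_def)
    moreover have "(h has_integral (\<tau> p - \<tau> 0)) {0..p}"
      by (rule fundamental_theorem_of_calculus[OF p])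
        (use d\<tau> in \<open>auto simp: vector_deriv_iff intro:
            has_vector_derivative_at_within\<close>)
    then have "integral {0..p} h = \<tau> p" by (simp add: \<tau>0 integral_unique)
    ultimately show "\<tau> (\<psi> (t + integral {0..p} h)) = \<tau> (\<psi> t + p)" by (simp add: \<psi>)
  qed
  ultimately show thesis using that[of \<psi>] by (simp add: inverse_eq_divide)
qed

lemma frechet_derivative_kinetic_energy:
  "frechet_derivative kinetic_energy (at x) Y = fst (snd x) * fst (snd Y) + snd (snd x) * snd (snd Y)"
proof -
  have "(kinetic_energy has_derivative (\<lambda>Y. fst (snd x) * fst (snd Y) + snd (snd x) * snd (snd Y)))
      (at x)"
    unfolding kinetic_energy_def[abs_def]
    by (auto intro!: derivative_eq_intros simp: power2_eq_square)
  from fun_cong[OF frechet_derivative_at[OF this], of Y] show ?thesis by (rule sym)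
qed

text \<open>
  In complex notation Hamilton's equations for the twisted form read \<open>q' = p\<close> and
  \<open>p' = - F(q) \<i> p\<close>.
\<close>

lemma magnetic_trajectory_of_ode:
  assumes q: "\<And>t. (q has_vector_derivative p t) (at t)"
    and p: "\<And>t. (p has_vector_derivative - (F (cis (Re (q t)), cis (Im (q t))) *\<^sub>R (\<i> * p t))) (at t)"
  shows "magnetic_trajectory F (\<lambda>t. phase_point (q t) (p t))"
  unfolding magnetic_trajectory_def
proof (intro conjI allI)
  fix t
  show "phase_point (q t) (p t) \<in> cotangent_torus" by (simp add: phase_point_def cotangent_torus_def
      torus_def)
  define B where "B = F (cis (Re (q t)), cis (Im (q t)))"
  define X where "X = ((Re (p t) *\<^sub>R (\<i> * cis (Re (q t))), Im (p t) *\<^sub>R (\<i> * cis (Im (q t)))), (B *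
      Im (p t), - (B * Re (p t))))"
  have "is_hamiltonian_vector F kinetic_energy (phase_point (q t) (p t)) X"
    unfolding is_hamiltonian_vector_def
  proof (intro conjI ballI)
    show "X \<in> tangent_space (phase_point (q t) (p t))"
      by (simp add: tangent_space_def X_def phase_point_def inner_complex_def)
    fix Y
    have "dq1 (fst (phase_point (q t) (p t))) (fst X) = Re (p t)" "dq2 (fst (phase_point (q t) (p
        t))) (fst X) = Im (p t)"
      unfolding dq1_def dq2_def phase_point_def X_def by (simp_all only: fst_conv snd_conv
          cnj_cis_tangent) simp_all
    then show "twisted_form F (phase_point (q t) (p t)) X Y = - frechet_derivative kinetic_energy
        (at (phase_point (q t) (p t))) Y"
      unfolding twisted_form_def canonical_form_def magnetic_form_def wedge_def
          frechet_derivative_kinetic_energy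
      by (simp add: X_def phase_point_def dp1_def dp2_def B_def[symmetric] algebra_simps)
  qed
  moreover have "((\<lambda>t. phase_point (q t) (p t)) has_vector_derivative X) (at t)"
  proof -
    have dq: "(q has_derivative (\<lambda>h. h *\<^sub>R p t)) (at t)"
      using q unfolding has_vector_derivative_def .
    have dp: "(p has_derivative (\<lambda>h. h *\<^sub>R - (B *\<^sub>R (\<i> * p t)))) (at t)"
      using p unfolding has_vector_derivative_def B_def .
    have "((\<lambda>t. phase_point (q t) (p t)) has_derivative (\<lambda>h. ((Re (h *\<^sub>R p t) *\<^sub>R (\<i> * cis (Re (q
        t))), Im (h *\<^sub>R p t) *\<^sub>R (\<i> * cis (Im (q t)))),
        (Re (h *\<^sub>R - (B *\<^sub>R (\<i> * p t))), Im (h *\<^sub>R - (B *\<^sub>R (\<i> * p t))))))) (at t)"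
      unfolding phase_point_def
      by (intro has_derivative_Pair has_derivative_cis has_derivative_Re has_derivative_Im dq dp)
    then show ?thesis unfolding has_vector_derivative_def X_def
      by (rule has_derivative_eq_rhs) (simp add: fun_eq_iff)
  qed
  ultimately show "\<exists>X. is_hamiltonian_vector F kinetic_energy (phase_point (q t) (p t)) X \<and>
     ((\<lambda>t. phase_point (q t) (p t)) has_vector_derivative X) (at t)" by blast
qed

text \<open>
  A loop that lifts to a loop in the plane is contracted there along straight lines.
\<close>

lemma contractible_loop_of_lift:
  assumes T: "\<And>t. q (t + T) = q t" "\<And>t. p (t + T) = p t" and cont: "continuous_on UNIV q"
      "continuous_on UNIV p"
  shows "contractible_loop T (\<lambda>t. phase_point (q t) (p t))"
proof -
  define l where "l s = (q (T * s), p (T * s))" for s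
  have "path l" unfolding path_def l_def
    by (intro continuous_intros continuous_on_compose2[OF cont(1)] continuous_on_compose2[OF
        cont(2)]) auto
  moreover have "pathfinish l = pathstart l"
    using T(1)[of 0] T(2)[of 0] by (simp add: pathfinish_def pathstart_def l_def)
  ultimately have "homotopic_loops UNIV l (\<lambda>_. l 0)"
    by (intro homotopic_loops_linear) (auto simp: path_def pathfinish_def pathstart_def)
  moreover have "continuous_on UNIV (\<lambda>y. phase_point (fst y) (snd y))"
    unfolding phase_point_def by (intro continuous_intros)
  moreover have "(\<lambda>y. phase_point (fst y) (snd y)) \<in> UNIV \<rightarrow> cotangent_torus"
    by (auto simp: phase_point_def cotangent_torus_def torus_def)
  ultimately have "homotopic_loops cotangent_torus ((\<lambda>y. phase_point (fst y) (snd y)) \<circ> l) ((\<lambda>y.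
      phase_point (fst y) (snd y)) \<circ> (\<lambda>_. l 0))"
    by (rule homotopic_loops_continuous_image)
  then have "homotopic_loops cotangent_torus (\<lambda>s. phase_point (q (T * s)) (p (T * s)))
      (\<lambda>_. phase_point (q 0) (p 0))"
    by (simp add: l_def o_def)
  then show ?thesis unfolding contractible_loop_def by blast
qed

theorem theorem2p10:
  fixes F :: "complex \<times> complex \<Rightarrow> real"
  assumes smooth: "smooth_on_torus F"
    and pos: "\<forall>z\<in>torus. F z > 0"
    and ratio: "(SUP z\<in>torus. F z) / (INF z\<in>torus. F z) < sqrt (pi / 2)"
  shows "\<exists>E0>0. \<exists>K>0. \<forall>E. 0 < E \<and> E < E0 \<longrightarrow>
           (\<exists>x T. periodic_orbit F T x \<and> (\<forall>t. kinetic_energy (x t) = E) \<and>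
                  contractible_loop T x \<and>
                  (\<exists>A. has_symplectic_area F T x A \<and> \<bar>A\<bar> \<le> K))"
proof -
  define f where "f z = F (cis (Re z), cis (Im z))" for z
  obtain m M L where fb: "field_bounds f m M L"
    unfolding f_def[abs_def] by (rule field_bounds_exist[OF smooth pos])
  have Fk: "Ck_on k (torus_lift F) UNIV" for k using smooth by (simp add: smooth_on_torus_def
      smooth_on_def)
  obtain A2 where A2: "continuous_on UNIV A2"
     "\<And>p. (x_primitive (torus_lift F) has_derivative (\<lambda>h. torus_lift F p * fst h + A2 p * snd h))
         (at p)"
    by (rule x_primitive_has_derivative[OF Fk]) blast
  interpret magnetic_action f m M L "x_primitive (torus_lift F)" A2
    using fb
    by (rule magnetic_action.intro, unfold_locales)
      (use A2 in \<open>simp_all add: f_def x_primitive_def cis_periodic\<close>)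
  have Fbound: "\<bar>F z\<bar> \<le> M" if "z \<in> torus" for z
  proof -
    obtain z1 z2 where z: "z = (z1, z2)" by (cases z)
    then have n: "norm z1 = 1" "norm z2 = 1" using that by (simp_all add: torus_def)
    then have "z1 \<noteq> 0" "z2 \<noteq> 0" by auto
    then have "cis (Arg z1) = z1" "cis (Arg z2) = z2" using n by (simp_all add: cis_Arg sgn_eq)
    then have "F z = f (Complex (Arg z1) (Arg z2))" by (simp add: f_def z)
    then show ?thesis using f_upper f_pos by (simp add: less_imp_le)
  qed
  obtain K where K: "K \<ge> 0"
    and area: "\<And>T q p q' p' a B. bounded_loop T a B q q' p p' \<Longrightarrow>
     \<exists>A. has_symplectic_area F T (\<lambda>t. phase_point (q t) (p t)) A \<and> \<bar>A\<bar> \<le> K * B\<^sup>2"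
    by (rule symplectic_area_bound[OF smooth, where M = M]) (use Fbound in blast)+
  \<comment> \<open>Chosen so that \<open>2\<pi> e0 velocity_lipschitz \<le> 1/3\<close>, the contraction condition.\<close>
  define e0 where "e0 = 1 / (6 * pi * (velocity_lipschitz + 1))"
  have e0: "e0 > 0" using velocity_lipschitz_nonneg by (simp add: e0_def)
  \<comment> \<open>The summands bound, in this order, the momentum, the distance to the starting point, and the
    derivatives of position and momentum after rescaling the period to \<open>1\<close>.\<close>
  define B where "B = e0 * (1 + 4 * pi / m + 2 * pi / m + 2 * pi * M / m)"
  have orbit: "\<exists>x T. periodic_orbit F T x \<and> (\<forall>t. kinetic_energy (x t) = E) \<and>
                  contractible_loop T x \<and> (\<exists>A. has_symplectic_area F T x A \<and> \<bar>A\<bar> \<le> K * B\<^sup>2 + 1)"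
    if E: "0 < E" "E < e0\<^sup>2 / 2" for E
  proof -
    define \<epsilon> where "\<epsilon> = sqrt (2 * E)"
    have \<epsilon>: "\<epsilon> > 0" "\<epsilon> \<le> e0" "\<epsilon>\<^sup>2 = 2 * E"
      using E e0 by (auto simp: \<epsilon>_def intro!: real_le_lsqrt)
    have small: "2 * pi * (\<epsilon> * velocity_lipschitz) \<le> 1 / 3"
    proof -
      have "\<epsilon> * velocity_lipschitz \<le> e0 * (velocity_lipschitz + 1)"
        using \<epsilon> velocity_lipschitz_nonneg by (intro mult_mono) auto
      then have "2 * pi * (\<epsilon> * velocity_lipschitz) \<le> 2 * pi * (e0 * (velocity_lipschitz + 1))" by simp
      also have "\<dots> = 1 / 3" using velocity_lipschitz_nonneg by (simp add: e0_def divide_simps)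
      finally show ?thesis .
    qed
    obtain q where q: "solution \<epsilon> q" "drift \<epsilon> q = 0"
      using drift_free_solution[OF less_imp_le[OF \<epsilon>(1)] small] by blast
    have qper: "q (\<theta> + 2 * pi) = q \<theta>" and dq: "(q has_vector_derivative velocity \<epsilon> q \<theta>) (at \<theta>)" for \<theta>
      using q(1) by (auto simp: solution_def)
    have cq: "continuous_on S q" for S using solution_cont[OF q(1)] .
    have vel: "velocity \<epsilon> q \<theta> = - ((\<epsilon> / f (q \<theta>)) *\<^sub>R cis \<theta>)" for \<theta>
      using q(2) by (simp add: velocity_def)
    obtain \<psi> where d\<psi>: "\<And>t. (\<psi> has_real_derivative 1 / (1 / f (q (\<psi> t)))) (at t)"
      and \<psi>per: "\<And>t. \<psi> (t + mass q) = \<psi> t + 2 * pi"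
      unfolding mass_def
      by (rule time_change[of "\<lambda>\<theta>. 1 / f (q \<theta>)" "1 / M" "2 * pi"])
          (use recip_cont[OF cq] recip_bounds(1) M_pos qper in auto)
    define T where "T = mass q"
    have T: "T > 0" "T \<le> 2 * pi / m"
    proof -
      show "T > 0" unfolding T_def by (rule mass_pos[OF cq])
      have "mass q \<le> integral {0..2 * pi} (\<lambda>_::real. 1 / m)" unfolding mass_def
        by (intro integral_le integrable_continuous_real recip_cont cq continuous_intros recip_bounds)
      then show "T \<le> 2 * pi / m" by (simp add: T_def)
    qed
    \<comment> \<open>Time runs backwards because \<open>\<theta>\<close> decreases along orbits.\<close>
    define \<theta> where "\<theta> t = \<psi> (- t)" for t
    define Q where "Q t = q (\<theta> t)" for t
    define p where "p t = \<epsilon> *\<^sub>R cis (\<theta> t)" for t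
    have d\<theta>: "(\<theta> has_vector_derivative - f (Q t)) (at t)" for t
    proof -
      have "((\<lambda>t. \<psi> (- t)) has_real_derivative (1 / (1 / f (q (\<psi> (- t))))) * (- 1)) (at t)"
        by (rule DERIV_chain2[OF d\<psi>]) (auto intro!: derivative_eq_intros)
      then show ?thesis
        unfolding vector_deriv_iff \<theta>_def Q_def by simp
    qed
    have \<theta>per: "cis (\<theta> (t + T)) = cis (\<theta> t)" "q (\<theta> (t + T)) = q (\<theta> t)" for t
    proof -
      have "\<theta> t = \<theta> (t + T) + 2 * pi" using \<psi>per[of "- t - T"] by (simp add: \<theta>_def T_def)
      then show "cis (\<theta> (t + T)) = cis (\<theta> t)" "q (\<theta> (t + T)) = q (\<theta> t)"
          by (simp_all add: cis_periodic qper)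
    qed
    have perQ: "Q (t + T) = Q t" and perp: "p (t + T) = p t" for t
      by (simp_all add: Q_def p_def \<theta>per)
    have dQ: "(Q has_vector_derivative p t) (at t)" for t
      using vector_diff_chain_at[OF d\<theta>[of t] dq[of "\<theta> t"]] f_pos[of "Q t"]
      by (simp add: o_def Q_def[abs_def] p_def vel)
    have dp: "(p has_vector_derivative - (f (Q t) *\<^sub>R (\<i> * p t))) (at t)" for t
    proof -
      have "((\<lambda>t. cis (\<theta> t)) has_derivative (\<lambda>h. (h *\<^sub>R - f (Q t)) *\<^sub>R (\<i> * cis (\<theta> t)))) (at t)"
        using d\<theta>[of t] unfolding has_vector_derivative_def by (rule has_derivative_cis)
      then have "((\<lambda>t. \<epsilon> *\<^sub>R cis (\<theta> t)) has_derivative (\<lambda>h. \<epsilon> *\<^sub>R ((h *\<^sub>R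
          - f (Q t)) *\<^sub>R (\<i> * cis (\<theta> t))))) (at t)"
        by (rule has_derivative_scaleR_right)
      then show ?thesis unfolding has_vector_derivative_def p_def[abs_def]
        by (rule has_derivative_eq_rhs) (simp add: fun_eq_iff)
    qed
    have np: "norm (p t) = \<epsilon>" for t using \<epsilon>(1) by (simp add: p_def)
    have contQ: "continuous_on UNIV Q" and contp: "continuous_on UNIV p"
      using dQ dp by (meson continuous_at_imp_continuous_on has_vector_derivative_continuous)+
    have Ckf: "Ck_on k f UNIV" for k
    proof -
      have "Ck_on k (\<lambda>z::complex. (Re z, Im z)) UNIV"
        by (intro Ck_on_bounded_linear bounded_linear_Pair bounded_linear_Re bounded_linear_Im
            open_UNIV)
      from Ck_on_compose[OF open_UNIV open_UNIV subset_UNIV Fk this] show ?thesis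
          by (simp add: f_def[abs_def])
    qed
    \<comment> \<open>Smoothness of the orbit follows from the autonomous system for position and momentum.\<close>
    define G where "G y = (snd y, - (f (fst y) *\<^sub>R (\<i> * snd y)))" for y
    have "Ck_on k G UNIV" for k
    proof -
      note fst = Ck_on_bounded_linear[OF bounded_linear_fst open_UNIV]
      note snd = Ck_on_bounded_linear[OF bounded_linear_snd open_UNIV]
      have "Ck_on k (\<lambda>y::complex \<times> complex. f (fst y) *\<^sub>R (\<i> * snd y)) UNIV"
        by (rule Ck_on_scaleR[OF open_UNIV Ck_on_compose[OF open_UNIV open_UNIV subset_UNIV Ckf fst]
              Ck_on_linear_compose[OF bounded_linear_mult_right open_UNIV snd]])
      from Ck_on_Pair[OF open_UNIV snd Ck_on_linear_compose[OF bounded_linear_minus[OF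
          bounded_linear_ident] open_UNIV this]]
      show ?thesis by (simp add: G_def[abs_def])
    qed
    moreover have "((\<lambda>t. (Q t, p t)) has_vector_derivative G (Q t, p t)) (at t)" for t
      using has_vector_derivative_Pair[OF dQ dp] by (simp add: G_def)
    ultimately have Cky: "Ck_on k (\<lambda>t. (Q t, p t)) UNIV" for k by (rule Ck_on_ode)
    have CkQ: "Ck_on k Q UNIV" and Ckp: "Ck_on k p UNIV" for k
      using Ck_on_linear_compose[OF bounded_linear_fst open_UNIV Cky] Ck_on_linear_compose[OF
          bounded_linear_snd open_UNIV Cky] by auto
    have QB: "norm (Q t - q 0) \<le> \<epsilon> * (4 * pi / m)" for t
    proof -
      obtain r where r: "r \<in> {0..2 * pi}" "q r = q (\<theta> t)"
        by (rule periodic_representative[where u = q, OF qper])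
      have "norm (primitive (velocity \<epsilon> q) r - primitive (\<lambda>_. 0) r) \<le> (2 * \<epsilon> / m) * \<bar>r\<bar>"
        by (rule primitive_diff_bound) (use velocity_le[OF cq less_imp_le[OF \<epsilon>(1)]] velocity_cont[OF
            cq] in auto)
      also have "\<dots> \<le> (2 * \<epsilon> / m) * (2 * pi)" using r(1) \<epsilon>(1) m by (intro mult_left_mono) auto
      also have "\<dots> = \<epsilon> * (4 * pi / m)" by simp
      also have "primitive (\<lambda>_. 0 :: complex) r = 0" by (simp add: primitive_def)
      finally have "norm (primitive (velocity \<epsilon> q) r) \<le> \<epsilon> * (4 * pi / m)" by simp
      moreover have "q r = q 0 + primitive (velocity \<epsilon> q) r" by (rule eq_primitive[OF
          velocity_cont[OF cq] dq])
      ultimately show ?thesis using r(2) by (simp add: Q_def)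
    qed
    have le_B: "\<epsilon> * s \<le> B" if "0 \<le> s" "s \<le> 1 + 4 * pi / m + 2 * pi / m + 2 * pi * M / m" for s
      unfolding B_def using \<epsilon> that by (intro mult_mono) auto
    have terms: "0 \<le> 4 * pi / m" "0 \<le> 2 * pi / m" "0 \<le> 2 * pi * M / m" using m M_pos by auto
    have "\<exists>A. has_symplectic_area F T (\<lambda>t. phase_point (Q t) (p t)) A \<and> \<bar>A\<bar> \<le> K * B\<^sup>2"
    proof (rule area[of T "q 0" B Q p p "\<lambda>t. - (f (Q t) *\<^sub>R (\<i> * p t))"],
        unfold bounded_loop_def, intro conjI allI T(1) CkQ Ckp perQ perp dQ dp)
      show "norm (Q t - q 0) \<le> B" for t using QB[of t] le_B[of "4 * pi / m"] terms by linarith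
      show "norm (p t) \<le> B" for t using np[of t] le_B[of 1] terms by linarith
      show "T * norm (p t) \<le> B" for t
      proof -
        have "\<epsilon> * T \<le> \<epsilon> * (2 * pi / m)" by (rule mult_left_mono[OF T(2)]) (use \<epsilon>(1) in simp)
        then have "\<epsilon> * T \<le> B" using le_B[of "2 * pi / m"] terms by linarith
        then show ?thesis by (simp add: np mult.commute)
      qed
      show "T * norm (- (f (Q t) *\<^sub>R (\<i> * p t))) \<le> B" for t
      proof -
        have "T * (f (Q t) * \<epsilon>) \<le> (2 * pi / m) * (M * \<epsilon>)"
          using T \<epsilon>(1) f_upper[of "Q t"] f_pos[of "Q t"] m M_pos by (intro mult_mono) auto
        also have "\<dots> = \<epsilon> * (2 * pi * M / m)" by simp
        also have "\<dots> \<le> B" using le_B[of "2 * pi * M / m"] terms by linarith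
        finally show ?thesis using f_pos[of "Q t"] by (simp add: norm_mult np)
      qed
    qed
    then have "\<exists>A. has_symplectic_area F T (\<lambda>t. phase_point (Q t) (p t)) A \<and> \<bar>A\<bar> \<le> K * B\<^sup>2 + 1"
      by fastforce
    moreover have "periodic_orbit F T (\<lambda>t. phase_point (Q t) (p t))"
      unfolding periodic_orbit_def using T(1) perQ perp
      by (auto intro!: magnetic_trajectory_of_ode dQ dp[unfolded f_def])
    moreover have "kinetic_energy (phase_point (Q t) (p t)) = E" for t
      using np[of t] \<epsilon>(3) cmod_power2[of "p t"] by (simp add: kinetic_energy_def phase_point_def)
    moreover have "contractible_loop T (\<lambda>t. phase_point (Q t) (p t))"
      by (rule contractible_loop_of_lift[OF perQ perp contQ contp])
    ultimately show ?thesis by blast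
  qed
  show ?thesis
    by (rule exI[of _ "e0\<^sup>2 / 2"], intro conjI, use e0 in simp, rule exI[of _ "K * B\<^sup>2 + 1"])
      (use K orbit in \<open>auto intro!: add_nonneg_pos mult_nonneg_nonneg\<close>)
qed

end
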